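(* Let $a<0<b$, let $p\ge4$ be an even integer, let $f$ be analytic in a complex neighbourhood of $[a,b]$, real on $\mathbb R$, with $xf(x)>0$ for $x\in[a,b]\setminus\{0\}$ and $f(x)=p\,x^{p-1}(1+O(x))$ as $x\to0$, and let $P$ be analytic in a neighbourhood of $[a,b]\times\{0\}\times\{0\}\subset\mathbb C^3$, with $P(x,y,\varepsilon)$ real when $x,y,\varepsilon$ are real. Consider, for $\varepsilon=\eta^p$, the equation $$\varepsilon y'=f(x)y+\varepsilon P(x,y,\varepsilon),$$ and let $g_n^-$, $g_n^+$ ($n\ge1$) be the coefficients of the fast parts of the combined asymptotic expansions of its solutions $y^-$ and $y^+$ on the left and on the right of $0$ respectively (see context). The following assertions are equivalent. (a) There exists a local canard. (b) There exists a global canard. (c) For all $n$, $g_n^-\equiv g_n^+$. (d) For all $n$, $g_n^-(0)=g_n^+(0)$.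
   Context: A local canard is a solution $y(x,\varepsilon)$ (a family of solutions indexed by $\varepsilon\in\,]0,\varepsilon_1]$ for some $\varepsilon_1>0$) bounded, uniformly in $\varepsilon$, on some open interval containing $0$ that does not depend on $\varepsilon$. A global canard is a solution bounded, uniformly in $\varepsilon$, on all of $[a,b]$. Notation: $S(\alpha,\beta,r)=\{x\in\mathbb C:0<|x|<r,\alpha<\arg x<\beta\}$, and for $\mu>0$, $V(\alpha,\beta,r,\mu)=\{x:(0<|x|<r,\alpha<\arg x<\beta)\text{ or }|x|<\mu\}$. $\mathcal G(V)$: bounded holomorphic functions $g$ on the infinite quasi-sector $V$ having an asymptotic expansion without constant term $g(X)\sim\sum_{\nu\ge1}g_\nu X^{-\nu}$ as $V\ni X\to\infty$. Definition of $g_n^\pm$. For some small $\delta,\gamma,x_0,\mu,\eta_0>0$ the equation has holomorphic solutions $y^+(x,\eta)$, $\eta\in S(-\delta,\delta,\eta_0)$, $x\in V^+(\eta)=V(-\gamma,\gamma,x_0,\mu|\eta|)$, and $y^-(x,\eta)$, $\eta\in S(-\delta,\delta,\eta_0)$, $x\in V^-(\eta)=-V^+(\eta)$, which have Gevrey combined asymptotic expansions of order $\frac1p$ $$y^\pm(x,\eta)\sim_{1/p}\sum_{n\ge1}\Big(a_n(x)+g_n^\pm\big(\tfrac x\eta\big)\Big)\eta^n,$$ with $a_n$ bounded holomorphic on $D(0,x_0)$ (the same for both signs) and $g_n^\pm\in\mathcal G(\pm V(-\gamma-\delta,\gamma+\delta,\infty,\mu))$. This means: writing $g_n^\pm(X)\sim\sum_{m\ge1}g_{nm}X^{-m}$,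 there are $C,L_1,L_2>0$ such that for all $n,M,N$: $\sup|a_n|\le CL_1^n\Gamma(\frac np+1)$, $|X|^M|g_n^\pm(X)-\sum_{m=1}^{M-1}g_{nm}X^{-m}|\le CL_1^nL_2^M\Gamma(\frac{M+n}p+1)$, and $|y^\pm(x,\eta)-\sum_{1\le n<N}(a_n(x)+g_n^\pm(\frac x\eta))\eta^n|\le CL_1^N\Gamma(\frac Np+1)|\eta|^N$ for $\eta\in S(-\delta,\delta,\eta_0)$, $x\in V^\pm(\eta)$. The functions $a_n,g_n^\pm$ do not depend on the choice of the solutions $y^\pm$. In (c), $g_n^-\equiv g_n^+$ means that the two functions, both holomorphic near $0$, are analytic continuations of each other.
   Formalization: Canards are real-valued, and "bounded" also requires that the closure of the graph of the family stay inside the domain where P is analytic; otherwise P = -f y/(1-y)+y-1+ε on |y|<1, with bounded solutions y = 1-ε, would satisfy (a) and (b) but not (d). *)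

theory Defs
  imports "HOL-Complex_Analysis.Complex_Analysis" "HOL-Library.Landau_Symbols"
begin

text \<open>Holomorphy in two and three complex variables: the total derivative exists at every point
  and is complex linear.\<close>

definition holomorphic2_on :: "(complex \<times> complex \<Rightarrow> complex) \<Rightarrow> (complex \<times> complex) set \<Rightarrow> bool"
  where "holomorphic2_on F U \<longleftrightarrow>
    (\<forall>z\<in>U. \<exists>A B. (F has_derivative (\<lambda>(h, k). A * h + B * k)) (at z within U))"

definition holomorphic3_on ::
  "(complex \<times> complex \<times> complex \<Rightarrow> complex) \<Rightarrow> (complex \<times> complex \<times> complex) set \<Rightarrow> bool"
  where "holomorphic3_on F U \<longleftrightarrow>
    (\<forall>z\<in>U. \<exists>A B C. (F has_derivative (\<lambda>(h, k, l). A * h + B * k + C * l)) (at z within U))"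

text \<open>The argument is the principal one, so the sectors below are the usual ones as long as
  \<open>-pi \<le> \<alpha>\<close> and \<open>\<beta> \<le> pi\<close>. The radius may be infinite.\<close>

definition sector :: "real \<Rightarrow> real \<Rightarrow> ereal \<Rightarrow> complex set"
  where "sector \<alpha> \<beta> r = {x. 0 < norm x \<and> ereal (norm x) < r \<and> \<alpha> < Arg x \<and> Arg x < \<beta>}"

definition quasi_sector :: "real \<Rightarrow> real \<Rightarrow> ereal \<Rightarrow> real \<Rightarrow> complex set"
  where "quasi_sector \<alpha> \<beta> r \<mu> = sector \<alpha> \<beta> r \<union> {x. norm x < \<mu>}"

text \<open>Asymptotic expansion without constant term; the value \<open>c 0\<close> is irrelevant.\<close>

definition asymp_expansion_at_infinity ::
  "(complex \<Rightarrow> complex) \<Rightarrow> (nat \<Rightarrow> complex) \<Rightarrow> complex set \<Rightarrow> bool"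
  where "asymp_expansion_at_infinity g c W \<longleftrightarrow>
    (\<forall>M. (\<lambda>X. g X - (\<Sum>m = 1..<M. c m / X ^ m))
           \<in> O[inf at_infinity (principal W)](\<lambda>X. 1 / X ^ M))"

definition fast_functions :: "complex set \<Rightarrow> (complex \<Rightarrow> complex) set"
  where "fast_functions W = {g. g holomorphic_on W \<and> bounded (g ` W) \<and>
    (\<exists>c. asymp_expansion_at_infinity g c W)}"

text \<open>Gevrey combined asymptotic expansion of order \<open>1/p\<close> of \<open>y\<close> for \<open>\<eta> \<in> S\<close>, \<open>x \<in> V \<eta>\<close>:
  the slow parts \<open>u n\<close> live on \<open>D\<close>, the fast parts \<open>g n\<close> on \<open>W\<close>. Only indices \<open>n \<ge> 1\<close> matter.\<close>

definition gevrey_combined_expansion ::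
  "nat \<Rightarrow> complex set \<Rightarrow> (complex \<Rightarrow> complex set) \<Rightarrow> complex set \<Rightarrow> complex set \<Rightarrow>
   (complex \<Rightarrow> complex \<Rightarrow> complex) \<Rightarrow> (nat \<Rightarrow> complex \<Rightarrow> complex) \<Rightarrow> (nat \<Rightarrow> complex \<Rightarrow> complex) \<Rightarrow> bool"
  where "gevrey_combined_expansion p S V D W y u g \<longleftrightarrow>
    (\<forall>n\<ge>1. u n holomorphic_on D \<and> bounded (u n ` D)) \<and>
    (\<forall>n\<ge>1. g n \<in> fast_functions W) \<and>
    (\<exists>c C L\<^sub>1 L\<^sub>2. C > 0 \<and> L\<^sub>1 > 0 \<and> L\<^sub>2 > 0 \<and>
      (\<forall>n\<ge>1. asymp_expansion_at_infinity (g n) (c n) W) \<and>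
      (\<forall>n\<ge>1. \<forall>x\<in>D. norm (u n x) \<le> C * L\<^sub>1 ^ n * Gamma (real n / real p + 1)) \<and>
      (\<forall>n\<ge>1. \<forall>M. \<forall>X\<in>W.
         norm X ^ M * norm (g n X - (\<Sum>m = 1..<M. c n m / X ^ m))
           \<le> C * L\<^sub>1 ^ n * L\<^sub>2 ^ M * Gamma (real (M + n) / real p + 1)) \<and>
      (\<forall>N. \<forall>\<eta>\<in>S. \<forall>x\<in>V \<eta>.
         norm (y x \<eta> - (\<Sum>n = 1..<N. (u n x + g n (x / \<eta>)) * \<eta> ^ n))
           \<le> C * L\<^sub>1 ^ N * Gamma (real N / real p + 1) * norm \<eta> ^ N))"

text \<open>In what follows \<open>f\<close> is defined on \<open>\<Omega>\<close> and \<open>P\<close> on \<open>U\<close>; solutions have to stay in these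
  domains.\<close>

definition holomorphic_solution ::
  "nat \<Rightarrow> complex set \<Rightarrow> (complex \<Rightarrow> complex) \<Rightarrow> (complex \<times> complex \<times> complex) set \<Rightarrow>
   (complex \<times> complex \<times> complex \<Rightarrow> complex) \<Rightarrow> complex set \<Rightarrow> (complex \<Rightarrow> complex set) \<Rightarrow>
   (complex \<Rightarrow> complex \<Rightarrow> complex) \<Rightarrow> bool"
  where "holomorphic_solution p \<Omega> f U P S V y \<longleftrightarrow>
    holomorphic2_on (\<lambda>(x, \<eta>). y x \<eta>) {(x, \<eta>). \<eta> \<in> S \<and> x \<in> V \<eta>} \<and>
    (\<forall>\<eta>\<in>S. \<forall>x\<in>V \<eta>. x \<in> \<Omega> \<and> (x, y x \<eta>, \<eta> ^ p) \<in> U \<and>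
       \<eta> ^ p * deriv (\<lambda>t. y t \<eta>) x = f x * y x \<eta> + \<eta> ^ p * P (x, y x \<eta>, \<eta> ^ p))"

definition real_solution_on ::
  "complex set \<Rightarrow> (complex \<Rightarrow> complex) \<Rightarrow> (complex \<times> complex \<times> complex) set \<Rightarrow>
   (complex \<times> complex \<times> complex \<Rightarrow> complex) \<Rightarrow> real \<Rightarrow> real set \<Rightarrow> (real \<Rightarrow> real) \<Rightarrow> bool"
  where "real_solution_on \<Omega> f U P \<epsilon> I \<phi> \<longleftrightarrow>
    (\<forall>x\<in>I. complex_of_real x \<in> \<Omega> \<and>
       (complex_of_real x, complex_of_real (\<phi> x), complex_of_real \<epsilon>) \<in> U \<and>
       (\<exists>d. (\<phi> has_real_derivative d) (at x within I) \<and>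
          complex_of_real (\<epsilon> * d) =
            f (complex_of_real x) * complex_of_real (\<phi> x) +
            complex_of_real \<epsilon> *
              P (complex_of_real x, complex_of_real (\<phi> x), complex_of_real \<epsilon>)))"

text \<open>Canards on an interval \<open>I\<close>: families of real solutions, bounded uniformly in \<open>\<epsilon>\<close>. As \<open>P\<close> is
  given only on \<open>U\<close>, boundedness is understood inside \<open>U\<close>, i.e. the family must not accumulate at
  the boundary of \<open>U\<close>. Otherwise a family running into a singularity of \<open>P\<close> would count: for
  \<open>P(x, y, \<epsilon>) = - f(x) y / (1 - y) + y - 1 + \<epsilon>\<close> on \<open>norm y < 1\<close>, the constants \<open>y = 1 - \<epsilon>\<close> are
  solutions on the whole interval, whatever happens near \<open>y = 0\<close>.\<close>

definition canard_on ::
  "complex set \<Rightarrow> (complex \<Rightarrow> complex) \<Rightarrow> (complex \<times> complex \<times> complex) set \<Rightarrow>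
   (complex \<times> complex \<times> complex \<Rightarrow> complex) \<Rightarrow> real set \<Rightarrow> (real \<Rightarrow> real \<Rightarrow> real) \<Rightarrow> bool"
  where "canard_on \<Omega> f U P I y \<longleftrightarrow>
    (\<exists>\<epsilon>\<^sub>1>0.
       (\<forall>\<epsilon>\<in>{0<..\<epsilon>\<^sub>1}. real_solution_on \<Omega> f U P \<epsilon> I (\<lambda>x. y x \<epsilon>)) \<and>
       (\<exists>B. \<forall>\<epsilon>\<in>{0<..\<epsilon>\<^sub>1}. \<forall>x\<in>I. \<bar>y x \<epsilon>\<bar> \<le> B) \<and>
       closure {(complex_of_real x, complex_of_real (y x \<epsilon>), complex_of_real \<epsilon>) | x \<epsilon>.
                  x \<in> I \<and> \<epsilon> \<in> {0<..\<epsilon>\<^sub>1}} \<subseteq> U)"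

definition local_canard ::
  "complex set \<Rightarrow> (complex \<Rightarrow> complex) \<Rightarrow> (complex \<times> complex \<times> complex) set \<Rightarrow>
   (complex \<times> complex \<times> complex \<Rightarrow> complex) \<Rightarrow> (real \<Rightarrow> real \<Rightarrow> real) \<Rightarrow> bool"
  where "local_canard \<Omega> f U P y \<longleftrightarrow> (\<exists>l<0. \<exists>r>0. canard_on \<Omega> f U P {l<..<r} y)"

definition global_canard ::
  "complex set \<Rightarrow> (complex \<Rightarrow> complex) \<Rightarrow> (complex \<times> complex \<times> complex) set \<Rightarrow>
   (complex \<times> complex \<times> complex \<Rightarrow> complex) \<Rightarrow> real \<Rightarrow> real \<Rightarrow> (real \<Rightarrow> real \<Rightarrow> real) \<Rightarrow> bool"
  where "global_canard \<Omega> f U P a b y \<longleftrightarrow> canard_on \<Omega> f U P {a..b} y"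

end

theory Submission
  imports Defs "HOL-Real_Asymp.Real_Asymp"
begin

text \<open>
  Idea. Write \<open>\<epsilon> = \<eta>\<^sup>p\<close>. The hard implication is from (d) to (b). By (d) the difference
  \<open>d(\<epsilon>) = y\<^sup>+(0) - y\<^sup>-(0)\<close> has Gevrey expansion 0, so \<open>d(\<epsilon>) = O(e\<^bsup>-\<alpha>/\<epsilon>\<^esup>)\<close> for some possibly small
  \<open>\<alpha> > 0\<close>; a global canard requires this with \<open>\<alpha>\<close> larger than
  \<open>\<integral>\<^sub>0\<^sup>x f\<close> at the nearer end point (nearer in the sense of this integral).
  In the coordinate \<open>z\<close> with \<open>z\<^sup>p = \<integral>\<^sub>0\<^sup>x f\<close> the equation restricted to a ray \<open>z = \<tau> \<sigma>\<close>,
  \<open>0 \<le> \<sigma> \<le> 1\<close>, with \<open>\<epsilon> = \<tau>\<^sup>p / s\<close>, is a contraction problem for every \<open>\<tau>\<close> in a complex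
  neighbourhood of the real interval and every \<open>s\<close> with \<open>Re s \<ge> c\<close>. The value \<open>Y(\<tau>, s)\<close> at 0 of the
  solution that vanishes at \<open>\<sigma> = 1\<close> is holomorphic in \<open>\<tau>\<close> and in \<open>s\<close>, and for real arguments it is
  within \<open>O(e\<^bsup>-s\<^esup>)\<close> of every other solution that stays bounded on the ray. For small real \<open>\<tau>\<close>
  the function \<open>k(\<tau>, s) = (Y(\<tau>, s) - Y(-\<tau>, s)) e\<^sup>s\<close> is bounded for real \<open>s\<close>, hence, by Phragmen and
  Lindeloef, on the half plane; so it is represented by its values on the line \<open>Re s = c\<close> through
  Cauchy's formula. Both sides of this formula are holomorphic in \<open>\<tau>\<close>, and the right hand side is at
  most of order \<open>s\<close>. So the formula, and with it \<open>Y(\<tau>, s) - Y(-\<tau>, s) = O(s e\<^bsup>-s\<^esup>)\<close>, extends to all \<open>\<tau>\<close>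
  with \<open>\<plusminus>\<tau>\<close> in the neighbourhood, and a shooting argument produces the global canard.

  For (a) implies (c), a canard is exponentially close to \<open>y\<^sup>+\<close> and to \<open>y\<^sup>-\<close> at \<open>x = \<eta> X\<close> for
  \<open>0 < X < \<mu>\<close>, so the coefficients of both expansions agree there.
\<close>

section \<open>Holomorphic parameter integrals and the Phragmen-Lindeloef principle\<close>

text \<open>The pair (\<tau>, s) replaces (x, \<epsilon>) because in it the expected gap is
  \<open>exp (- s)\<close> whatever \<tau> is: smallness farther away from 0 becomes a statement
  about the same function of s at another \<tau>. Boundedness in s is not an identity and cannot be
  continued in \<tau>; a formula that expresses k by its values on a vertical line can. On that line
  the trivial bound by a multiple of \<open>exp (Re s)\<close> is constant, uniformly in \<tau>, so
  for complex \<tau> the contraction estimate is all that has to be known. As p is even, \<tau> and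
  -\<tau> belong to the same \<epsilon> and s, so one function can compare both sides of 0. The
  factor s lost in the formula is harmless since the coordinate extends beyond the interval: the
  estimate is taken slightly farther out than the nearer end, and the exponential gain beats every
  power of 1/\<epsilon>. Only the side of the nearer end is shot; on the other side a ray solution
  with end value 0 serves as the target.\<close>

lemma holomorphic_on_integral:
  fixes f :: "complex \<Rightarrow> 'b \<Rightarrow> complex"
  assumes A: "open A"
    and hol: "\<And>x. x \<in> space M \<Longrightarrow> (\<lambda>z. f z x) holomorphic_on A"
    and meas: "\<And>z. z \<in> A \<Longrightarrow> f z \<in> borel_measurable M"
    and g: "integrable M g"
    and bnd: "\<And>z x. z \<in> A \<Longrightarrow> x \<in> space M \<Longrightarrow> norm (f z x) \<le> g x"
  shows "(\<lambda>z. \<integral>x. f z x \<partial>M) holomorphic_on A"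
proof -
  have int: "integrable M (f z)" if "z \<in> A" for z
    by (rule Bochner_Integration.integrable_bound[OF g meas[OF that]]) (use bnd[OF that] in force)
  have "\<exists>D. ((\<lambda>z. \<integral>x. f z x \<partial>M) has_field_derivative D) (at z0)" if z0: "z0 \<in> A" for z0
  proof -
    obtain r where r: "r > 0" "cball z0 r \<subseteq> A"
      using A z0 open_contains_cball by blast
    define r2 where "r2 = r / 2"
    have r2: "r2 > 0" using r by (simp add: r2_def)
    \<comment> \<open>Cauchy's inequality on circles of radius r/2 around the points of the
      half-size disc turns the majorant \<open>g\<close> of the functions into a majorant of their
      difference quotients, as dominated convergence requires.\<close>
    have lip: "norm (f z x - f z0 x) \<le> g x / r2 * norm (z - z0)"
      if x: "x \<in> space M" and z: "z \<in> cball z0 r2" for x z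
    proof (rule field_differentiable_bound[of "cball z0 r2" "\<lambda>z. f z x" "\<lambda>z. deriv (\<lambda>z. f z x) z"])
      show "convex (cball z0 r2)" by simp
      show "z \<in> cball z0 r2" "z0 \<in> cball z0 r2" using z r2 by auto
      fix w assume w: "w \<in> cball z0 r2"
      have sub: "cball w r2 \<subseteq> A"
      proof
        fix v assume "v \<in> cball w r2"
        then have "dist z0 v \<le> r" using w dist_triangle[of z0 v w] by (simp add: r2_def)
        then show "v \<in> A" using r by auto
      qed
      have "w \<in> A" using sub r2 by auto
      then show "((\<lambda>z. f z x) has_field_derivative deriv (\<lambda>z. f z x) w) (at w within cball z0 r2)"
        using hol[OF x] A holomorphic_derivI by blast
      have "norm ((deriv ^^ 1) (\<lambda>z. f z x) w) \<le> fact 1 * g x / r2 ^ 1"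
      proof (rule Cauchy_inequality)
        show "(\<lambda>z. f z x) holomorphic_on ball w r2"
          using hol[OF x] sub by (meson ball_subset_cball holomorphic_on_subset)
        show "continuous_on (cball w r2) (\<lambda>z. f z x)"
          using hol[OF x] sub by (meson holomorphic_on_imp_continuous_on holomorphic_on_subset)
        show "norm (f v x) \<le> g x" if "norm (w - v) = r2" for v
        proof (rule bnd[OF _ x])
          have "v \<in> cball w r2" using that by (simp add: dist_norm)
          then show "v \<in> A" using sub by blast
        qed
      qed (use r2 in auto)
      then show "norm (deriv (\<lambda>z. f z x) w) \<le> g x / r2" by simp
    qed
    define D where "D = (\<integral>x. deriv (\<lambda>z. f z x) z0 \<partial>M)"
    have lim: "(\<lambda>n. ((\<integral>x. f (h n) x \<partial>M) - (\<integral>x. f z0 x \<partial>M)) / (h n - z0)) \<longlonglongrightarrow> D"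
      if h: "\<And>n. h n \<noteq> z0" "h \<longlonglongrightarrow> z0" "\<And>n. h n \<in> cball z0 r2" for h
    proof -
      have hA: "h n \<in> A" for n using h(3)[of n] r by (auto simp: r2_def)
      have ptw: "(\<lambda>n. (f (h n) x - f z0 x) / (h n - z0)) \<longlonglongrightarrow> deriv (\<lambda>z. f z x) z0" if x: "x \<in> space M" for x
      proof -
        have "((\<lambda>z. f z x) has_field_derivative deriv (\<lambda>z. f z x) z0) (at z0)"
          using hol[OF x] A z0 holomorphic_derivI by blast
        then have "((\<lambda>z. (f z x - f z0 x) / (z - z0)) \<longlongrightarrow> deriv (\<lambda>z. f z x) z0) (at z0)"
          by (simp add: has_field_derivative_iff)
        then show ?thesis using h(1,2) by (auto simp: tendsto_at_iff_sequentially o_def)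
      qed
      have "(\<lambda>n. \<integral>x. (f (h n) x - f z0 x) / (h n - z0) \<partial>M) \<longlonglongrightarrow> (\<integral>x. deriv (\<lambda>z. f z x) z0 \<partial>M)"
      proof (rule integral_dominated_convergence[where w="\<lambda>x. g x / r2"])
        show m: "(\<lambda>x. (f (h n) x - f z0 x) / (h n - z0)) \<in> borel_measurable M" for n
          using meas[OF hA[of n]] meas[OF z0] by measurable
        show "(\<lambda>x. deriv (\<lambda>z. f z x) z0) \<in> borel_measurable M"
          by (rule borel_measurable_LIMSEQ_metric[where f="\<lambda>n x. (f (h n) x - f z0 x) / (h n - z0)", OF m ptw])
        show "integrable M (\<lambda>x. g x / r2)" using g by simp
        show "AE x in M. norm ((f (h n) x - f z0 x) / (h n - z0)) \<le> g x / r2" for n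
        proof (rule AE_I2)
          fix x assume x: "x \<in> space M"
          have "norm (h n - z0) > 0" using h(1) by simp
          then show "norm ((f (h n) x - f z0 x) / (h n - z0)) \<le> g x / r2"
            using lip[OF x h(3)[of n]] by (simp add: norm_divide pos_divide_le_eq)
        qed
        show "AE x in M. (\<lambda>n. (f (h n) x - f z0 x) / (h n - z0)) \<longlonglongrightarrow> deriv (\<lambda>z. f z x) z0"
          using ptw by auto
      qed
      then show ?thesis
        unfolding D_def using int[OF hA] int[OF z0] by (simp add: Bochner_Integration.integral_diff)
    qed
    have "((\<lambda>z. ((\<integral>x. f z x \<partial>M) - (\<integral>x. f z0 x \<partial>M)) / (z - z0)) \<longlongrightarrow> D) (at z0 within cball z0 r2)"
      unfolding tendsto_at_iff_sequentially using lim by (auto simp: o_def)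
    then have "((\<lambda>z. \<integral>x. f z x \<partial>M) has_field_derivative D) (at z0 within cball z0 r2)"
      by (simp add: has_field_derivative_iff)
    then show ?thesis using r2 at_within_interior[of z0 "cball z0 r2"] by auto
  qed
  then show ?thesis
    by (auto simp: holomorphic_on_def field_differentiable_def intro: has_field_derivative_at_within)
qed

text \<open>The order of growth is 1 while the quadrant admits every order below 2. The substitution
  \<open>s = e\<^bsup>i \<pi>/4\<^esup> z\<^sup>2\<close> turns the damping factor \<open>exp (- \<delta> (s / e\<^bsup>i \<pi>/4\<^esup>)\<^bsup>3/2\<^esup>)\<close> into the
  entire function \<open>exp (- \<delta> z\<^sup>3)\<close>.\<close>

lemma phragmen_lindelof_quadrant:
  fixes k :: "complex \<Rightarrow> complex"
  assumes hol: "k holomorphic_on {s. 0 < Re s \<and> 0 < Im s}"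
    and cont: "continuous_on {s. 0 \<le> Re s \<and> 0 \<le> Im s} k"
    and growth: "\<And>s. 0 \<le> Re s \<Longrightarrow> 0 \<le> Im s \<Longrightarrow> norm (k s) \<le> C * exp (norm s)"
    and re: "\<And>x. 0 \<le> x \<Longrightarrow> norm (k (of_real x)) \<le> B"
    and im: "\<And>x. 0 \<le> x \<Longrightarrow> norm (k (\<i> * of_real x)) \<le> B"
    and B: "B > 0"
    and s0: "0 < Re s0" "0 < Im s0"
  shows "norm (k s0) \<le> B"
proof -
  define e where "e = Complex (1 / sqrt 2) (1 / sqrt 2)"
  have e1: "norm e = 1" by (simp add: e_def cmod_def power_divide)
  define G where "G = (\<lambda>z::complex. e * z\<^sup>2)"
  have ReG: "Re (G z) = ((Re z)\<^sup>2 - (Im z)\<^sup>2 - 2 * Re z * Im z) / sqrt 2"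
    and ImG: "Im (G z) = ((Re z)\<^sup>2 - (Im z)\<^sup>2 + 2 * Re z * Im z) / sqrt 2" for z
    by (simp_all add: G_def e_def power2_eq_square diff_divide_distrib add_divide_distrib)
  have normG: "norm (G z) = (norm z)\<^sup>2" for z
    by (simp add: G_def norm_mult norm_power e1)
  have holG [holomorphic_intros]: "G holomorphic_on A" for A
    unfolding G_def by (intro holomorphic_intros)
  \<comment> \<open>The preimage of the quadrant is the sector where the argument is at most pi/8 in
    modulus, so the argument of \<open>z ^ 3\<close> stays within 3 pi/8 and its real part is
    comparable to its modulus. The inequalities on \<open>G\<close> describe this sector without
    mentioning arguments.\<close>
  define T where "T = {z. 0 \<le> Re z \<and> 0 \<le> Re (G z) \<and> 0 \<le> Im (G z)}"
  define T' where "T' = {z. 0 < Re z \<and> 0 < Re (G z) \<and> 0 < Im (G z)}"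
  have contG: "continuous_on UNIV G" using holG holomorphic_on_imp_continuous_on by blast
  have cube: "Re (z ^ 3) \<ge> (norm z) ^ 3 / 32" if "z \<in> T" for z
  proof -
    define u v where "u = Re z" and "v = \<bar>Im z\<bar>"
    have u: "u \<ge> 0" and v: "v \<ge> 0" using that by (auto simp: u_def v_def T_def)
    have "2 * u * v \<le> u\<^sup>2 - v\<^sup>2"
    proof (cases "Im z \<ge> 0")
      case True
      then show ?thesis using that by (simp add: T_def ReG u_def v_def zero_le_divide_iff)
    next
      case False
      then show ?thesis using that by (simp add: T_def ImG u_def v_def zero_le_divide_iff)
    qed
    have vu: "v \<le> u / 2"
    proof (rule ccontr)
      assume "\<not> v \<le> u / 2"
      then have *: "v > u / 2" by simp
      have "v * v > 0" using * u by simp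
      moreover have "2 * u * v \<ge> u * u" using mult_left_mono[of "u/2" v "2*u"] * u by simp
      ultimately show False using \<open>2 * u * v \<le> u\<^sup>2 - v\<^sup>2\<close> by (simp add: power2_eq_square)
    qed
    have "norm z \<le> \<bar>Re z\<bar> + \<bar>Im z\<bar>" by (rule cmod_le)
    then have "norm z \<le> 2 * u" using vu u by (simp add: u_def v_def)
    then have "(norm z) ^ 3 \<le> (2 * u) ^ 3" by (rule power_mono) simp
    then have 1: "(norm z) ^ 3 / 32 \<le> u ^ 3 / 4" by (simp add: power_mult_distrib)
    have "v\<^sup>2 \<le> (u / 2)\<^sup>2" using vu v by (rule power_mono)
    then have "u * (3 * v\<^sup>2) \<le> u * (3 * (u\<^sup>2 / 4))" using u
      by (intro mult_left_mono) (simp_all add: power_divide)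
    moreover have "Re (z ^ 3) = u ^ 3 - u * (3 * v\<^sup>2)"
      by (simp add: power3_eq_cube u_def v_def power2_eq_square algebra_simps)
    ultimately have "Re (z ^ 3) \<ge> u ^ 3 / 4" by (simp add: power3_eq_cube power2_eq_square)
    with 1 show ?thesis by linarith
  qed
  have pre: "\<exists>z0. z0 \<in> T' \<and> G z0 = s0"
  proof -
    define z0 where "z0 = csqrt (s0 / e)"
    have e0: "e \<noteq> 0" using e1 by auto
    have G0: "G z0 = s0" using e0 by (simp add: G_def z0_def)
    have "Re z0 \<noteq> 0"
    proof
      assume "Re z0 = 0"
      then have "Re (G z0) = - (Im z0)\<^sup>2 / sqrt 2" by (simp add: ReG)
      then have "Re (G z0) \<le> 0" by simp
      then show False using G0 s0 by simp
    qed
    moreover have "Re z0 \<ge> 0" unfolding z0_def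
      by (metis csqrt_principal order_le_less)
    ultimately have "z0 \<in> T'" using G0 s0 by (simp add: T'_def)
    then show ?thesis using G0 by blast
  qed
  then obtain z0 where z0: "z0 \<in> T'" "G z0 = s0" by blast
  have main: "norm (k s0) * exp (- \<delta> * Re (z0 ^ 3)) \<le> B" if \<delta>: "\<delta> > 0" for \<delta>
  proof -
    define K where "K = (\<lambda>z. k (G z) * exp (- of_real \<delta> * z ^ 3))"
    have normK: "norm (K z) = norm (k (G z)) * exp (- \<delta> * Re (z ^ 3))" for z
      by (simp add: K_def norm_mult)
    \<comment> \<open>On the arc of radius n the growth is at most
      \<open>C * exp (n\<^sup>2)\<close> and the damping at most
      \<open>exp (- \<delta> * n ^ 3 / 32)\<close>; n is chosen so that the arc respects the bound
      \<open>B\<close> and encloses \<open>z0\<close>.\<close>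
    have "((\<lambda>n. C * exp (n\<^sup>2 * (1 - \<delta> * n / 32))) \<longlongrightarrow> 0) at_top"
      using \<delta> by real_asymp
    then have "\<forall>\<^sub>F n in at_top. C * exp (n\<^sup>2 * (1 - \<delta> * n / 32)) < B"
      using B by (rule order_tendstoD)
    moreover have "\<forall>\<^sub>F n in at_top. n > norm z0" by (rule eventually_gt_at_top)
    ultimately have "\<forall>\<^sub>F n in at_top. C * exp (n\<^sup>2 * (1 - \<delta> * n / 32)) < B \<and> n > norm z0"
      by eventually_elim simp
    then obtain n where n: "C * exp (n\<^sup>2 * (1 - \<delta> * n / 32)) < B" "n > norm z0"
      by (auto simp: eventually_at_top_linorder)
    define S where "S = T' \<inter> ball 0 n"
    have opS: "open S" unfolding S_def T'_def
      by (intro open_Int open_ball open_Collect_conj open_Collect_less continuous_intros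
          continuous_on_compose2[OF contG]) auto
    have clT: "closed T" unfolding T_def
      by (intro closed_Collect_conj closed_Collect_le continuous_intros
          continuous_on_compose2[OF contG]) auto
    have sub: "closure S \<subseteq> T \<inter> cball 0 n"
    proof (rule closure_minimal)
      show "S \<subseteq> T \<inter> cball 0 n" by (auto simp: S_def T_def T'_def)
      show "closed (T \<inter> cball 0 n)" using clT by (simp add: closed_Int)
    qed
    have "norm (K z0) \<le> B"
    proof (rule maximum_modulus_frontier[where f=K and S=S])
      have "(k \<circ> G) holomorphic_on S"
        by (rule holomorphic_on_compose_gen[OF holG hol]) (auto simp: S_def T'_def)
      then show "K holomorphic_on interior S"
        unfolding K_def interior_open[OF opS] by (intro holomorphic_intros) (simp_all add: o_def)
      show "continuous_on (closure S) K"
        unfolding K_def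
        by (intro continuous_intros continuous_on_compose2[OF cont] continuous_on_compose2[OF contG])
          (use sub in \<open>auto simp: T_def\<close>)
      show "bounded S" unfolding S_def by (simp add: bounded_Int)
      show "z0 \<in> S" using z0 n by (simp add: S_def)
      fix z assume "z \<in> frontier S"
      then have zT: "z \<in> T" "norm z \<le> n" and zS: "z \<notin> S"
        using sub by (auto simp: frontier_def interior_open[OF opS])
      have "norm z ^ 3 / 32 \<ge> 0" by simp
      then have "Re (z ^ 3) \<ge> 0" using cube[OF zT(1)] by linarith
      then have damp: "exp (- \<delta> * Re (z ^ 3)) \<le> 1" using \<delta> by simp
      have bdry: "norm (K z) \<le> B" if "norm (k (G z)) \<le> B"
        unfolding normK using mult_mono[OF that damp] B by simp
      have nonneg: "0 \<le> Re (G z)" "0 \<le> Im (G z)" "0 \<le> Re z" using zT by (auto simp: T_def)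
      consider "norm z = n" | "Re (G z) = 0" | "Im (G z) = 0" | "Re z = 0"
        using zT zS nonneg by (force simp: S_def T'_def)
      then show "norm (K z) \<le> B"
      proof cases
        case 1
        have "norm (K z) \<le> (C * exp (n\<^sup>2)) * exp (- \<delta> * (n ^ 3 / 32))"
          unfolding normK
        proof (rule mult_mono)
          show "norm (k (G z)) \<le> C * exp (n\<^sup>2)"
            using growth[OF nonneg(1,2)] by (simp add: normG 1)
          then show "0 \<le> C * exp (n\<^sup>2)" using norm_ge_zero order_trans by blast
          show "exp (- \<delta> * Re (z ^ 3)) \<le> exp (- \<delta> * (n ^ 3 / 32))"
            using cube[OF zT(1)] 1 \<delta> by simp
        qed simp
        also have "\<dots> = C * exp (n\<^sup>2 * (1 - \<delta> * n / 32))"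
          by (simp add: mult.assoc flip: exp_add) (simp add: algebra_simps power2_eq_square power3_eq_cube)
        finally show ?thesis using n by simp
      next
        case 2
        then have "G z = \<i> * of_real (Im (G z))" by (simp add: complex_eq_iff)
        then show ?thesis using bdry im[OF nonneg(2)] by simp
      next
        case 3
        then have "G z = of_real (Re (G z))" by (simp add: complex_eq_iff)
        then show ?thesis using bdry re[OF nonneg(1)] by simp
      next
        case 4
        then have "(Im z)\<^sup>2 \<le> 0" using nonneg(1) by (simp add: ReG divide_le_0_iff)
        then have "z = 0" using 4 by (simp add: complex_eq_iff)
        then show ?thesis using bdry re[of 0] by (simp add: G_def)
      qed
    qed
    then show ?thesis by (simp add: normK z0)
  qed
  \<comment> \<open>The damping can be removed since \<open>z0\<close> and \<open>B\<close> do not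
    depend on \<delta>.\<close>
  have "((\<lambda>\<delta>. norm (k s0) * exp (- \<delta> * Re (z0 ^ 3))) \<longlongrightarrow> norm (k s0) * exp (- 0 * Re (z0 ^ 3))) (at_right 0)"
    by (intro tendsto_intros)
  then show ?thesis
    by (intro tendsto_upperbound[of "\<lambda>\<delta>. norm (k s0) * exp (- \<delta> * Re (z0 ^ 3))" _ "at_right 0"])
      (use main in \<open>auto simp: eventually_at_right_less intro: eventually_mono[OF eventually_at_right_less]\<close>)
qed

text \<open>The half plane is cut along the real axis into two quadrants. The common edge is
  controlled by \<open>re\<close>, the vertical edges by \<open>growth\<close>, which is constant
  there. A full half plane would not do: growth of order 1 is its critical order.\<close>

lemma phragmen_lindelof_half_plane:
  fixes k :: "complex \<Rightarrow> complex"
  assumes hol: "k holomorphic_on {s. c0 < Re s}" and c: "c0 < c"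
    and growth: "\<And>s. c \<le> Re s \<Longrightarrow> norm (k s) \<le> C * exp (Re s)"
    and re: "\<And>x. c \<le> x \<Longrightarrow> norm (k (of_real x)) \<le> B"
    and B: "B > 0" "C * exp c \<le> B"
    and s: "c \<le> Re s"
  shows "norm (k s) \<le> B"
proof -
  have contk: "continuous_on {s. c0 < Re s} k" using hol by (rule holomorphic_on_imp_continuous_on)
  have C: "C \<ge> 0"
  proof -
    have "0 \<le> C * exp (Re (of_real c))" using growth[of "of_real c"] norm_ge_zero order_trans
      by (metis Re_complex_of_real order_refl)
    then show ?thesis by (simp add: zero_le_mult_iff)
  qed
  have vert: "norm (k (of_real c + \<i> * of_real x)) \<le> B" for x
    using growth[of "of_real c + \<i> * of_real x"] B(2) by simp
  have gr: "norm (k w) \<le> (C * exp c) * exp (norm v)" if "Re w = c + t" "0 \<le> t" "t \<le> norm v" for w v :: complex and t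
  proof -
    have "norm (k w) \<le> C * exp (Re w)" using growth[of w] that by simp
    also have "\<dots> \<le> C * exp (c + norm v)" using that C by (intro mult_left_mono) auto
    finally show ?thesis by (simp add: exp_add)
  qed
  consider "Re s = c" | "Im s = 0" | "Re s > c" "Im s > 0" | "Re s > c" "Im s < 0"
    using s by force
  then show ?thesis
  proof cases
    case 1
    then show ?thesis using growth[OF s] B(2) by simp
  next
    case 2
    then have "s = of_real (Re s)" by (simp add: complex_eq_iff)
    then show ?thesis using re[OF s] by metis
  next
    case 3
    have "norm (k (of_real c + (s - of_real c))) \<le> B"
    proof (rule phragmen_lindelof_quadrant[where k="\<lambda>v. k (of_real c + v)" and C="C * exp c"])
      show "(\<lambda>v. k (of_real c + v)) holomorphic_on {s. 0 < Re s \<and> 0 < Im s}"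
        by (rule holomorphic_on_compose_gen[OF _ hol, unfolded o_def])
          (use c in \<open>auto intro!: holomorphic_intros\<close>)
      show "continuous_on {s. 0 \<le> Re s \<and> 0 \<le> Im s} (\<lambda>v. k (of_real c + v))"
        by (rule continuous_on_compose2[OF contk]) (use c in \<open>auto intro!: continuous_intros\<close>)
      show "norm (k (of_real c + v)) \<le> C * exp c * exp (norm v)" if "0 \<le> Re v" "0 \<le> Im v" for v
        by (rule gr[where t="Re v"]) (use that complex_Re_le_cmod[of v] in auto)
      show "norm (k (of_real c + of_real x)) \<le> B" if "0 \<le> x" for x
        using re[of "c + x"] that by simp
    qed (use 3 B vert in auto)
    then show ?thesis by simp
  next
    case 4
    \<comment> \<open>The substitution s = c - i v turns the upper quadrant into the lower one: the
      real v-axis goes to the vertical line and the imaginary v-axis to the real ray.\<close>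
    have "norm (k (of_real c - \<i> * (\<i> * (s - of_real c)))) \<le> B"
    proof (rule phragmen_lindelof_quadrant[where k="\<lambda>v. k (of_real c - \<i> * v)" and C="C * exp c"])
      show "(\<lambda>v. k (of_real c - \<i> * v)) holomorphic_on {s. 0 < Re s \<and> 0 < Im s}"
        by (rule holomorphic_on_compose_gen[OF _ hol, unfolded o_def])
          (use c in \<open>auto intro!: holomorphic_intros\<close>)
      show "continuous_on {s. 0 \<le> Re s \<and> 0 \<le> Im s} (\<lambda>v. k (of_real c - \<i> * v))"
        by (rule continuous_on_compose2[OF contk]) (use c in \<open>auto intro!: continuous_intros\<close>)
      show "norm (k (of_real c - \<i> * v)) \<le> C * exp c * exp (norm v)" if "0 \<le> Re v" "0 \<le> Im v" for v
        by (rule gr[where t="Im v"]) (use that abs_Im_le_cmod[of v] in auto)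
      show "norm (k (of_real c - \<i> * of_real x)) \<le> B" if "0 \<le> x" for x
        using vert[of "-x"] by simp
      show "norm (k (of_real c - \<i> * (\<i> * of_real x))) \<le> B" if "0 \<le> x" for x
        using re[of "c + x"] that by (simp flip: mult.assoc)
    qed (use 4 B in auto)
    then show ?thesis by (simp flip: mult.assoc)
  qed
qed

section \<open>Propagation of exponential smallness\<close>

text \<open>Under s = 1/w a half plane Re s \<ge> c with c > 0 becomes the disc with centre and
  radius 1/(2c), infinity going to the boundary point 0. The identity yields the closed and the open
  version at once.\<close>

lemma circle_half_plane_identity:
  fixes w :: complex
  assumes "c \<noteq> 0" "w \<noteq> 0"
  shows "c - Re (1 / w) = c * ((norm (w - of_real (1 / (2 * c))))\<^sup>2 - (1 / (2 * c))\<^sup>2) / (norm w)\<^sup>2"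
proof -
  have 1: "(norm w)\<^sup>2 \<noteq> 0" using assms by simp
  have 2: "Re (1 / w) = Re w / (norm w)\<^sup>2"
    by (simp add: Re_divide cmod_power2)
  have 3: "(norm (w - of_real (1 / (2 * c))))\<^sup>2 - (1 / (2 * c))\<^sup>2 = (norm w)\<^sup>2 - Re w / c"
    using assms(1) by (simp add: cmod_power2 power2_diff)
  show ?thesis using 1 assms(1) unfolding 2 3 by (simp add: field_simps)
qed

lemma Re_inverse_le_iff:
  assumes c: "c > 0" "w \<noteq> 0"
  shows "c \<le> Re (1 / w) \<longleftrightarrow> norm (w - of_real (1 / (2 * c))) \<le> 1 / (2 * c)"
    and "c < Re (1 / w) \<longleftrightarrow> norm (w - of_real (1 / (2 * c))) < 1 / (2 * c)"
proof -
  define X where "X = norm (w - of_real (1 / (2 * c)))"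
  define r where "r = 1 / (2 * c)"
  have r: "r > 0" using c by (simp add: r_def)
  have id: "c - Re (1 / w) = c * (X\<^sup>2 - r\<^sup>2) / (norm w)\<^sup>2"
    unfolding X_def r_def by (rule circle_half_plane_identity) (use c in auto)
  have X: "X \<ge> 0" by (simp add: X_def)
  have "c \<le> Re (1 / w) \<longleftrightarrow> c * (X\<^sup>2 - r\<^sup>2) / (norm w)\<^sup>2 \<le> 0" using id by linarith
  also have "\<dots> \<longleftrightarrow> X\<^sup>2 \<le> r\<^sup>2" using c by (simp add: divide_le_0_iff mult_le_0_iff)
  also have "\<dots> \<longleftrightarrow> X \<le> r" using r X by simp
  finally show "c \<le> Re (1 / w) \<longleftrightarrow> norm (w - of_real (1 / (2 * c))) \<le> 1 / (2 * c)"
    by (simp add: X_def r_def)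
  have "c < Re (1 / w) \<longleftrightarrow> c * (X\<^sup>2 - r\<^sup>2) / (norm w)\<^sup>2 < 0" using id by linarith
  also have "\<dots> \<longleftrightarrow> X\<^sup>2 < r\<^sup>2" using c by (simp add: divide_less_0_iff mult_less_0_iff)
  also have "\<dots> \<longleftrightarrow> X < r" using r X by (meson power2_less_imp_less power_strict_mono less_le zero_less_numeral)
  finally show "c < Re (1 / w) \<longleftrightarrow> norm (w - of_real (1 / (2 * c))) < 1 / (2 * c)"
    by (simp add: X_def r_def)
qed

text \<open>On the circle r + r exp(2 pi i x) this singles out the parameter of the singular point
  0, which corresponds to s = infinity.\<close>

lemma exp_2pi_i_eq_minus_one:
  assumes "x \<in> {0..1}" "exp (2 * of_real pi * \<i> * of_real x) = -1"
  shows "x = 1 / 2"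
proof -
  have "exp (2 * of_real pi * \<i> * of_real x) = exp (of_real pi * \<i>)" using assms by simp
  then obtain n :: int where "2 * of_real pi * \<i> * of_real x = of_real pi * \<i> + of_int (2 * n) * of_real pi * \<i>"
    unfolding exp_eq by auto
  then have "Im (2 * of_real pi * \<i> * of_real x) = Im (of_real pi * \<i> + of_int (2 * n) * of_real pi * \<i>)"
    by (rule arg_cong)
  then have "2 * pi * x = pi + 2 * of_int n * pi" by simp
  then have "pi * (2 * x) = pi * (1 + 2 * of_int n)" by (simp add: algebra_simps)
  then have x: "2 * x = 1 + 2 * real_of_int n" by simp
  then have "real_of_int n < 1" "real_of_int n > -1" using assms(1) by auto
  then have "n = 0" by linarith
  then show ?thesis using x by simp
qed

text \<open>Cauchy's formula on the circle \<open>Re (1 / \<omega>) = c\<close>. As \<open>\<omega> = 0\<close> is in general an essential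
  singularity, it is obtained as a limit of smaller circles.\<close>

lemma Cauchy_formula_bounded_half_plane:
  fixes k :: "complex \<Rightarrow> complex"
  assumes hol: "k holomorphic_on {s. c0 < Re s}" and c: "0 \<le> c0" "c0 < c"
    and bnd: "\<And>s. c \<le> Re s \<Longrightarrow> norm (k s) \<le> B"
    and s0: "c < Re s0"
  defines "r \<equiv> 1 / (2 * c)"
  defines "w \<equiv> (\<lambda>x::real. of_real r + of_real r * exp (2 * of_real pi * \<i> * of_real x))"
  shows "k s0 = integral ({0..1} - {1/2}) (\<lambda>x. k (1 / w x) / (w x - 1 / s0) * (w x - of_real r))"
proof -
  define S where "S = {0..1} - {1/2 :: real}"
  define w0 where "w0 = 1 / s0"
  have r: "r > 0" using c by (simp add: r_def)
  have s0nz: "s0 \<noteq> 0" using s0 c by auto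
  have w0: "w0 \<noteq> 0" "norm (w0 - of_real r) < r"
    using Re_inverse_le_iff(2)[of c w0] s0 s0nz c by (auto simp: w0_def r_def)
  \<comment> \<open>Half the distance of \<open>w0\<close> from the limiting circle: concentric
    circles of radius above r - m keep distance m from \<open>w0\<close>, which gives one majorant
    for all of them.\<close>
  define m where "m = (r - norm (w0 - of_real r)) / 2"
  have m: "m > 0" using w0 by (simp add: m_def)
  define e where "e = (\<lambda>x::real. exp (2 * of_real pi * \<i> * of_real x) :: complex)"
  have norme: "norm (e x) = 1" for x by (simp add: e_def)
  define q where "q = (\<lambda>n::nat. 1 - 1 / (real n + 2))"
  have q: "q \<longlonglongrightarrow> 1" unfolding q_def by real_asymp
  have q01: "0 < q n" "q n < 1" for n by (auto simp: q_def field_simps)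
  have "\<forall>\<^sub>F n in sequentially. q n > 1 - m / r"
    using q by (rule order_tendstoD) (use m r in simp)
  then obtain N where N: "\<And>n. n \<ge> N \<Longrightarrow> q n > 1 - m / r"
    by (auto simp: eventually_sequentially)
  define W where "W = (\<lambda>n x. of_real r + of_real (q (n + N) * r) * e x)"
  define F where "F = (\<lambda>u. k (1 / u) / (u - w0) * (u - of_real r))"
  have normW: "norm (W n x - of_real r) = q (n + N) * r" for n x
    using q01[of "n + N"] r by (simp add: W_def norm_mult norme)
  have qr: "q (n + N) * r < r" "q (n + N) * r > r - m" for n
  proof -
    show "q (n + N) * r < r" using q01[of "n + N"] r by simp
    have "(1 - m / r) * r < q (n + N) * r" using N[of "n + N"] r by (intro mult_strict_right_mono) auto
    then show "q (n + N) * r > r - m" using r by (simp add: left_diff_distrib)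
  qed
  have inner: "u \<noteq> 0 \<and> c \<le> Re (1 / u)" if "norm (u - of_real r) < r" for u
  proof -
    have "u \<noteq> 0" using that r by auto
    then show ?thesis using Re_inverse_le_iff(1)[of c u] that c by (simp add: r_def)
  qed
  have holk: "(\<lambda>u. k (1 / u)) holomorphic_on ball (of_real r) r"
  proof -
    have "(k \<circ> (\<lambda>u. 1 / u)) holomorphic_on ball (of_real r) r"
    proof (rule holomorphic_on_compose_gen[OF _ hol])
      show "(\<lambda>u. 1 / u) holomorphic_on ball (complex_of_real r) r"
        by (intro holomorphic_intros) (use inner in \<open>auto simp: dist_norm norm_minus_commute\<close>)
      show "(\<lambda>u. 1 / u) ` ball (complex_of_real r) r \<subseteq> {s. c0 < Re s}"
        using inner c by (force simp: dist_norm norm_minus_commute)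
    qed
    then show ?thesis by (simp add: o_def)
  qed
  have int: "((\<lambda>x. F (W n x)) has_integral k s0) S" for n
  proof -
    have "((\<lambda>u. k (1 / u) / (u - w0)) has_contour_integral 2 * of_real pi * \<i> * k (1 / w0))
        (circlepath (of_real r) (q (n + N) * r))"
    proof (rule Cauchy_integral_circlepath_simple)
      show "(\<lambda>u. k (1 / u)) holomorphic_on cball (complex_of_real r) (q (n + N) * r)"
        by (rule holomorphic_on_subset[OF holk]) (use qr[of n] in auto)
      show "norm (w0 - of_real r) < q (n + N) * r" using qr(2)[of n] w0(2) unfolding m_def by argo
    qed
    then have "((\<lambda>x. k (1 / W n x) / (W n x - w0) * (2 * of_real pi * \<i> * of_real (q (n + N) * r) * e x))
       has_integral 2 * of_real pi * \<i> * k s0) {0..1}"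
      unfolding has_contour_integral vector_derivative_circlepath
      by (simp add: circlepath W_def e_def w0_def mult_ac)
    then have "((\<lambda>x. (1 / (2 * of_real pi * \<i>)) * (k (1 / W n x) / (W n x - w0) * (2 * of_real pi * \<i> * of_real (q (n + N) * r) * e x)))
       has_integral (1 / (2 * of_real pi * \<i>)) * (2 * of_real pi * \<i> * k s0)) {0..1}"
      by (rule has_integral_mult_right)
    moreover have can: "(1 / (2 * of_real pi * \<i>)) * (X * (2 * of_real pi * \<i> * Y * Z)) = X * (Y * Z)" for X Y Z :: complex
      by (simp add: field_simps)
    ultimately have "((\<lambda>x. F (W n x)) has_integral (1 / (2 * of_real pi * \<i>)) * (2 * of_real pi * \<i> * k s0)) {0..1}"
      unfolding can by (simp add: F_def W_def)
    then have "((\<lambda>x. F (W n x)) has_integral k s0) {0..1}" by simp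
    then show ?thesis unfolding S_def
      by (rule has_integral_spike_set_eq[THEN iffD1, rotated 2]) (rule negligible_subset[of "{1/2}"]; auto)+
  qed
  have lim: "(\<lambda>n. F (W n x)) \<longlonglongrightarrow> F (w x)" if x: "x \<in> S" for x
  proof -
    have ex: "e x \<noteq> -1" using exp_2pi_i_eq_minus_one[of x] x by (auto simp: e_def S_def)
    have wx: "w x = of_real r + of_real r * e x" by (simp add: w_def e_def)
    have "w x \<noteq> 0"
    proof
      assume "w x = 0"
      then have "of_real r * (1 + e x) = 0" by (simp add: wx distrib_left)
      then show False using ex r by (simp add: add_eq_0_iff)
    qed
    have nw: "norm (w x - of_real r) = r" using r by (simp add: wx norm_mult norme)
    then have cw: "c \<le> Re (1 / w x)" using Re_inverse_le_iff(1)[of c "w x"] c \<open>w x \<noteq> 0\<close> by (simp add: r_def)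
    have "isCont k (1 / w x)"
      using holomorphic_on_imp_continuous_on[OF hol] cw c
      by (subst (asm) continuous_on_eq_continuous_at) (auto intro: open_halfspace_Re_gt)
    moreover have "w x \<noteq> w0" using nw w0 by auto
    ultimately have "isCont F (w x)"
      unfolding F_def using \<open>w x \<noteq> 0\<close>
      by (intro continuous_intros isCont_o2[of _ "\<lambda>u. 1 / u" k]) auto
    moreover have "(\<lambda>n. W n x) \<longlonglongrightarrow> of_real r + of_real (1 * r) * e x"
      unfolding W_def by (intro tendsto_intros LIMSEQ_ignore_initial_segment[OF q])
    ultimately show ?thesis using isCont_tendsto_compose[of "w x" F "\<lambda>n. W n x" sequentially]
      by (simp add: wx)
  qed
  have B: "B \<ge> 0" using bnd[of s0] s0 norm_ge_zero order_trans by (metis less_imp_le)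
  have "(\<lambda>n. integral S (\<lambda>x. F (W n x))) \<longlonglongrightarrow> integral S (\<lambda>x. F (w x))"
  proof (rule dominated_convergence(2)[where h="\<lambda>_. B / m * r"])
    show "(\<lambda>x. F (W n x)) integrable_on S" for n using int by (rule has_integral_integrable)
    have "((\<lambda>_. B / m * r) has_integral (B / m * r)) {0..1::real}"
      using has_integral_const_real[of "B / m * r" 0 1] by simp
    then have "((\<lambda>_. B / m * r) has_integral (B / m * r)) S" unfolding S_def
      by (rule has_integral_spike_set_eq[THEN iffD1, rotated 2]) (rule negligible_subset[of "{1/2}"]; auto)+
    then show "(\<lambda>_. B / m * r) integrable_on S" by (rule has_integral_integrable)
    show "norm (F (W n x)) \<le> B / m * r" for n x
    proof -
      have "c \<le> Re (1 / W n x)" using inner[of "W n x"] normW[of n x] qr[of n] by simp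
      then have 1: "norm (k (1 / W n x)) \<le> B" by (rule bnd)
      have "q (n + N) * r \<le> norm (W n x - w0) + norm (w0 - of_real r)"
        using norm_triangle_ineq[of "W n x - w0" "w0 - of_real r"] normW[of n x] by simp
      then have 2: "m \<le> norm (W n x - w0)" using qr(2)[of n] unfolding m_def by argo
      have "norm (F (W n x)) = norm (k (1 / W n x)) / norm (W n x - w0) * norm (W n x - of_real r)"
        by (simp add: F_def norm_mult norm_divide)
      also have "\<dots> \<le> B / m * r"
        using 1 2 m B qr(1)[of n] q01[of "n + N"] r
        by (intro mult_mono frac_le divide_nonneg_pos) (simp_all add: normW)
      finally show ?thesis .
    qed
    show "(\<lambda>n. F (W n x)) \<longlonglongrightarrow> F (w x)" if "x \<in> S" for x using lim[OF that] .
  qed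
  moreover have "integral S (\<lambda>x. F (W n x)) = k s0" for n using int by (rule integral_unique)
  ultimately have "integral S (\<lambda>x. F (w x)) = k s0" using LIMSEQ_unique tendsto_const by (metis (no_types, lifting) ext)
  then show ?thesis by (simp add: F_def S_def w0_def)
qed


text \<open>For \<tau> in \<open>I\<close> boundedness makes Cauchy's formula on Re s = c available.
  Both sides of it are holomorphic in \<tau> on all of \<open>D\<close>, because
  \<open>growth\<close> bounds the integrand there uniformly, so the identity theorem carries the
  formula from \<open>I\<close> to \<open>D\<close>. Estimating the integrand then gives the bound.
  The constants hidden in \<open>small\<close> may vary with \<tau> in any way, as they do not
  survive in the formula.\<close>

lemma exponential_smallness_extends:
  fixes k :: "complex \<Rightarrow> complex \<Rightarrow> complex"
  assumes D: "open D" "connected D" and I: "I \<subseteq> D" "\<tau>0 \<in> D" "\<tau>0 islimpt I"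
    and c: "0 \<le> c0" "c0 < c"
    and hol_s: "\<And>\<tau>. \<tau> \<in> D \<Longrightarrow> k \<tau> holomorphic_on {s. c0 < Re s}"
    and hol_\<tau>: "\<And>s. c0 < Re s \<Longrightarrow> (\<lambda>\<tau>. k \<tau> s) holomorphic_on D"
    and growth: "\<And>\<tau> s. \<tau> \<in> D \<Longrightarrow> c \<le> Re s \<Longrightarrow> norm (k \<tau> s) \<le> C * exp (Re s)"
    and small: "\<And>\<tau>. \<tau> \<in> I \<Longrightarrow> \<exists>B. \<forall>x\<ge>c. norm (k \<tau> (of_real x)) \<le> B"
    and \<tau>: "\<tau> \<in> D" and s0: "2 * c \<le> s0"
  shows "norm (k \<tau> (of_real s0)) \<le> C * exp c * s0 / (2 * c)"
proof -
  define r where "r = 1 / (2 * c)"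
  define w where "w = (\<lambda>x::real. of_real r + of_real r * exp (2 * of_real pi * \<i> * of_real x) :: complex)"
  define S where "S = {0..1} - {1/2 :: real}"
  define f where "f = (\<lambda>\<tau> x. k \<tau> (1 / w x) / (w x - 1 / of_real s0) * (w x - of_real r))"
  have c': "c > 0" using c by simp
  have r: "r > 0" using c' by (simp add: r_def)
  have C: "C \<ge> 0"
  proof -
    have "0 \<le> C * exp (Re (of_real c))" using growth[OF \<tau>, of "of_real c"] norm_ge_zero order_trans
      by (metis Re_complex_of_real order_refl)
    then show ?thesis by (simp add: zero_le_mult_iff)
  qed
  have nw: "norm (w x - of_real r) = r" for x using r by (simp add: w_def norm_mult)
  have wS: "w x \<noteq> 0 \<and> Re (1 / w x) = c" if x: "x \<in> S" for x
  proof -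
    have "w x \<noteq> 0"
    proof
      assume "w x = 0"
      then have "of_real r * (1 + exp (2 * of_real pi * \<i> * of_real x)) = 0" by (simp add: w_def distrib_left)
      then have "exp (2 * of_real pi * \<i> * of_real x) = -1" using r by (simp add: add_eq_0_iff)
      then show False using exp_2pi_i_eq_minus_one[of x] x by (auto simp: S_def)
    qed
    then show ?thesis using Re_inverse_le_iff[OF c', of "w x"] nw[of x] by (auto simp: r_def)
  qed
  have Smeas: "S \<in> sets lebesgue" by (simp add: S_def)
  have S1: "measure lebesgue S = 1"
  proof -
    have "measure lebesgue S = measure lebesgue {0..1::real}"
      unfolding S_def by (rule measure_negligible_symdiff) (auto intro: negligible_subset[of "{1/2}"])
    then show ?thesis by simp
  qed
  have fin: "finite_measure (lebesgue_on S)"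
    by (rule finite_measure_lebesgue_on) (simp add: S_def fmeasurable_Diff)
  have contw: "continuous_on S w" unfolding w_def by (intro continuous_intros)
  have contk: "continuous_on S (\<lambda>x. k \<tau> (1 / w x))" if "\<tau> \<in> D" for \<tau>
    by (rule continuous_on_compose2[OF holomorphic_on_imp_continuous_on[OF hol_s[OF that]]])
      (use wS c in \<open>auto intro!: continuous_intros contw\<close>)
  define w0 where "w0 = 1 / s0"
  have w0: "0 < w0" "w0 \<le> r" using s0 c' by (auto simp: w0_def r_def field_simps)
  \<comment> \<open>Here 2c \<le> s0 enters: the real point \<open>w0\<close> does not lie beyond
    the centre r, so the nearest point of the circle is 0, at distance \<open>w0\<close>.\<close>
  have den: "norm (w x - 1 / of_real s0) \<ge> w0" for x
  proof -
    have "r \<le> norm (w x - of_real w0) + norm (of_real w0 - of_real r :: complex)"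
      using norm_triangle_ineq[of "w x - of_real w0" "of_real w0 - of_real r"] nw[of x] by simp
    moreover have "norm (of_real w0 - of_real r :: complex) = r - w0"
      using w0 by (simp flip: of_real_diff)
    ultimately show ?thesis by (simp add: w0_def)
  qed
  have contf: "continuous_on S (f \<tau>)" if "\<tau> \<in> D" for \<tau>
  proof -
    have "w x - 1 / of_real s0 \<noteq> 0" for x using den[of x] w0(1) by auto
    then show ?thesis unfolding f_def by (intro continuous_intros contk[OF that] contw) auto
  qed
  have measf: "f \<tau> \<in> borel_measurable (lebesgue_on S)" if "\<tau> \<in> D" for \<tau>
    by (rule continuous_imp_measurable_on_sets_lebesgue[OF contf[OF that] Smeas])
  define M where "M = C * exp c / w0 * r"
  have bndf: "norm (f \<tau> x) \<le> M" if "\<tau> \<in> D" "x \<in> S" for \<tau> x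
  proof -
    have "norm (k \<tau> (1 / w x)) \<le> C * exp c" using growth[OF that(1), of "1 / w x"] wS[OF that(2)] by simp
    then have "norm (k \<tau> (1 / w x)) / norm (w x - 1 / of_real s0) * norm (w x - of_real r) \<le> M"
      unfolding M_def using den[of x] w0 C by (intro mult_mono frac_le) (auto simp: nw r)
    then show ?thesis by (simp add: f_def norm_mult norm_divide)
  qed
  have intM: "integrable (lebesgue_on S) (\<lambda>_. M)" using fin by (simp add: finite_measure.integrable_const)
  have intf: "integrable (lebesgue_on S) (f \<tau>)" if "\<tau> \<in> D" for \<tau>
    by (rule Bochner_Integration.integrable_bound[OF intM measf[OF that]]) (use bndf[OF that] in force)
  define E where "E = (\<lambda>\<tau>. k \<tau> (of_real s0) - (\<integral>x. f \<tau> x \<partial>lebesgue_on S))"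
  have "E \<tau> = 0"
  proof (rule analytic_continuation[where f=E, OF _ D I])
    show "E holomorphic_on D" unfolding E_def
    proof (intro holomorphic_on_diff holomorphic_on_integral[OF D(1) _ measf intM])
      show "(\<lambda>\<tau>. k \<tau> (of_real s0)) holomorphic_on D" by (rule hol_\<tau>) (use c s0 in simp)
      show "(\<lambda>\<tau>. f \<tau> x) holomorphic_on D" if "x \<in> space (lebesgue_on S)" for x
        unfolding f_def
        by (intro holomorphic_intros hol_\<tau>) (use that wS[of x] c den[of x] w0 in auto)
    qed (use bndf in auto)
  next
    fix \<sigma> assume \<sigma>: "\<sigma> \<in> I"
    then have \<sigma>D: "\<sigma> \<in> D" using I by auto
    obtain B where B: "\<And>x. x \<ge> c \<Longrightarrow> norm (k \<sigma> (of_real x)) \<le> B" using small[OF \<sigma>] by blast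
    \<comment> \<open>The boundary line Re s = c needs the bound C exp(c) from \<open>growth\<close>
      as well. The size of \<open>B'\<close> is irrelevant for the final estimate: it only makes
      Cauchy's formula valid.\<close>
    define B' where "B' = max 1 (max B (C * exp c))"
    have "norm (k \<sigma> s) \<le> B'" if "c \<le> Re s" for s
    proof (rule phragmen_lindelof_half_plane[OF hol_s[OF \<sigma>D] c(2) growth[OF \<sigma>D]])
      show "norm (k \<sigma> (of_real x)) \<le> B'" if "c \<le> x" for x
        using B[OF that] by (simp add: B'_def)
    qed (use that in \<open>auto simp: B'_def\<close>)
    then have "k \<sigma> (of_real s0) = integral S (f \<sigma>)"
      unfolding S_def f_def w_def r_def
      by (rule Cauchy_formula_bounded_half_plane[OF hol_s[OF \<sigma>D] c]) (use s0 c' in auto)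
    then show "E \<sigma> = 0"
      using lebesgue_integral_eq_integral[OF intf[OF \<sigma>D] Smeas] by (simp add: E_def)
  qed (fact \<tau>)
  then have "norm (k \<tau> (of_real s0)) = norm (\<integral>x. f \<tau> x \<partial>lebesgue_on S)" by (simp add: E_def)
  also have "\<dots> \<le> (\<integral>x. M \<partial>lebesgue_on S)"
    by (rule Bochner_Integration.integral_norm_bound_integral[OF intf[OF \<tau>] intM]) (use bndf[OF \<tau>] in auto)
  also have "\<dots> = M" using S1 Smeas by (simp add: measure_restrict_space)
  also have "M = C * exp c * s0 / (2 * c)" by (simp add: M_def w0_def r_def)
  finally show ?thesis .
qed

section \<open>Growth estimates\<close>

text \<open>The squared norm is differentiable also at zeros of \<open>w\<close>. Multiplied by
  \<open>exp (2 * (a * z - \<Phi> z))\<close> it is increasing for a = L and decreasing for a = -L.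
  Both directions occur later: one shows that solutions approach each other towards 0, the other
  bounds from below how close they can get.\<close>

lemma gronwall_two_sided:
  fixes w w' :: "real \<Rightarrow> complex" and \<Phi> \<Phi>' :: "real \<Rightarrow> real"
  assumes uv: "u \<le> v"
    and w: "\<And>z. z \<in> {u..v} \<Longrightarrow> (w has_vector_derivative w' z) (at z within {u..v})"
    and \<Phi>: "\<And>z. z \<in> {u..v} \<Longrightarrow> (\<Phi> has_real_derivative \<Phi>' z) (at z within {u..v})"
    and bnd: "\<And>z. z \<in> {u..v} \<Longrightarrow> norm (w' z - of_real (\<Phi>' z) * w z) \<le> L * norm (w z)"
  shows "norm (w u) \<le> exp (\<Phi> u - \<Phi> v + L * (v - u)) * norm (w v)"
    and "norm (w v) \<le> exp (\<Phi> v - \<Phi> u + L * (v - u)) * norm (w u)"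
proof -
  define N where "N = (\<lambda>z. w z \<bullet> w z)"
  have key: "\<bar>2 * (w z \<bullet> w' z) - 2 * \<Phi>' z * N z\<bar> \<le> 2 * L * N z" if z: "z \<in> {u..v}" for z
  proof -
    have "\<bar>w z \<bullet> (w' z - of_real (\<Phi>' z) * w z)\<bar> \<le> norm (w z) * (L * norm (w z))"
      using Cauchy_Schwarz_ineq2[of "w z" "w' z - of_real (\<Phi>' z) * w z"]
        mult_left_mono[OF bnd[OF z], of "norm (w z)"] by simp
    moreover have "w z \<bullet> (w' z - of_real (\<Phi>' z) * w z) = w z \<bullet> w' z - \<Phi>' z * N z"
      by (simp add: inner_diff_right N_def flip: scaleR_conv_of_real)
    moreover have "norm (w z) * (L * norm (w z)) = L * N z"
      by (simp add: N_def dot_square_norm power2_eq_square)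
    ultimately show ?thesis by (simp add: abs_le_iff)
  qed
  have der: "((\<lambda>z. exp (2 * (a * z - \<Phi> z)) * N z) has_real_derivative
       exp (2 * (a * z - \<Phi> z)) * (2 * (w z \<bullet> w' z) - 2 * \<Phi>' z * N z + 2 * a * N z)) (at z within {u..v})"
    if z: "z \<in> {u..v}" for z a
  proof -
    have "(N has_vector_derivative (w z \<bullet> w' z + w' z \<bullet> w z)) (at z within {u..v})"
      unfolding N_def has_vector_derivative_def
      by (rule has_derivative_eq_rhs[OF has_derivative_inner[OF w[OF z, unfolded has_vector_derivative_def] w[OF z, unfolded has_vector_derivative_def]]])
        (auto simp: inner_commute algebra_simps)
    then have N': "(N has_real_derivative 2 * (w z \<bullet> w' z)) (at z within {u..v})"
      by (simp add: has_real_derivative_iff_has_vector_derivative inner_commute)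
    have "((\<lambda>z. 2 * (a * z - \<Phi> z)) has_real_derivative (2 * (a - \<Phi>' z))) (at z within {u..v})"
      by (auto intro!: derivative_eq_intros \<Phi>[OF z])
    then have E': "((\<lambda>z. exp (2 * (a * z - \<Phi> z))) has_real_derivative
        exp (2 * (a * z - \<Phi> z)) * (2 * (a - \<Phi>' z))) (at z within {u..v})"
      by (rule DERIV_chain2[where f=exp, OF DERIV_exp])
    have arith: "e * (2 * (a - P)) * n + 2 * b * e = e * (2 * b - 2 * P * n + 2 * a * n)" for e b P n :: real
      by (simp add: algebra_simps)
    show ?thesis by (rule DERIV_cong[OF DERIV_mult[OF E' N']]) (rule arith)
  qed
  have cont: "continuous_on {u..v} (\<lambda>z. exp (2 * (a * z - \<Phi> z)) * N z)" for a
    by (rule DERIV_continuous_on[OF der])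
  have der_at: "((\<lambda>z. exp (2 * (a * z - \<Phi> z)) * N z) has_real_derivative
       exp (2 * (a * z - \<Phi> z)) * (2 * (w z \<bullet> w' z) - 2 * \<Phi>' z * N z + 2 * a * N z)) (at z)"
    if z: "u < z" "z < v" for z a
    using der[of z a] z at_within_Icc_at[of u z v] by simp
  have N2: "N z = (norm (w z))\<^sup>2" for z by (simp add: N_def dot_square_norm)
  have conv: "x \<le> exp d * y" if "exp (2 * a) * x\<^sup>2 \<le> exp (2 * b) * y\<^sup>2" "d = b - a" "y \<ge> 0" for x y a b d :: real
  proof -
    have "(exp a * x)\<^sup>2 \<le> (exp b * y)\<^sup>2"
      using that(1) by (simp add: power_mult_distrib exp_double)
    then have "exp a * x \<le> exp b * y" by (rule power2_le_imp_le) (use that in simp)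
    then show ?thesis by (simp add: that(2) exp_diff field_simps)
  qed
  have "exp (2 * (L * u - \<Phi> u)) * N u \<le> exp (2 * (L * v - \<Phi> v)) * N v"
  proof (rule DERIV_nonneg_imp_increasing_open[OF uv _ cont])
    fix z assume z: "u < z" "z < v"
    have "0 \<le> 2 * (w z \<bullet> w' z) - 2 * \<Phi>' z * N z + 2 * L * N z"
      using key[of z] z by (simp add: abs_le_iff)
    then show "\<exists>y. ((\<lambda>z. exp (2 * (L * z - \<Phi> z)) * N z) has_real_derivative y) (at z) \<and> 0 \<le> y"
      using der_at[OF z, of L] by (meson exp_ge_zero mult_nonneg_nonneg)
  qed
  then show "norm (w u) \<le> exp (\<Phi> u - \<Phi> v + L * (v - u)) * norm (w v)"
    unfolding N2 by (rule conv) (simp_all add: right_diff_distrib)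
  have "exp (2 * ((- L) * v - \<Phi> v)) * N v \<le> exp (2 * ((- L) * u - \<Phi> u)) * N u"
  proof (rule DERIV_nonpos_imp_decreasing_open[OF uv _ cont])
    fix z assume z: "u < z" "z < v"
    have "2 * (w z \<bullet> w' z) - 2 * \<Phi>' z * N z + 2 * (- L) * N z \<le> 0"
      using key[of z] z by (simp add: abs_le_iff)
    then show "\<exists>y. ((\<lambda>z. exp (2 * ((- L) * z - \<Phi> z)) * N z) has_real_derivative y) (at z) \<and> y \<le> 0"
      using der_at[OF z, of "- L"] by (meson exp_ge_zero mult_nonneg_nonpos)
  qed
  then show "norm (w v) \<le> exp (\<Phi> v - \<Phi> u + L * (v - u)) * norm (w u)"
    unfolding N2 by (rule conv) (simp_all add: right_diff_distrib)
qed

text \<open>Used for \<sigma> and r - \<sigma>, where it yields \<sigma>^p - r^p \<le> - (r -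
  \<sigma>)^p. This decay is uniform in \<sigma>, even near \<sigma> = 0, where the derivative of
  \<sigma>^p degenerates.\<close>

lemma power_add_ge:
  fixes x y :: real
  assumes "x \<ge> 0" "y \<ge> 0" "p > 0"
  shows "x ^ p + y ^ p \<le> (x + y) ^ p"
proof -
  have "x ^ Suc n + y ^ Suc n \<le> (x + y) ^ Suc n" for n
  proof (induction n)
    case (Suc n)
    have "x ^ Suc (Suc n) + y ^ Suc (Suc n) \<le> (x + y) * (x ^ Suc n + y ^ Suc n)"
      using assms by (simp add: algebra_simps)
    also have "\<dots> \<le> (x + y) * (x + y) ^ Suc n"
      using Suc assms by (intro mult_left_mono) auto
    finally show ?case by simp
  qed simp
  from this[of "p - 1"] show ?thesis using assms by simp
qed

text \<open>The integral is cut at distance \<kappa>/2 from \<sigma>: the near part is small by its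
  length, the far part because the integrand is at most exp(- x (\<kappa>/2)^p). Smallness of this
  kernel is the source of every contraction constant below.\<close>

lemma integral_exp_power_small:
  fixes \<kappa> :: real
  assumes "p > 0" "\<kappa> > 0"
  obtains c where "c > 0"
    "\<And>\<sigma> x. \<sigma> \<in> {0..1} \<Longrightarrow> c \<le> x \<Longrightarrow> integral {\<sigma>..1} (\<lambda>r. exp ((\<sigma> ^ p - r ^ p) * x)) \<le> \<kappa>"
proof -
  define h where "h = \<kappa> / 2"
  have h: "h > 0" using assms by (simp add: h_def)
  have "((\<lambda>x. exp (- x * h ^ p)) \<longlongrightarrow> 0) at_top" using h by real_asymp
  then have "\<forall>\<^sub>F x in at_top. exp (- x * h ^ p) < h" using h by (rule order_tendstoD)
  then obtain c0 where c0: "\<And>x. x \<ge> c0 \<Longrightarrow> exp (- x * h ^ p) < h"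
    by (auto simp: eventually_at_top_linorder)
  show ?thesis
  proof (rule that[of "max c0 1"])
    fix \<sigma> x :: real assume \<sigma>: "\<sigma> \<in> {0..1}" and x: "max c0 1 \<le> x"
    let ?f = "\<lambda>r. exp ((\<sigma> ^ p - r ^ p) * x)"
    have int: "?f integrable_on {a..b}" for a b by (intro integrable_continuous_real continuous_intros)
    define d where "d = min 1 (\<sigma> + h)"
    have d: "\<sigma> \<le> d" "d \<le> 1" "d \<le> \<sigma> + h" using \<sigma> h by (auto simp: d_def)
    have "integral {\<sigma>..d} ?f \<le> integral {\<sigma>..d} (\<lambda>_. 1)"
    proof (rule integral_le[OF int])
      fix r assume r: "r \<in> {\<sigma>..d}"
      then have "\<sigma> ^ p \<le> r ^ p" using \<sigma> by (intro power_mono) auto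
      then have "(\<sigma> ^ p - r ^ p) * x \<le> 0" using x by (intro mult_nonpos_nonneg) auto
      then show "?f r \<le> 1" by simp
    qed (intro integrable_continuous_real continuous_intros)
    moreover have "integral {\<sigma>..d} (\<lambda>_. 1::real) \<le> h" using d by simp
    moreover have "integral {d..1} ?f \<le> h"
    proof (cases "\<sigma> + h \<le> 1")
      case True
      have "integral {d..1} ?f \<le> integral {d..1} (\<lambda>_. h)"
      proof (rule integral_le[OF int])
        fix r assume r: "r \<in> {d..1}"
        then have rd: "r - \<sigma> \<ge> h" using True by (simp add: d_def)
        have "\<sigma> ^ p + (r - \<sigma>) ^ p \<le> r ^ p"
          using power_add_ge[of \<sigma> "r - \<sigma>" p] \<sigma> rd h assms by simp
        moreover have "h ^ p \<le> (r - \<sigma>) ^ p" using rd h by (intro power_mono) auto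
        ultimately have "(\<sigma> ^ p - r ^ p) * x \<le> - (h ^ p) * x"
          using x by (intro mult_right_mono) auto
        then have "?f r \<le> exp (- x * h ^ p)" by (simp add: mult.commute)
        also have "\<dots> \<le> h" using c0[of x] x by simp
        finally show "?f r \<le> h" .
      qed (intro integrable_continuous_real continuous_intros)
      also have "\<dots> \<le> 1 * h" using d \<sigma> h by (simp add: mult_left_le_one_le)
      finally show ?thesis by simp
    next
      case False
      then have "d = 1" by (simp add: d_def)
      then show ?thesis using h by simp
    qed
    moreover have "integral {\<sigma>..1} ?f = integral {\<sigma>..d} ?f + integral {d..1} ?f"
      using Henstock_Kurzweil_Integration.integral_combine[OF d(1,2) int] by simp
    ultimately show "integral {\<sigma>..1} ?f \<le> \<kappa>" unfolding h_def by linarith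
  qed simp
qed

section \<open>The equation on complex rays\<close>

definition strip :: "real \<Rightarrow> real \<Rightarrow> real \<Rightarrow> complex set"
  where "strip A B h = {z. - A < Re z \<and> Re z < B \<and> \<bar>Im z\<bar> < h}"

lemma of_real_in_strip [simp]: "of_real x \<in> strip A B h \<longleftrightarrow> - A < x \<and> x < B \<and> 0 < h"
  by (auto simp: strip_def)

lemma minus_in_strip: "- z \<in> strip A B h \<longleftrightarrow> z \<in> strip B A h"
  by (auto simp: strip_def)

lemma strip_mono: "A \<le> A' \<Longrightarrow> B \<le> B' \<Longrightarrow> strip A B h \<subseteq> strip A' B' h"
  by (auto simp: strip_def)

lemma open_strip: "open (strip A B h)"
  unfolding strip_def by (intro open_Collect_conj open_Collect_less continuous_intros)

lemma convex_strip: "convex (strip A B h)"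
proof -
  have "strip A B h = {z. Re z > - A} \<inter> {z. Re z < B} \<inter> {z. Im z < h} \<inter> {z. Im z > - h}"
    by (auto simp: strip_def abs_less_iff)
  then show ?thesis
    by (simp add: convex_Int convex_halfspace_Re_gt convex_halfspace_Re_lt convex_halfspace_Im_gt convex_halfspace_Im_lt)
qed

lemma strip_subset_open:
  assumes "open G" "of_real ` {- A..B} \<subseteq> G"
  obtains h where "0 < h" "strip A B h \<subseteq> G"
proof -
  have "compact (complex_of_real ` {- A..B})"
    by (intro compact_continuous_image continuous_intros compact_Icc)
  then obtain h where h: "0 < h" "(\<Union>x\<in>complex_of_real ` {- A..B}. cball x h) \<subseteq> G"
    using assms compact_subset_open_imp_cball_epsilon_subset by metis
  have "strip A B h \<subseteq> G"
  proof
    fix z assume z: "z \<in> strip A B h"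
    have "dist (of_real (Re z)) z = \<bar>Im z\<bar>"
      by (simp add: dist_norm cmod_def)
    then have "z \<in> cball (of_real (Re z)) h" "Re z \<in> {- A..B}" using z by (auto simp: strip_def)
    then show "z \<in> G" using h(2) by blast
  qed
  then show ?thesis using that h(1) by blast
qed

text \<open>The equation \<open>\<epsilon> dy/dz = p z\<^bsup>p-1\<^esup> y + \<epsilon> R(z, y, \<epsilon>)\<close> on a strip around a real interval. The
  constant \<open>c\<close> is so large that the integral operator below is a contraction as long as
  \<open>Re (\<tau>\<^sup>p / \<epsilon>) \<ge> c\<close>, where \<open>\<tau>\<close> is the end of the ray \<open>z = \<tau> \<sigma>\<close>.\<close>

locale normal_form =
  fixes p :: nat and R :: "complex \<Rightarrow> complex \<Rightarrow> complex \<Rightarrow> complex"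
    and A B h \<rho> e0 K L c \<kappa> :: real
  assumes p_even: "even p" and p2: "2 \<le> p"
    and pos: "0 < A" "0 < B" "0 < h" "0 < \<rho>" "0 < e0" "0 \<le> K" "0 \<le> L" "0 < c"
    and R_bound: "\<And>z y e. z \<in> strip A B h \<Longrightarrow> norm y \<le> \<rho> \<Longrightarrow> norm e < e0 \<Longrightarrow> norm (R z y e) \<le> K"
    and R_lip: "\<And>z y y' e. z \<in> strip A B h \<Longrightarrow> norm y \<le> \<rho> \<Longrightarrow> norm y' \<le> \<rho> \<Longrightarrow> norm e < e0 \<Longrightarrow>
        norm (R z y e - R z y' e) \<le> L * norm (y - y')"
    and R_real: "\<And>z y e. z \<in> strip A B h \<Longrightarrow> norm y \<le> \<rho> \<Longrightarrow> norm e < e0 \<Longrightarrow>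
        z \<in> \<real> \<Longrightarrow> y \<in> \<real> \<Longrightarrow> e \<in> \<real> \<Longrightarrow> R z y e \<in> \<real>"
    and R_cont: "continuous_on (strip A B h \<times> cball 0 \<rho> \<times> ball 0 e0) (\<lambda>(z, y, e). R z y e)"
    \<comment> \<open>Joint holomorphy is required only along holomorphic curves. This is the form
      in which the Picard iterates use it, with the parameter as curve variable.\<close>
    and R_hol: "\<And>S g v e. open S \<Longrightarrow> g holomorphic_on S \<Longrightarrow> v holomorphic_on S \<Longrightarrow> e holomorphic_on S \<Longrightarrow>
        (\<And>t. t \<in> S \<Longrightarrow> g t \<in> strip A B h \<and> norm (v t) \<le> \<rho> \<and> norm (e t) < e0) \<Longrightarrow>
        (\<lambda>t. R (g t) (v t) (e t)) holomorphic_on S"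
    and kernel: "\<And>\<sigma> x. \<sigma> \<in> {0..1} \<Longrightarrow> c \<le> x \<Longrightarrow>
        integral {\<sigma>..1} (\<lambda>r. exp ((\<sigma> ^ p - r ^ p) * x)) \<le> \<kappa>"
    \<comment> \<open>A + B + h bounds the modulus of \<tau> on the strip. The first inequality
      leaves the ball of radius \<rho> invariant with room to spare, the second gives the
      contraction factor 1/2; \<open>c_large\<close> keeps \<epsilon> = \<tau>^p / s in the domain
      of \<open>R\<close>.\<close>
    and \<kappa>: "(A + B + h) * K * \<kappa> \<le> \<rho> / 4" "(A + B + h) * L * \<kappa> \<le> 1 / 2" 
    and c_large: "(A + B + h) ^ p / c < e0"
begin

abbreviation "D \<equiv> strip A B h"
abbreviation "m \<equiv> A + B + h"

lemma m_pos: "m > 0" using pos by simp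

lemma strip_scale:
  assumes "\<tau> \<in> D" "r \<in> {0..1}"
  shows "\<tau> * of_real r \<in> D"
proof -
  have aux: "- A < x * r" "x * r < B" if "- A < x" "x < B" for x
  proof -
    show "x * r < B"
    proof (cases "x \<le> 0")
      case True
      then have "x * r \<le> 0" using assms by (intro mult_nonpos_nonneg) auto
      then show ?thesis using pos by simp
    next
      case False
      then have "x * r \<le> x" using assms by (intro mult_left_le) auto
      then show ?thesis using that by simp
    qed
    show "- A < x * r"
    proof (cases "x \<ge> 0")
      case True
      then have "x * r \<ge> 0" using assms by auto
      then show ?thesis using pos by simp
    next
      case False
      then have "(- x) * r \<le> - x" using assms by (intro mult_left_le) auto
      then show ?thesis using that by simp
    qed
  qed
  have "\<bar>Im \<tau> * r\<bar> \<le> \<bar>Im \<tau>\<bar>" using assms by (auto simp: abs_mult intro!: mult_left_le)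
  then show ?thesis using assms aux[of "Re \<tau>"] by (auto simp: strip_def)
qed

lemma strip_norm: "\<tau> \<in> D \<Longrightarrow> norm \<tau> \<le> m"
  using cmod_le[of \<tau>] pos by (auto simp: strip_def)

lemma eps_small:
  assumes "\<tau> \<in> D" "c \<le> Re s"
  shows "norm (\<tau> ^ p / s) < e0"
proof -
  have "c \<le> norm s" using assms complex_Re_le_cmod[of s] by linarith
  moreover have "norm \<tau> ^ p \<le> m ^ p" using strip_norm[OF assms(1)] by (intro power_mono) auto
  ultimately have "norm \<tau> ^ p / norm s \<le> m ^ p / c" using pos m_pos by (intro frac_le) auto
  then show ?thesis using c_large by (simp add: norm_divide norm_power)
qed

section \<open>The integral operator on a ray\<close>

definition integrand :: "complex \<Rightarrow> complex \<Rightarrow> (real \<Rightarrow> complex) \<Rightarrow> real \<Rightarrow> real \<Rightarrow> complex"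
  where "integrand \<tau> s y \<sigma> r =
    exp (of_real (\<sigma> ^ p - r ^ p) * s) * R (\<tau> * of_real r) (y r) (\<tau> ^ p / s)"

text \<open>Fixed points solve \<open>dy/d\<sigma> = s p \<sigma>\<^bsup>p-1\<^esup> y + \<tau> R(\<tau> \<sigma>, y, \<tau>\<^sup>p / s)\<close>, \<open>y(1) = \<beta>\<close>, which is the
  equation on the ray \<open>z = \<tau> \<sigma>\<close> with \<open>\<epsilon> = \<tau>\<^sup>p / s\<close>.\<close>

definition T :: "complex \<Rightarrow> complex \<Rightarrow> complex \<Rightarrow> (real \<Rightarrow> complex) \<Rightarrow> real \<Rightarrow> complex"
  where "T \<tau> s \<beta> y \<sigma> =
    \<beta> * exp (of_real (\<sigma> ^ p - 1) * s) - \<tau> * integral {\<sigma>..1} (integrand \<tau> s y \<sigma>)"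

definition admissible :: "(real \<Rightarrow> complex) \<Rightarrow> bool"
  where "admissible y \<longleftrightarrow> continuous_on {0..1} y \<and> (\<forall>r\<in>{0..1}. norm (y r) \<le> \<rho>)"

lemma R_continuous_on_ray:
  assumes "\<tau> \<in> D" "c \<le> Re s" "admissible y"
  shows "continuous_on {0..1} (\<lambda>r. R (\<tau> * of_real r) (y r) (\<tau> ^ p / s))"
proof -
  have "continuous_on {0..1} (\<lambda>r. (\<lambda>(z, y, e). R z y e) (\<tau> * of_real r, y r, \<tau> ^ p / s))"
    by (rule continuous_on_compose2[OF R_cont])
      (use assms strip_scale eps_small in \<open>auto simp: admissible_def intro!: continuous_intros\<close>)
  then show ?thesis by simp
qed

lemma integrand_continuous:
  assumes "\<tau> \<in> D" "c \<le> Re s" "admissible y"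
  shows "continuous_on {0..1} (integrand \<tau> s y \<sigma>)"
  unfolding integrand_def by (intro continuous_intros R_continuous_on_ray assms)

lemma integrand_integrable:
  assumes "\<tau> \<in> D" "c \<le> Re s" "admissible y" "\<sigma> \<in> {0..1}"
  shows "integrand \<tau> s y \<sigma> integrable_on {\<sigma>..1}"
  by (intro integrable_continuous_real continuous_on_subset[OF integrand_continuous[OF assms(1-3)]])
    (use assms in auto)

lemma norm_integral_exp_le:
  fixes f g :: "real \<Rightarrow> complex"
  assumes "\<sigma> \<in> {0..1}" "c \<le> Re s" "0 \<le> M" "f integrable_on {\<sigma>..1}"
    and "\<And>r. r \<in> {\<sigma>..1} \<Longrightarrow> norm (f r) \<le> exp ((\<sigma> ^ p - r ^ p) * Re s) * M"
  shows "norm (integral {\<sigma>..1} f) \<le> \<kappa> * M"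
proof -
  have "norm (integral {\<sigma>..1} f) \<le> integral {\<sigma>..1} (\<lambda>r. exp ((\<sigma> ^ p - r ^ p) * Re s) * M)"
    by (rule integral_norm_bound_integral[OF assms(4)])
      (use assms(5) in \<open>auto intro!: integrable_continuous_real continuous_intros\<close>)
  also have "\<dots> \<le> \<kappa> * M"
    using kernel[OF assms(1,2)] assms(3) by (simp add: mult_right_mono)
  finally show ?thesis .
qed

text \<open>The first summand is damped since Re s > 0. That the integral costs only \<rho>/4
  matters beyond invariance of the ball: it separates the end values with modulus \<rho>/2 from the
  solution with end value 0 in the shooting argument.\<close>

lemma T_bound:
  assumes \<tau>: "\<tau> \<in> D" "c \<le> Re s" and y: "admissible y" and \<sigma>: "\<sigma> \<in> {0..1}"
  shows "norm (T \<tau> s \<beta> y \<sigma>) \<le> norm \<beta> + \<rho> / 4"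
proof -
  have "\<sigma> ^ p \<le> 1" using \<sigma> by (auto intro: power_le_one)
  then have "(\<sigma> ^ p - 1) * Re s \<le> 0" using \<tau> pos by (intro mult_nonpos_nonneg) auto
  then have "norm \<beta> * exp ((\<sigma> ^ p - 1) * Re s) \<le> norm \<beta> * 1" by (intro mult_left_mono) auto
  then have 1: "norm (\<beta> * exp (of_real (\<sigma> ^ p - 1) * s)) \<le> norm \<beta>" by (simp add: norm_mult)
  have "norm (integral {\<sigma>..1} (integrand \<tau> s y \<sigma>)) \<le> \<kappa> * K"
  proof (rule norm_integral_exp_le[OF \<sigma> \<tau>(2) pos(6) integrand_integrable[OF \<tau> y \<sigma>]])
    fix r assume r: "r \<in> {\<sigma>..1}"
    then have "r \<in> {0..1}" using \<sigma> by auto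
    then show "norm (integrand \<tau> s y \<sigma> r) \<le> exp ((\<sigma> ^ p - r ^ p) * Re s) * K"
      using R_bound[OF strip_scale[OF \<tau>(1)] _ eps_small[OF \<tau>], of r "y r"] y
      by (auto simp: integrand_def norm_mult admissible_def)
  qed
  then have "norm (\<tau> * integral {\<sigma>..1} (integrand \<tau> s y \<sigma>)) \<le> m * (\<kappa> * K)"
    unfolding norm_mult using strip_norm[OF \<tau>(1)] m_pos by (intro mult_mono) auto
  then have "norm (\<tau> * integral {\<sigma>..1} (integrand \<tau> s y \<sigma>)) \<le> \<rho> / 4"
    using \<kappa>(1) by (simp only: mult.commute[of \<kappa> K] mult.assoc[symmetric])
  with 1 show ?thesis unfolding T_def using norm_triangle_ineq4 add_mono order_trans by blast
qed

text \<open>The kernel is a product of a function of \<sigma> and a function of r, so \<sigma> can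
  be taken out of the integrand. Continuity and differentiability in \<sigma> thereby reduce to
  those of an indefinite integral. Estimates keep the unsplit form, because
  \<open>exp (of_real (\<sigma> ^ p) * s)\<close> alone is huge.\<close>

lemma T_factor:
  assumes "\<tau> \<in> D" "c \<le> Re s" "admissible y" "\<sigma> \<in> {0..1}"
  shows "T \<tau> s \<beta> y \<sigma> = exp (of_real (\<sigma> ^ p) * s) *
    (\<beta> * exp (- s) - \<tau> * integral {\<sigma>..1} (integrand \<tau> s y 0))"
proof -
  have "integrand \<tau> s y \<sigma> r = exp (of_real (\<sigma> ^ p) * s) * integrand \<tau> s y 0 r" for r
    using p2 by (simp add: integrand_def left_diff_distrib exp_diff exp_minus field_simps power_0_left)
  then have "integral {\<sigma>..1} (integrand \<tau> s y \<sigma>) = integral {\<sigma>..1} (\<lambda>r. exp (of_real (\<sigma> ^ p) * s) * integrand \<tau> s y 0 r)"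
    by (intro Henstock_Kurzweil_Integration.integral_cong)
  then have "integral {\<sigma>..1} (integrand \<tau> s y \<sigma>) = exp (of_real (\<sigma> ^ p) * s) * integral {\<sigma>..1} (integrand \<tau> s y 0)"
    by simp
  then show ?thesis
    by (simp add: T_def left_diff_distrib exp_diff exp_minus field_simps)
qed

lemma T_admissible:
  assumes \<tau>: "\<tau> \<in> D" "c \<le> Re s" and y: "admissible y" and \<beta>: "norm \<beta> \<le> \<rho> / 2"
  shows "admissible (T \<tau> s \<beta> y)"
proof -
  have "continuous_on {0..1} (\<lambda>\<sigma>. exp (of_real (\<sigma> ^ p) * s) *
      (\<beta> * exp (- s) - \<tau> * integral {\<sigma>..1} (integrand \<tau> s y 0)))"
    by (intro continuous_intros indefinite_integral_continuous_1' integrand_integrable \<tau> y) auto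
  then have "continuous_on {0..1} (T \<tau> s \<beta> y)"
    by (rule continuous_on_eq) (simp add: T_factor[OF \<tau> y])
  moreover have "norm (T \<tau> s \<beta> y \<sigma>) \<le> \<rho>" if "\<sigma> \<in> {0..1}" for \<sigma>
    using T_bound[OF \<tau> y that, of \<beta>] \<beta> pos by simp
  ultimately show ?thesis by (simp add: admissible_def)
qed

lemma T_contraction:
  assumes \<tau>: "\<tau> \<in> D" "c \<le> Re s" and y: "admissible y" "admissible y'" and \<sigma>: "\<sigma> \<in> {0..1}"
    and d: "\<And>r. r \<in> {0..1} \<Longrightarrow> norm (y r - y' r) \<le> d"
  shows "norm (T \<tau> s \<beta> y \<sigma> - T \<tau> s \<beta> y' \<sigma>) \<le> d / 2"
proof -
  have d0: "d \<ge> 0" using order_trans[OF norm_ge_zero d[of 0]] by simp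
  note int = integrand_integrable[OF \<tau> y(1) \<sigma>] integrand_integrable[OF \<tau> y(2) \<sigma>]
  have "norm (integral {\<sigma>..1} (\<lambda>r. integrand \<tau> s y \<sigma> r - integrand \<tau> s y' \<sigma> r)) \<le> \<kappa> * (L * d)"
  proof (rule norm_integral_exp_le[OF \<sigma> \<tau>(2) _ integrable_diff[OF int]])
    fix r assume r: "r \<in> {\<sigma>..1}"
    then have r': "r \<in> {0..1}" using \<sigma> by auto
    have "norm (R (\<tau> * of_real r) (y r) (\<tau> ^ p / s) - R (\<tau> * of_real r) (y' r) (\<tau> ^ p / s)) \<le> L * norm (y r - y' r)"
      by (rule R_lip[OF strip_scale[OF \<tau>(1) r'] _ _ eps_small[OF \<tau>]]) (use y r' in \<open>auto simp: admissible_def\<close>)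
    also have "\<dots> \<le> L * d" using d[OF r'] pos by (intro mult_left_mono) auto
    finally show "norm (integrand \<tau> s y \<sigma> r - integrand \<tau> s y' \<sigma> r) \<le> exp ((\<sigma> ^ p - r ^ p) * Re s) * (L * d)"
      by (simp add: integrand_def norm_mult flip: right_diff_distrib)
  qed (use d0 pos in simp)
  then have "norm \<tau> * norm (integral {\<sigma>..1} (\<lambda>r. integrand \<tau> s y \<sigma> r - integrand \<tau> s y' \<sigma> r)) \<le> m * (\<kappa> * (L * d))"
    using strip_norm[OF \<tau>(1)] m_pos by (intro mult_mono) auto
  also have "m * (\<kappa> * (L * d)) = (m * L * \<kappa>) * d" by simp
  also have "\<dots> \<le> 1 / 2 * d" using \<kappa>(2) d0 by (rule mult_right_mono)
  finally have "norm (\<tau> * (integral {\<sigma>..1} (integrand \<tau> s y \<sigma>) - integral {\<sigma>..1} (integrand \<tau> s y' \<sigma>))) \<le> d / 2"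
    using Henstock_Kurzweil_Integration.integral_diff[OF int] by (simp add: norm_mult)
  moreover have "T \<tau> s \<beta> y \<sigma> - T \<tau> s \<beta> y' \<sigma>
      = - (\<tau> * (integral {\<sigma>..1} (integrand \<tau> s y \<sigma>) - integral {\<sigma>..1} (integrand \<tau> s y' \<sigma>)))"
    unfolding T_def by (simp add: algebra_simps)
  ultimately show ?thesis by (simp only: norm_minus_cancel)
qed

text \<open>Explicit Picard iterates are kept instead of an abstract fixed point, since holomorphy
  in the parameters and reality for real data are proved by induction on the iterates and pass to
  the limit.\<close>

primrec iter :: "complex \<Rightarrow> complex \<Rightarrow> complex \<Rightarrow> nat \<Rightarrow> real \<Rightarrow> complex"
  where "iter \<tau> s \<beta> 0 = (\<lambda>_. 0)"
  | "iter \<tau> s \<beta> (Suc n) = T \<tau> s \<beta> (iter \<tau> s \<beta> n)"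

definition sol :: "complex \<Rightarrow> complex \<Rightarrow> complex \<Rightarrow> real \<Rightarrow> complex"
  where "sol \<tau> s \<beta> \<sigma> = lim (\<lambda>n. iter \<tau> s \<beta> n \<sigma>)"

section \<open>The fixed point for given parameters\<close>

context
  fixes \<tau> s \<beta> :: complex assumes \<tau>: "\<tau> \<in> D" and s: "c \<le> Re s" and \<beta>: "norm \<beta> \<le> \<rho> / 2"
begin

lemma iter_admissible: "admissible (iter \<tau> s \<beta> n)"
  by (induction n) (use pos T_admissible[OF \<tau> s _ \<beta>] in \<open>auto simp: admissible_def\<close>)

lemma iter_step:
  assumes "\<sigma> \<in> {0..1}"
  shows "norm (iter \<tau> s \<beta> (Suc n) \<sigma> - iter \<tau> s \<beta> n \<sigma>) \<le> \<rho> * (1 / 2) ^ n"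
  using assms
proof (induction n arbitrary: \<sigma>)
  case 0
  then show ?case using iter_admissible[of 1] by (simp add: admissible_def)
next
  case (Suc n)
  have "norm (T \<tau> s \<beta> (iter \<tau> s \<beta> (Suc n)) \<sigma> - T \<tau> s \<beta> (iter \<tau> s \<beta> n) \<sigma>) \<le> \<rho> * (1 / 2) ^ n / 2"
    by (rule T_contraction[OF \<tau> s iter_admissible iter_admissible Suc.prems Suc.IH])
  then show ?case by simp
qed

text \<open>The right-hand side is the exact geometric sum of the steps n, ..., n + k - 1; stated
  with the subtracted tail the induction on k closes.\<close>

lemma iter_diff:
  assumes "\<sigma> \<in> {0..1}"
  shows "norm (iter \<tau> s \<beta> (n + k) \<sigma> - iter \<tau> s \<beta> n \<sigma>) \<le> 2 * \<rho> * (1 / 2) ^ n - 2 * \<rho> * (1 / 2) ^ (n + k)"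
proof (induction k)
  case (Suc k)
  have "norm (iter \<tau> s \<beta> (n + Suc k) \<sigma> - iter \<tau> s \<beta> n \<sigma>)
      \<le> norm (iter \<tau> s \<beta> (Suc (n + k)) \<sigma> - iter \<tau> s \<beta> (n + k) \<sigma>) + norm (iter \<tau> s \<beta> (n + k) \<sigma> - iter \<tau> s \<beta> n \<sigma>)"
    using norm_triangle_ineq[of "iter \<tau> s \<beta> (Suc (n + k)) \<sigma> - iter \<tau> s \<beta> (n + k) \<sigma>" "iter \<tau> s \<beta> (n + k) \<sigma> - iter \<tau> s \<beta> n \<sigma>"]
    by simp
  also have "\<dots> \<le> \<rho> * (1 / 2) ^ (n + k) + (2 * \<rho> * (1 / 2) ^ n - 2 * \<rho> * (1 / 2) ^ (n + k))"
    using iter_step[OF assms, of "n + k"] Suc by (intro add_mono) auto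
  also have "\<dots> = 2 * \<rho> * (1 / 2) ^ n - 2 * \<rho> * (1 / 2) ^ (n + Suc k)" by simp
  finally show ?case .
qed simp

lemma iter_tendsto_sol:
  assumes "\<sigma> \<in> {0..1}"
  shows "(\<lambda>n. iter \<tau> s \<beta> n \<sigma>) \<longlonglongrightarrow> sol \<tau> s \<beta> \<sigma>"
proof -
  have "Cauchy (\<lambda>n. iter \<tau> s \<beta> n \<sigma>)"
  proof (rule CauchyI')
    fix e :: real assume "0 < e"
    have "(\<lambda>n. 2 * \<rho> * (1 / 2) ^ n) \<longlonglongrightarrow> 0" by real_asymp
    then have "\<forall>\<^sub>F n in sequentially. 2 * \<rho> * (1 / 2) ^ n < e" using \<open>e > 0\<close> by (rule order_tendstoD)
    then obtain N where N: "\<And>n. n \<ge> N \<Longrightarrow> 2 * \<rho> * (1 / 2) ^ n < e" by (auto simp: eventually_sequentially)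
    have "norm (iter \<tau> s \<beta> k \<sigma> - iter \<tau> s \<beta> n \<sigma>) < e" if "n \<ge> N" "k > n" for n k
    proof -
      obtain j where j: "k = n + j" using \<open>k > n\<close> less_imp_add_positive by blast
      have "2 * \<rho> * (1 / 2) ^ (n + j) \<ge> 0" using pos by simp
      then show ?thesis using iter_diff[OF assms, of n j] N[OF that(1)] unfolding j by linarith
    qed
    then show "\<exists>M. \<forall>j\<ge>M. \<forall>n>j. dist (iter \<tau> s \<beta> j \<sigma>) (iter \<tau> s \<beta> n \<sigma>) < e"
      by (metis norm_minus_commute dist_norm)
  qed
  then show ?thesis unfolding sol_def using Cauchy_convergent convergent_LIMSEQ_iff by blast
qed

lemma sol_iter:
  assumes "\<sigma> \<in> {0..1}"
  shows "norm (sol \<tau> s \<beta> \<sigma> - iter \<tau> s \<beta> n \<sigma>) \<le> 2 * \<rho> * (1 / 2) ^ n"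
proof (rule LIMSEQ_le_const2)
  show "(\<lambda>k. norm (iter \<tau> s \<beta> (n + k) \<sigma> - iter \<tau> s \<beta> n \<sigma>)) \<longlonglongrightarrow> norm (sol \<tau> s \<beta> \<sigma> - iter \<tau> s \<beta> n \<sigma>)"
    by (intro tendsto_intros LIMSEQ_ignore_initial_segment[OF iter_tendsto_sol[OF assms], of n, unfolded add.commute[of _ n]])
  have "2 * \<rho> * (1 / 2) ^ (n + k) \<ge> 0" for k using pos by simp
  then show "\<exists>N. \<forall>k\<ge>N. norm (iter \<tau> s \<beta> (n + k) \<sigma> - iter \<tau> s \<beta> n \<sigma>) \<le> 2 * \<rho> * (1 / 2) ^ n"
    using iter_diff[OF assms, of n] by (smt (verit))
qed

lemma iter_uniform_limit:
  "uniform_limit {0..1} (iter \<tau> s \<beta>) (sol \<tau> s \<beta>) sequentially"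
proof (rule uniform_limitI)
  fix e :: real assume "e > 0"
  have "(\<lambda>n. 2 * \<rho> * (1 / 2) ^ n) \<longlonglongrightarrow> 0" by real_asymp
  then have "\<forall>\<^sub>F n in sequentially. 2 * \<rho> * (1 / 2) ^ n < e" using \<open>e > 0\<close> by (rule order_tendstoD)
  then show "\<forall>\<^sub>F n in sequentially. \<forall>x\<in>{0..1}. dist (iter \<tau> s \<beta> n x) (sol \<tau> s \<beta> x) < e"
  proof eventually_elim
    case (elim n)
    show ?case
      using le_less_trans[OF sol_iter elim] by (simp add: dist_norm norm_minus_commute)
  qed
qed

lemma sol_admissible: "admissible (sol \<tau> s \<beta>)"
  unfolding admissible_def
proof
  show "continuous_on {0..1} (sol \<tau> s \<beta>)"
    by (rule uniform_limit_theorem[OF _ iter_uniform_limit])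
      (use iter_admissible in \<open>auto simp: admissible_def\<close>)
  show "\<forall>r\<in>{0..1}. norm (sol \<tau> s \<beta> r) \<le> \<rho>"
  proof
    fix r :: real assume r: "r \<in> {0..1}"
    show "norm (sol \<tau> s \<beta> r) \<le> \<rho>"
      by (rule LIMSEQ_le_const2[OF tendsto_norm[OF iter_tendsto_sol[OF r]]])
        (use iter_admissible r in \<open>auto simp: admissible_def\<close>)
  qed
qed

lemma sol_fixed:
  assumes "\<sigma> \<in> {0..1}"
  shows "T \<tau> s \<beta> (sol \<tau> s \<beta>) \<sigma> = sol \<tau> s \<beta> \<sigma>"
proof -
  have "norm (T \<tau> s \<beta> (sol \<tau> s \<beta>) \<sigma> - iter \<tau> s \<beta> (Suc n) \<sigma>) \<le> 2 * \<rho> * (1 / 2) ^ n / 2" for n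
    unfolding iter.simps by (rule T_contraction[OF \<tau> s sol_admissible iter_admissible assms sol_iter])
  then have b: "norm (norm (T \<tau> s \<beta> (sol \<tau> s \<beta>) \<sigma> - iter \<tau> s \<beta> (Suc n) \<sigma>)) \<le> 2 * \<rho> * (1 / 2) ^ n / 2" for n
    unfolding real_norm_def abs_norm_cancel .
  have "(\<lambda>n. 2 * \<rho> * (1 / 2) ^ n / 2) \<longlonglongrightarrow> 0" by real_asymp
  then have "(\<lambda>n. norm (T \<tau> s \<beta> (sol \<tau> s \<beta>) \<sigma> - iter \<tau> s \<beta> (Suc n) \<sigma>)) \<longlonglongrightarrow> 0"
    by (rule Lim_null_comparison[OF always_eventually[OF allI[OF b]]])
  moreover have "(\<lambda>n. norm (T \<tau> s \<beta> (sol \<tau> s \<beta>) \<sigma> - iter \<tau> s \<beta> (Suc n) \<sigma>)) \<longlonglongrightarrow> norm (T \<tau> s \<beta> (sol \<tau> s \<beta>) \<sigma> - sol \<tau> s \<beta> \<sigma>)"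
    by (intro tendsto_intros LIMSEQ_Suc iter_tendsto_sol[OF assms])
  ultimately have "norm (T \<tau> s \<beta> (sol \<tau> s \<beta>) \<sigma> - sol \<tau> s \<beta> \<sigma>) = 0" by (rule LIMSEQ_unique[rotated])
  then show ?thesis by simp
qed

lemma sol_bound: "\<sigma> \<in> {0..1} \<Longrightarrow> norm (sol \<tau> s \<beta> \<sigma>) \<le> norm \<beta> + \<rho> / 4"
  using T_bound[OF \<tau> s sol_admissible, of \<sigma> \<beta>] sol_fixed by simp

lemma sol_at_1: "sol \<tau> s \<beta> 1 = \<beta>"
  using sol_fixed[of 1] by (simp add: T_def)

text \<open>In the split form the outer exponential contributes the linear term and the lower limit
  of the integral contributes \<open>R\<close>, the two exponentials cancelling at r =
  \<sigma>.\<close>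

lemma sol_deriv:
  assumes \<sigma>: "\<sigma> \<in> {0..1}"
  shows "(sol \<tau> s \<beta> has_vector_derivative
      s * of_real (real p * \<sigma> ^ (p - 1)) * sol \<tau> s \<beta> \<sigma> + \<tau> * R (\<tau> * of_real \<sigma>) (sol \<tau> s \<beta> \<sigma>) (\<tau> ^ p / s))
    (at \<sigma> within {0..1})"
proof -
  define g where "g = integrand \<tau> s (sol \<tau> s \<beta>) 0"
  define E where "E = (\<lambda>\<sigma>::real. exp (of_real (\<sigma> ^ p) * s))"
  define I where "I = (\<lambda>\<sigma>. integral {\<sigma>..1} g)"
  have fact: "sol \<tau> s \<beta> x = E x * (\<beta> * exp (- s) - \<tau> * I x)" if "x \<in> {0..1}" for x
    using T_factor[OF \<tau> s sol_admissible that] sol_fixed[OF that] by (simp add: E_def I_def g_def)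
  have I': "(I has_vector_derivative - g \<sigma>) (at \<sigma> within {0..1})"
    unfolding I_def g_def
    by (rule integral_has_vector_derivative'[OF integrand_continuous[OF \<tau> s sol_admissible] \<sigma>])
  have "((\<lambda>x. of_real (x ^ p) * s) has_vector_derivative of_real (real p * \<sigma> ^ (p - 1)) * s) (at \<sigma> within {0..1})"
    by (rule derivative_eq_intros has_vector_derivative_real_field refl | simp)+
  then have "(exp \<circ> (\<lambda>x. of_real (x ^ p) * s) has_vector_derivative
      (of_real (real p * \<sigma> ^ (p - 1)) * s) * exp (of_real (\<sigma> ^ p) * s)) (at \<sigma> within {0..1})"
    by (rule field_vector_diff_chain_within) (auto intro!: derivative_eq_intros)
  then have E': "(E has_vector_derivative (of_real (real p * \<sigma> ^ (p - 1)) * s) * E \<sigma>) (at \<sigma> within {0..1})"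
    by (simp add: E_def o_def)
  have "((\<lambda>x. \<beta> * exp (- s) - \<tau> * I x) has_vector_derivative \<tau> * g \<sigma>) (at \<sigma> within {0..1})"
    using has_vector_derivative_diff[OF has_vector_derivative_const has_vector_derivative_mult_right[OF I'], of "\<beta> * exp (- s)" \<tau>]
    by simp
  from has_vector_derivative_mult[OF E' this]
  have "((\<lambda>x. E x * (\<beta> * exp (- s) - \<tau> * I x)) has_vector_derivative
      E \<sigma> * (\<tau> * g \<sigma>) + of_real (real p * \<sigma> ^ (p - 1)) * s * E \<sigma> * (\<beta> * exp (- s) - \<tau> * I \<sigma>)) (at \<sigma> within {0..1})" .
  moreover have "E \<sigma> * (\<tau> * g \<sigma>) = \<tau> * R (\<tau> * of_real \<sigma>) (sol \<tau> s \<beta> \<sigma>) (\<tau> ^ p / s)"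
    using p2 by (simp add: E_def g_def integrand_def power_0_left exp_minus)
  moreover have "of_real (real p * \<sigma> ^ (p - 1)) * s * E \<sigma> * (\<beta> * exp (- s) - \<tau> * I \<sigma>)
      = s * of_real (real p * \<sigma> ^ (p - 1)) * sol \<tau> s \<beta> \<sigma>"
    using fact[OF \<sigma>] by simp
  ultimately have "((\<lambda>x. E x * (\<beta> * exp (- s) - \<tau> * I x)) has_vector_derivative
      s * of_real (real p * \<sigma> ^ (p - 1)) * sol \<tau> s \<beta> \<sigma> + \<tau> * R (\<tau> * of_real \<sigma>) (sol \<tau> s \<beta> \<sigma>) (\<tau> ^ p / s)) (at \<sigma> within {0..1})"
    by (simp only: add.commute)
  then show ?thesis
    by (rule has_vector_derivative_transform[rotated 2]) (use \<sigma> fact in auto)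
qed

lemma sol_real:
  assumes "\<tau> \<in> \<real>" "s \<in> \<real>" "\<beta> \<in> \<real>" "\<sigma> \<in> {0..1}"
  shows "sol \<tau> s \<beta> \<sigma> \<in> \<real>"
proof -
  have "iter \<tau> s \<beta> n x \<in> \<real>" if "x \<in> {0..1}" for n x
    using that
  proof (induction n arbitrary: x)
    case (Suc n)
    have exp_real: "exp (of_real y * s) \<in> \<real>" for y
    proof -
      obtain x where "s = of_real x" using assms(2) by (auto elim: Reals_cases)
      then have "exp (of_real y * s) = of_real (exp (y * x))" by (simp flip: exp_of_real)
      then show ?thesis by simp
    qed
    have "integrand \<tau> s (iter \<tau> s \<beta> n) x r \<in> \<real>" if r: "r \<in> {x..1}" for r
    proof -
      have r': "r \<in> {0..1}" using r Suc.prems by auto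
      have "R (\<tau> * of_real r) (iter \<tau> s \<beta> n r) (\<tau> ^ p / s) \<in> \<real>"
        by (rule R_real[OF strip_scale[OF \<tau> r'] _ eps_small[OF \<tau> s]])
          (use iter_admissible r' Suc.IH assms in \<open>auto simp: admissible_def intro!: Reals_mult Reals_divide Reals_power\<close>)
      then show ?thesis unfolding integrand_def by (intro Reals_mult exp_real)
    qed
    then have "integral {x..1} (Im \<circ> integrand \<tau> s (iter \<tau> s \<beta> n) x) = integral {x..1} (\<lambda>_. 0)"
      by (intro Henstock_Kurzweil_Integration.integral_cong) (simp add: complex_is_Real_iff)
    then have "integral {x..1} (integrand \<tau> s (iter \<tau> s \<beta> n) x) \<in> \<real>"
      using integral_linear[OF integrand_integrable[OF \<tau> s iter_admissible Suc.prems] bounded_linear_Im]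
      by (simp add: complex_is_Real_iff)
    then show ?case unfolding iter.simps T_def
      by (intro Reals_diff Reals_mult assms exp_real)
  qed simp
  then show ?thesis
    using closed_sequentially[OF closed_complex_Reals _ iter_tendsto_sol[OF assms(4)]] assms(4) by blast
qed

end

text \<open>Each iterate is an integral of holomorphic functions with constant majorant
  \<open>K\<close>, and the iterates converge at the rate 2 \<rho> / 2^n for all parameters alike.
  With both parameters as functions of one variable, a single statement covers \<tau>, -\<tau> and
  s.\<close>

lemma sol_holomorphic:
  assumes Z: "open Z" and t: "t holomorphic_on Z" "\<And>\<zeta>. \<zeta> \<in> Z \<Longrightarrow> t \<zeta> \<in> D"
    and s: "s holomorphic_on Z" "\<And>\<zeta>. \<zeta> \<in> Z \<Longrightarrow> c \<le> Re (s \<zeta>)" and \<beta>: "norm \<beta> \<le> \<rho> / 2" and \<sigma>: "\<sigma> \<in> {0..1}"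
  shows "(\<lambda>\<zeta>. sol (t \<zeta>) (s \<zeta>) \<beta> \<sigma>) holomorphic_on Z"
proof -
  have s0: "s \<zeta> \<noteq> 0" if "\<zeta> \<in> Z" for \<zeta> using s(2)[OF that] pos by auto
  have adm: "admissible (iter (t \<zeta>) (s \<zeta>) \<beta> n)" if "\<zeta> \<in> Z" for \<zeta> n
    using iter_admissible t(2) s(2) \<beta> that by blast
  have iter_hol: "(\<lambda>\<zeta>. iter (t \<zeta>) (s \<zeta>) \<beta> n x) holomorphic_on Z" if "x \<in> {0..1}" for n x
    using that
  proof (induction n arbitrary: x)
    case (Suc n)
    let ?y = "\<lambda>\<zeta>. iter (t \<zeta>) (s \<zeta>) \<beta> n"
    let ?f = "\<lambda>\<zeta>. integrand (t \<zeta>) (s \<zeta>) (?y \<zeta>) x"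
    define M where "M = lebesgue_on {x..1}"
    have sets: "{x..1} \<in> sets lebesgue" by simp
    have fin: "finite_measure M" unfolding M_def by (rule finite_measure_lebesgue_on) simp
    have intK: "integrable M (\<lambda>_. K)" using fin by (simp add: finite_measure.integrable_const)
    have xsub: "r \<in> {0..1}" if "r \<in> {x..1}" for r using that Suc.prems by auto
    have meas: "?f \<zeta> \<in> borel_measurable M" if "\<zeta> \<in> Z" for \<zeta>
      unfolding M_def
      by (rule continuous_imp_measurable_on_sets_lebesgue[OF continuous_on_subset[OF integrand_continuous] sets])
        (use that t s adm xsub in auto)
    have bnd: "norm (?f \<zeta> r) \<le> K" if "\<zeta> \<in> Z" "r \<in> space M" for \<zeta> r
    proof -
      have r: "r \<in> {x..1}" using that by (simp add: M_def)
      have "x ^ p \<le> r ^ p" using r Suc.prems by (intro power_mono) auto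
      then have "(x ^ p - r ^ p) * Re (s \<zeta>) \<le> 0"
        using s(2)[OF that(1)] pos by (intro mult_nonpos_nonneg) auto
      then have 1: "norm (exp (of_real (x ^ p - r ^ p) * s \<zeta>)) \<le> 1" by simp
      have "norm (R (t \<zeta> * of_real r) (?y \<zeta> r) (t \<zeta> ^ p / s \<zeta>)) \<le> K"
        by (rule R_bound[OF strip_scale _ eps_small])
          (use t s that xsub[OF r] adm[OF that(1)] in \<open>auto simp: admissible_def\<close>)
      then show ?thesis unfolding integrand_def norm_mult using mult_mono[OF 1] by fastforce
    qed
    have "(\<lambda>\<zeta>. \<integral>r. ?f \<zeta> r \<partial>M) holomorphic_on Z"
    proof (rule holomorphic_on_integral[OF Z _ meas intK bnd])
      fix r assume "r \<in> space M"
      then have r: "r \<in> {0..1}" using xsub by (simp add: M_def)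
      show "(\<lambda>\<zeta>. ?f \<zeta> r) holomorphic_on Z"
        unfolding integrand_def
        by (intro holomorphic_intros s(1) R_hol[OF Z] t(1) Suc.IH[OF r] s0)
          (use t s r adm strip_scale eps_small in \<open>auto simp: admissible_def\<close>)
    qed
    moreover have "(\<integral>r. ?f \<zeta> r \<partial>M) = integral {x..1} (?f \<zeta>)" if "\<zeta> \<in> Z" for \<zeta>
      unfolding M_def
    proof (rule lebesgue_integral_eq_integral[OF _ sets])
      show "integrable (lebesgue_on {x..1}) (?f \<zeta>)"
        using Bochner_Integration.integrable_bound[OF intK meas[OF that]] bnd[OF that]
        unfolding M_def by fastforce
    qed
    ultimately have "(\<lambda>\<zeta>. integral {x..1} (?f \<zeta>)) holomorphic_on Z"
      by (simp cong: holomorphic_cong)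
    then show ?case unfolding iter.simps T_def by (intro holomorphic_intros s(1) t(1))
  qed simp
  show ?thesis
  proof (rule holomorphic_uniform_sequence[OF Z iter_hol[OF \<sigma>]])
    fix \<zeta> assume "\<zeta> \<in> Z"
    then obtain d where d: "d > 0" "cball \<zeta> d \<subseteq> Z" using Z open_contains_cball by blast
    have "uniform_limit (cball \<zeta> d) (\<lambda>n \<zeta>. iter (t \<zeta>) (s \<zeta>) \<beta> n \<sigma>) (\<lambda>\<zeta>. sol (t \<zeta>) (s \<zeta>) \<beta> \<sigma>) sequentially"
    proof (rule uniform_limitI)
      fix e :: real assume "e > 0"
      have "(\<lambda>n. 2 * \<rho> * (1 / 2) ^ n) \<longlonglongrightarrow> 0" by real_asymp
      then have "\<forall>\<^sub>F n in sequentially. 2 * \<rho> * (1 / 2) ^ n < e" using \<open>e > 0\<close> by (rule order_tendstoD)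
      then show "\<forall>\<^sub>F n in sequentially. \<forall>x\<in>cball \<zeta> d. dist (iter (t x) (s x) \<beta> n \<sigma>) (sol (t x) (s x) \<beta> \<sigma>) < e"
      proof eventually_elim
        case (elim n)
        show ?case
        proof
          fix x assume "x \<in> cball \<zeta> d"
          then have "x \<in> Z" using d by auto
          then have "norm (sol (t x) (s x) \<beta> \<sigma> - iter (t x) (s x) \<beta> n \<sigma>) \<le> 2 * \<rho> * (1 / 2) ^ n"
            by (intro sol_iter t s \<beta> \<sigma>)
          then show "dist (iter (t x) (s x) \<beta> n \<sigma>) (sol (t x) (s x) \<beta> \<sigma>) < e"
            using elim by (simp add: dist_norm norm_minus_commute)
        qed
      qed
    qed
    then show "\<exists>d>0. cball \<zeta> d \<subseteq> Z \<and> uniform_limit (cball \<zeta> d) (\<lambda>n \<zeta>. iter (t \<zeta>) (s \<zeta>) \<beta> n \<sigma>) (\<lambda>\<zeta>. sol (t \<zeta>) (s \<zeta>) \<beta> \<sigma>) sequentially"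
      using d by blast
  qed
qed

end

section \<open>Real solutions in normal form\<close>

lemma nonvanishing_same_sign:
  fixes g :: "real \<Rightarrow> real"
  assumes cont: "continuous_on (closed_segment u v) g"
    and nz: "\<And>z. z \<in> closed_segment u v \<Longrightarrow> g z \<noteq> 0" and pos: "g u > 0"
  shows "g v > 0"
proof (rule ccontr)
  assume "\<not> g v > 0"
  moreover have "connected (g ` closed_segment u v)"
    by (rule connected_continuous_image[OF cont]) simp
  ultimately have "0 \<in> g ` closed_segment u v"
    using pos connected_contains_Icc[of "g ` closed_segment u v" "g v" "g u"] by force
  then show False using nz by force
qed

context normal_form
begin

definition slow_solution :: "real \<Rightarrow> real set \<Rightarrow> (real \<Rightarrow> complex) \<Rightarrow> bool"
  where "slow_solution \<epsilon> I v \<longleftrightarrow> (\<forall>z\<in>I. norm (v z) \<le> \<rho> \<and>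
    (v has_vector_derivative of_real (real p * z ^ (p - 1) / \<epsilon>) * v z + R (of_real z) (v z) (of_real \<epsilon>))
      (at z within I))"

lemma slow_solution_subset: "slow_solution \<epsilon> I v \<Longrightarrow> J \<subseteq> I \<Longrightarrow> slow_solution \<epsilon> J v"
  unfolding slow_solution_def by (meson has_vector_derivative_within_subset subsetD)

text \<open>Gronwall with the weight z^p / \<epsilon>, for u and w in either order. If u is closer
  to 0 than w, the factor is exponentially small, so solutions bunch together towards 0; in the
  opposite case it limits how fast they separate.\<close>

lemma slow_solution_compare:
  assumes v: "slow_solution \<epsilon> (closed_segment u w) v1" "slow_solution \<epsilon> (closed_segment u w) v2"
    and D: "of_real u \<in> D" "of_real w \<in> D" and \<epsilon>: "0 < \<epsilon>" "\<epsilon> < e0"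
  shows "norm (v1 u - v2 u) \<le> exp ((u ^ p - w ^ p) / \<epsilon> + L * \<bar>w - u\<bar>) * norm (v1 w - v2 w)"
proof -
  have aux: "norm (v1 a - v2 a) \<le> exp ((a ^ p - b ^ p) / \<epsilon> + L * (b - a)) * norm (v1 b - v2 b) \<and>
       norm (v1 b - v2 b) \<le> exp ((b ^ p - a ^ p) / \<epsilon> + L * (b - a)) * norm (v1 a - v2 a)"
    if ab: "a \<le> b" "slow_solution \<epsilon> {a..b} v1" "slow_solution \<epsilon> {a..b} v2" "of_real a \<in> D" "of_real b \<in> D" for a b
  proof -
    define v' where "v' = (\<lambda>v z. of_real (real p * z ^ (p - 1) / \<epsilon>) * v z + R (of_real z) (v z) (of_real \<epsilon>))"
    have 1: "((\<lambda>z. v1 z - v2 z) has_vector_derivative v' v1 z - v' v2 z) (at z within {a..b})" if "z \<in> {a..b}" for z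
      using ab(2,3) that unfolding slow_solution_def v'_def by (intro has_vector_derivative_diff) blast+
    have 2: "((\<lambda>z. z ^ p / \<epsilon>) has_real_derivative real p * z ^ (p - 1) / \<epsilon>) (at z within {a..b})" for z
      using \<epsilon>(1) by (auto intro!: derivative_eq_intros)
    have 3: "norm (v' v1 z - v' v2 z - of_real (real p * z ^ (p - 1) / \<epsilon>) * (v1 z - v2 z)) \<le> L * norm (v1 z - v2 z)"
      if z: "z \<in> {a..b}" for z
    proof -
      have "of_real z \<in> D" using z ab(4,5) by auto
      moreover have "norm (v1 z) \<le> \<rho>" "norm (v2 z) \<le> \<rho>" using ab(2,3) z unfolding slow_solution_def by blast+
      ultimately have "norm (R (of_real z) (v1 z) (of_real \<epsilon>) - R (of_real z) (v2 z) (of_real \<epsilon>)) \<le> L * norm (v1 z - v2 z)"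
        using \<epsilon> by (intro R_lip) auto
      moreover have "v' v1 z - v' v2 z - of_real (real p * z ^ (p - 1) / \<epsilon>) * (v1 z - v2 z)
          = R (of_real z) (v1 z) (of_real \<epsilon>) - R (of_real z) (v2 z) (of_real \<epsilon>)"
        unfolding v'_def right_diff_distrib by simp
      ultimately show ?thesis by simp
    qed
    show ?thesis
      using gronwall_two_sided[OF ab(1) 1 2 3] by (simp add: diff_divide_distrib)
  qed
  show ?thesis
  proof (cases "u \<le> w")
    case True
    then show ?thesis using aux[of u w] v D by (simp add: closed_segment_eq_real_ivl)
  next
    case False
    then show ?thesis using aux[of w u] v D by (simp add: closed_segment_eq_real_ivl)
  qed
qed

text \<open>The fixed point in the variable z = \<tau> \<sigma>, with prescribed value \<beta> at z
  = \<tau>. A negative \<tau> describes the left side; as p is even, s = \<tau>^p / \<epsilon> is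
  positive there too.\<close>

definition ray_sol :: "real \<Rightarrow> real \<Rightarrow> complex \<Rightarrow> real \<Rightarrow> complex"
  where "ray_sol \<tau> \<epsilon> \<beta> z = sol (of_real \<tau>) (of_real (\<tau> ^ p / \<epsilon>)) \<beta> (z / \<tau>)"

section \<open>Solutions on real rays\<close>

context
  fixes \<tau> \<epsilon> :: real and \<beta> :: complex
  assumes \<tau>: "of_real \<tau> \<in> D" "\<tau> \<noteq> 0" and \<epsilon>: "0 < \<epsilon>" "c \<le> \<tau> ^ p / \<epsilon>" and \<beta>: "norm \<beta> \<le> \<rho> / 2"
begin

lemma ray_in_unit: "z \<in> closed_segment 0 \<tau> \<Longrightarrow> z / \<tau> \<in> {0..1}"
  using \<tau>(2) by (auto simp: closed_segment_eq_real_ivl divide_simps split: if_splits)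

lemma Re_ray: "c \<le> Re (of_real (\<tau> ^ p / \<epsilon>))"
  using \<epsilon>(2) by (simp only: Re_complex_of_real)

lemma ray_eps: "\<epsilon> < e0"
proof -
  have "(of_real \<tau>) ^ p / (of_real (\<tau> ^ p / \<epsilon>) :: complex) = of_real \<epsilon>"
    using \<tau>(2) \<epsilon>(1) by simp
  then show ?thesis using eps_small[OF \<tau>(1) Re_ray] \<epsilon>(1) by (metis abs_of_pos norm_of_real)
qed

lemma ray_sol_bound: "z \<in> closed_segment 0 \<tau> \<Longrightarrow> norm (ray_sol \<tau> \<epsilon> \<beta> z) \<le> norm \<beta> + \<rho> / 4"
  unfolding ray_sol_def by (rule sol_bound[OF \<tau>(1) Re_ray \<beta> ray_in_unit])

lemma ray_sol_slow: "slow_solution \<epsilon> (closed_segment 0 \<tau>) (ray_sol \<tau> \<epsilon> \<beta>)"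
  unfolding slow_solution_def
proof (intro ballI conjI)
  fix z assume z: "z \<in> closed_segment 0 \<tau>"
  show "norm (ray_sol \<tau> \<epsilon> \<beta> z) \<le> \<rho>" using ray_sol_bound[OF z] \<beta> pos by simp
  let ?s = "complex_of_real (\<tau> ^ p / \<epsilon>)"
  let ?y = "sol (of_real \<tau>) ?s \<beta>"
  have e: "of_real \<tau> ^ p / ?s = of_real \<epsilon>" using \<tau>(2) \<epsilon>(1) by simp
  have t: "complex_of_real \<tau> * of_real (z / \<tau>) = of_real z" using \<tau>(2) by simp
  have "(?y has_vector_derivative ?s * of_real (real p * (z / \<tau>) ^ (p - 1)) * ?y (z / \<tau>) +
      of_real \<tau> * R (of_real z) (?y (z / \<tau>)) (of_real \<epsilon>)) (at (z / \<tau>) within {0..1})"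
    using sol_deriv[OF \<tau>(1) Re_ray \<beta> ray_in_unit[OF z]] unfolding e t .
  then have d: "(?y has_vector_derivative ?s * of_real (real p * (z / \<tau>) ^ (p - 1)) * ?y (z / \<tau>) +
      of_real \<tau> * R (of_real z) (?y (z / \<tau>)) (of_real \<epsilon>)) (at (z / \<tau>) within (\<lambda>z. z / \<tau>) ` closed_segment 0 \<tau>)"
    by (rule has_vector_derivative_within_subset) (use ray_in_unit in auto)
  have "((\<lambda>z. z / \<tau>) has_vector_derivative 1 / \<tau>) (at z within closed_segment 0 \<tau>)"
    using \<tau>(2) by (auto intro!: derivative_eq_intros simp flip: has_real_derivative_iff_has_vector_derivative)
  from vector_diff_chain_within[OF this d]
  have "(ray_sol \<tau> \<epsilon> \<beta> has_vector_derivative (1 / \<tau>) *\<^sub>R (?s * of_real (real p * (z / \<tau>) ^ (p - 1)) * ?y (z / \<tau>) +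
      of_real \<tau> * R (of_real z) (?y (z / \<tau>)) (of_real \<epsilon>))) (at z within closed_segment 0 \<tau>)"
    by (simp add: o_def ray_sol_def[abs_def])
  moreover have "(1 / \<tau>) *\<^sub>R (?s * of_real (real p * (z / \<tau>) ^ (p - 1)) * ?y (z / \<tau>) +
      of_real \<tau> * R (of_real z) (?y (z / \<tau>)) (of_real \<epsilon>))
     = of_real (real p * z ^ (p - 1) / \<epsilon>) * ray_sol \<tau> \<epsilon> \<beta> z + R (of_real z) (ray_sol \<tau> \<epsilon> \<beta> z) (of_real \<epsilon>)"
  proof -
    have "\<tau> ^ p = \<tau> * \<tau> ^ (p - 1)" using p2 by (simp flip: power_Suc)
    then have "1 / \<tau> * (\<tau> ^ p / \<epsilon> * (real p * (z / \<tau>) ^ (p - 1))) = real p * z ^ (p - 1) / \<epsilon>"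
      using \<tau>(2) by (simp add: power_divide)
    then have "complex_of_real (1 / \<tau> * (\<tau> ^ p / \<epsilon> * (real p * (z / \<tau>) ^ (p - 1)))) = of_real (real p * z ^ (p - 1) / \<epsilon>)"
      by (rule arg_cong)
    then have 1: "complex_of_real (1 / \<tau>) * (?s * of_real (real p * (z / \<tau>) ^ (p - 1))) = of_real (real p * z ^ (p - 1) / \<epsilon>)"
      by (simp only: of_real_mult)
    have 2: "complex_of_real (1 / \<tau>) * of_real \<tau> = 1" using \<tau>(2) by simp
    have "complex_of_real (1 / \<tau>) * (X * Y + of_real \<tau> * Z) = (complex_of_real (1 / \<tau>) * X) * Y + (complex_of_real (1 / \<tau>) * of_real \<tau>) * Z" for X Y Z
      by (simp only: distrib_left mult.assoc)
    then show ?thesis unfolding scaleR_conv_of_real ray_sol_def by (simp only: 1 2 mult_1)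
  qed
  ultimately show "(ray_sol \<tau> \<epsilon> \<beta> has_vector_derivative of_real (real p * z ^ (p - 1) / \<epsilon>) * ray_sol \<tau> \<epsilon> \<beta> z +
      R (of_real z) (ray_sol \<tau> \<epsilon> \<beta> z) (of_real \<epsilon>)) (at z within closed_segment 0 \<tau>)"
    by simp
qed

lemma ray_sol_end: "ray_sol \<tau> \<epsilon> \<beta> \<tau> = \<beta>"
  using sol_at_1[OF \<tau>(1) Re_ray \<beta>] \<tau>(2) by (simp add: ray_sol_def)

lemma ray_sol_real: "\<beta> \<in> \<real> \<Longrightarrow> z \<in> closed_segment 0 \<tau> \<Longrightarrow> ray_sol \<tau> \<epsilon> \<beta> z \<in> \<real>"
  unfolding ray_sol_def by (rule sol_real[OF \<tau>(1) Re_ray \<beta> _ _ _ ray_in_unit]) auto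

text \<open>The difference is at most 2 \<rho> at the far end and is damped on the way to 0. This is
  the gap exp(-s) that is intrinsic to the parameters (\<tau>, s).\<close>

lemma ray_sol_compare:
  assumes "slow_solution \<epsilon> (closed_segment 0 \<tau>) v"
  shows "norm (ray_sol \<tau> \<epsilon> \<beta> 0 - v 0) \<le> exp (- (\<tau> ^ p / \<epsilon>)) * (exp (L * \<bar>\<tau>\<bar>) * (2 * \<rho>))"
proof -
  have "norm (ray_sol \<tau> \<epsilon> \<beta> 0 - v 0)
      \<le> exp ((0 ^ p - \<tau> ^ p) / \<epsilon> + L * \<bar>\<tau> - 0\<bar>) * norm (ray_sol \<tau> \<epsilon> \<beta> \<tau> - v \<tau>)"
    by (rule slow_solution_compare[OF ray_sol_slow assms])
      (use pos \<tau> \<epsilon> ray_eps in \<open>auto simp: strip_def\<close>)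
  also have "norm (ray_sol \<tau> \<epsilon> \<beta> \<tau> - v \<tau>) \<le> 2 * \<rho>"
    using norm_triangle_ineq4[of "ray_sol \<tau> \<epsilon> \<beta> \<tau>" "v \<tau>"] ray_sol_slow assms
    unfolding slow_solution_def by (smt (verit) ends_in_segment(2))
  also have "exp ((0 ^ p - \<tau> ^ p) / \<epsilon> + L * \<bar>\<tau> - 0\<bar>) = exp (- (\<tau> ^ p / \<epsilon>)) * exp (L * \<bar>\<tau>\<bar>)"
    using p2 by (simp add: power_0_left flip: exp_add)
  finally show ?thesis by (simp add: mult.assoc)
qed

end


text \<open>At 0 both one-sided derivatives are prescribed by the same equation, so agreement of the
  values forces agreement of the derivatives.\<close>

lemma slow_solution_glue:
  assumes v1: "slow_solution \<epsilon> {0..b} v1" and v2: "slow_solution \<epsilon> {a..0} v2" and "v1 0 = v2 0"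
    and ab: "a < 0" "0 < b"
  shows "slow_solution \<epsilon> {a..b} (\<lambda>z. if z \<le> 0 then v2 z else v1 z)" (is "slow_solution _ _ ?v")
  unfolding slow_solution_def
proof (intro ballI conjI)
  fix z assume z: "z \<in> {a..b}"
  show "norm (?v z) \<le> \<rho>" using v1 v2 z by (auto simp: slow_solution_def)
  define F where "F = of_real (real p * z ^ (p - 1) / \<epsilon>) * ?v z + R (of_real z) (?v z) (of_real \<epsilon>)"
  have d1: "(?v has_vector_derivative F) (at z within {0..b})" if "z \<ge> 0"
  proof -
    have eq: "?v z = v1 z" using that \<open>v1 0 = v2 0\<close> by auto
    have "z \<in> {0..b}" using that z by simp
    then have "(v1 has_vector_derivative F) (at z within {0..b})"
      using v1 unfolding slow_solution_def F_def eq by blast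
    then show ?thesis
      by (rule has_vector_derivative_transform[rotated 2]) (use that z \<open>v1 0 = v2 0\<close> in auto)
  qed
  have d2: "(?v has_vector_derivative F) (at z within {a..0})" if "z \<le> 0"
  proof -
    have "(v2 has_vector_derivative F) (at z within {a..0})"
      using v2 that z by (auto simp: slow_solution_def F_def)
    then show ?thesis
      by (rule has_vector_derivative_transform[rotated 2]) (use that z in auto)
  qed
  consider "z < 0" | "z = 0" | "z > 0" by linarith
  then have "(?v has_vector_derivative F) (at z within {a..b})"
  proof cases
    case 1
    have "at z within {a..0} = at z within {a..b}"
      by (rule at_within_nhd[of z "{..<0}"]) (use 1 ab in auto)
    then show ?thesis using d2 1 by simp
  next
    case 3
    have "at z within {0..b} = at z within {a..b}"
      by (rule at_within_nhd[of z "{0<..}"]) (use 3 ab in auto)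
    then show ?thesis using d1 3 by simp
  next
    case 2
    have "{a..0} \<union> {0..b} = {a..b}" using ab by auto
    then show ?thesis
      using d1 d2 2 Lim_Un[of _ _ z "{a..0}" "{0..b}"]
      unfolding has_vector_derivative_def has_derivative_within by fastforce
  qed
  then show "(?v has_vector_derivative of_real (real p * z ^ (p - 1) / \<epsilon>) * ?v z + R (of_real z) (?v z) (of_real \<epsilon>))
      (at z within {a..b})"
    unfolding F_def .
qed

text \<open>For \<tau>^p < \<alpha> the given rate exp(-\<alpha>/\<epsilon>) is at least as good as
  the intrinsic gap exp(-s), and the ray solutions for \<tau> and -\<tau> are compared through
  \<open>v1\<close> and \<open>v2\<close>. The second restriction on \<tau> puts \<epsilon> =
  \<tau>^p / s below \<epsilon>1 for every s \<ge> c, not only for large s.\<close>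

lemma differences_flat_near_0:
  assumes \<tau>1: "0 < \<tau>1" "\<tau>1 < A" "\<tau>1 < B" and \<alpha>: "0 < \<alpha>" "0 < \<epsilon>1"
    and H: "\<And>\<epsilon>. 0 < \<epsilon> \<Longrightarrow> \<epsilon> < \<epsilon>1 \<Longrightarrow> \<exists>v1 v2. slow_solution \<epsilon> {0..\<tau>1} v1 \<and> slow_solution \<epsilon> {- \<tau>1..0} v2 \<and>
        norm (v1 0 - v2 0) \<le> C * exp (- \<alpha> / \<epsilon>)"
  obtains \<tau>2 where "0 < \<tau>2" "\<And>\<tau>. 0 < \<tau> \<Longrightarrow> \<tau> < \<tau>2 \<Longrightarrow>
    \<exists>M. \<forall>s\<ge>c. norm (sol (of_real \<tau>) (of_real s) 0 0 - sol (- of_real \<tau>) (of_real s) 0 0) \<le> M * exp (- s)"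
proof -
  have "((\<lambda>x::real. x ^ p) \<longlongrightarrow> 0 ^ p) (at_right 0)" by (intro tendsto_intros)
  then have lim: "((\<lambda>x::real. x ^ p) \<longlongrightarrow> 0) (at_right 0)" using p2 by (simp add: power_0_left)
  have "\<forall>\<^sub>F x in at_right 0. x ^ p < \<alpha>" by (rule order_tendstoD(2)[OF lim \<alpha>(1)])
  moreover have "\<forall>\<^sub>F x in at_right 0. x ^ p < c * \<epsilon>1"
    by (rule order_tendstoD(2)[OF lim]) (use pos \<alpha> in simp)
  ultimately have "\<forall>\<^sub>F x in at_right 0. x ^ p < \<alpha> \<and> x ^ p < c * \<epsilon>1" by eventually_elim simp
  then obtain d where d: "d > 0" "\<And>x. 0 < x \<Longrightarrow> x < d \<Longrightarrow> x ^ p < \<alpha> \<and> x ^ p < c * \<epsilon>1"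
    by (auto simp: eventually_at_right_field)
  show ?thesis
  proof (rule that[of "min d \<tau>1"])
    show "0 < min d \<tau>1" using d \<tau>1 by simp
    fix \<tau> :: real assume \<tau>: "0 < \<tau>" "\<tau> < min d \<tau>1"
    define M where "M = 2 * (exp (L * \<tau>) * (2 * \<rho>)) + \<bar>C\<bar>"
    have "norm (sol (of_real \<tau>) (of_real s) 0 0 - sol (- of_real \<tau>) (of_real s) 0 0) \<le> M * exp (- s)" if s: "s \<ge> c" for s
    proof -
      have s0: "s > 0" using s pos by simp
      define \<epsilon> where "\<epsilon> = \<tau> ^ p / s"
      have "\<tau> ^ p > 0" using \<tau> by simp
      have \<epsilon>: "\<epsilon> > 0" "\<tau> ^ p / \<epsilon> = s" using \<tau> s0 by (auto simp: \<epsilon>_def)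
      have tp: "\<tau> ^ p < \<alpha>" "\<tau> ^ p < c * \<epsilon>1" using d(2) \<tau> by auto
      have "c * \<epsilon>1 \<le> s * \<epsilon>1" using s \<alpha> by simp
      then have "\<epsilon> < \<epsilon>1" using tp s0 by (simp add: \<epsilon>_def divide_less_eq mult.commute)
      then obtain v1 v2 where v: "slow_solution \<epsilon> {0..\<tau>1} v1" "slow_solution \<epsilon> {- \<tau>1..0} v2"
        "norm (v1 0 - v2 0) \<le> C * exp (- \<alpha> / \<epsilon>)" using H[OF \<epsilon>(1)] by blast
      have r0: "ray_sol \<tau> \<epsilon> 0 0 = sol (of_real \<tau>) (of_real s) 0 0"
        "ray_sol (- \<tau>) \<epsilon> 0 0 = sol (- of_real \<tau>) (of_real s) 0 0"
        using \<epsilon>(2) p_even by (simp_all add: ray_sol_def)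
      have "norm (ray_sol \<tau> \<epsilon> 0 0 - v1 0) \<le> exp (- (\<tau> ^ p / \<epsilon>)) * (exp (L * \<bar>\<tau>\<bar>) * (2 * \<rho>))"
      proof (rule ray_sol_compare)
        show "slow_solution \<epsilon> (closed_segment 0 \<tau>) v1"
          by (rule slow_solution_subset[OF v(1)]) (use \<tau> in \<open>auto simp: closed_segment_eq_real_ivl\<close>)
      qed (use \<tau> \<tau>1 \<epsilon> s pos in auto)
      then have 1: "norm (ray_sol \<tau> \<epsilon> 0 0 - v1 0) \<le> exp (- s) * (exp (L * \<tau>) * (2 * \<rho>))" using \<epsilon> \<tau> by simp
      have "norm (ray_sol (- \<tau>) \<epsilon> 0 0 - v2 0) \<le> exp (- ((- \<tau>) ^ p / \<epsilon>)) * (exp (L * \<bar>- \<tau>\<bar>) * (2 * \<rho>))"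
      proof (rule ray_sol_compare)
        show "slow_solution \<epsilon> (closed_segment 0 (- \<tau>)) v2"
          by (rule slow_solution_subset[OF v(2)]) (use \<tau> in \<open>auto simp: closed_segment_eq_real_ivl\<close>)
        show "c \<le> (- \<tau>) ^ p / \<epsilon>" using \<epsilon> s p_even by simp
        show "complex_of_real (- \<tau>) \<in> D" using \<tau> \<tau>1 pos by (simp only: of_real_in_strip) auto
      qed (use \<tau> \<epsilon> pos in auto)
      then have 2: "norm (ray_sol (- \<tau>) \<epsilon> 0 0 - v2 0) \<le> exp (- s) * (exp (L * \<tau>) * (2 * \<rho>))"
        using \<epsilon> \<tau> p_even by simp
      have "s * \<epsilon> = \<tau> ^ p" using s0 by (simp add: \<epsilon>_def)
      then have "s \<le> \<alpha> / \<epsilon>" using tp \<epsilon>(1) by (simp add: pos_le_divide_eq)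
      then have "exp (- \<alpha> / \<epsilon>) \<le> exp (- s)" by simp
      then have "C * exp (- \<alpha> / \<epsilon>) \<le> \<bar>C\<bar> * exp (- s)" by (intro mult_mono) auto
      then have 3: "norm (v1 0 - v2 0) \<le> \<bar>C\<bar> * exp (- s)" using v(3) by linarith
      have "norm (ray_sol \<tau> \<epsilon> 0 0 - ray_sol (- \<tau>) \<epsilon> 0 0)
          \<le> norm (ray_sol \<tau> \<epsilon> 0 0 - v1 0) + norm (v1 0 - v2 0) + norm (ray_sol (- \<tau>) \<epsilon> 0 0 - v2 0)"
        using norm_triangle_ineq[of "ray_sol \<tau> \<epsilon> 0 0 - v1 0" "v1 0 - v2 0"]
          norm_triangle_ineq4[of "ray_sol \<tau> \<epsilon> 0 0 - v2 0" "ray_sol (- \<tau>) \<epsilon> 0 0 - v2 0"] by simp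
      also have "\<dots> \<le> M * exp (- s)" using 1 2 3 by (simp add: M_def algebra_simps)
      finally show ?thesis unfolding r0 .
    qed
    then show "\<exists>M. \<forall>s\<ge>c. norm (sol (of_real \<tau>) (of_real s) 0 0 - sol (- of_real \<tau>) (of_real s) 0 0) \<le> M * exp (- s)"
      by blast
  qed
qed

text \<open>The step from small \<tau> to all \<tau> for which both rays lie in the strip:
  \<open>exponential_smallness_extends\<close> for the difference multiplied by exp(s). The
  contraction bounds supply its growth hypothesis for complex \<tau> and s.\<close>

lemma differences_flat:
  assumes \<tau>2: "0 < \<tau>2" "\<And>\<tau>. 0 < \<tau> \<Longrightarrow> \<tau> < \<tau>2 \<Longrightarrow>
    \<exists>M. \<forall>s\<ge>c. norm (sol (of_real \<tau>) (of_real s) 0 0 - sol (- of_real \<tau>) (of_real s) 0 0) \<le> M * exp (- s)"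
    and \<tau>: "of_real \<tau> \<in> D" "- of_real \<tau> \<in> D" and s: "2 * (c + 1) \<le> s"
  shows "norm (sol (of_real \<tau>) (of_real s) 0 0 - sol (- of_real \<tau>) (of_real s) 0 0)
    \<le> 2 * \<rho> * exp (c + 1) * s / (2 * (c + 1)) * exp (- s)"
proof -
  \<comment> \<open>\<open>E\<close> is the part of the strip that is symmetric about 0, so that it
    contains -t along with t.\<close>
  define n where "n = min A B"
  define E where "E = strip n n h"
  have n: "n > 0" "n \<le> A" "n \<le> B" using pos by (auto simp: n_def)
  have E: "E \<subseteq> D" unfolding E_def by (rule strip_mono) (use n in auto)
  have E': "- z \<in> E" if "z \<in> E" for z using that by (simp add: E_def minus_in_strip)
  have E_conv: "open E" "connected E"
  proof -
    have "E = D \<inter> uminus ` D"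
    proof safe
      fix z assume "z \<in> E"
      then show "z \<in> D" "z \<in> uminus ` D" using E E'[of z] by (auto intro!: image_eqI[of z uminus "-z"])
    next
      fix z assume "- z \<in> D" "z \<in> D" then show "- z \<in> E" by (auto simp: E_def strip_def n_def)
    qed
    then show "open E" "connected E"
      using open_strip convex_strip
      by (auto intro!: open_Int open_negations convex_connected convex_Int convex_negations)
  qed
  define k where "k = (\<lambda>\<tau> s. (sol \<tau> s 0 0 - sol (- \<tau>) s 0 0) * exp s)"
  define I where "I = complex_of_real ` {0<..<min \<tau>2 n}"
  have k_real: "norm (k t (of_real x)) = norm (sol t (of_real x) 0 0 - sol (- t) (of_real x) 0 0) * exp x" for t x
    by (simp add: k_def norm_mult)
  have "norm (k (of_real \<tau>) (of_real s)) \<le> 2 * \<rho> * exp (c + 1) * s / (2 * (c + 1))"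
  \<comment> \<open>The fixed points exist for Re s \<ge> c; the line of Cauchy's formula is moved
    to c + 1 so that it lies inside the open set of holomorphy.\<close>
  proof (rule exponential_smallness_extends[OF E_conv, of I 0 c "c + 1" k])
    show "I \<subseteq> E" using n pos by (auto simp: I_def E_def)
    show "0 \<in> E" using n pos by (simp add: E_def strip_def)
    show "0 islimpt I"
    proof (subst islimpt_approachable, intro allI impI)
      fix e :: real assume "e > 0"
      define x where "x = min (min \<tau>2 n) e / 2"
      have "x > 0" "x < \<tau>2" "x < n" "x < e" using \<tau>2 n \<open>e > 0\<close> by (auto simp: x_def)
      then show "\<exists>x'\<in>I. x' \<noteq> 0 \<and> dist x' 0 < e"
        by (intro bexI[of _ "of_real x"]) (auto simp: I_def)
    qed
    show "0 \<le> c" "c < c + 1" using pos by auto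
    show "k t holomorphic_on {s. c < Re s}" if t: "t \<in> E" for t
      unfolding k_def
      by (intro holomorphic_intros sol_holomorphic) (use t E E' pos in \<open>auto simp: open_halfspace_Re_gt\<close>)
    show "(\<lambda>t. k t s) holomorphic_on E" if "c < Re s" for s
      unfolding k_def
      by (intro holomorphic_intros sol_holomorphic) (use that E E' E_conv pos in auto)
    show "norm (k t s) \<le> 2 * \<rho> * exp (Re s)" if "t \<in> E" "c + 1 \<le> Re s" for t s
    proof -
      have "norm (sol t' s 0 0) \<le> \<rho>" if "t' \<in> D" for t'
        using sol_bound[OF that, of s 0 0] \<open>c + 1 \<le> Re s\<close> pos by simp
      then have "norm (sol t s 0 0 - sol (- t) s 0 0) \<le> 2 * \<rho>"
        using norm_triangle_ineq4[of "sol t s 0 0" "sol (- t) s 0 0"] that(1) E E' by (smt (verit) subsetD)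
      then show ?thesis by (simp add: k_def norm_mult mult_right_mono)
    qed
    show "\<exists>M. \<forall>x\<ge>c + 1. norm (k t (of_real x)) \<le> M" if "t \<in> I" for t
    proof -
      obtain x where "x \<in> {0<..<min \<tau>2 n}" "t = of_real x" using \<open>t \<in> I\<close> unfolding I_def by blast
      then have x: "t = of_real x" "0 < x" "x < \<tau>2" by auto
      obtain M where M: "\<And>s. s \<ge> c \<Longrightarrow> norm (sol t (of_real s) 0 0 - sol (- t) (of_real s) 0 0) \<le> M * exp (- s)"
        using \<tau>2(2)[OF x(2,3)] x(1) by blast
      have "norm (k t (of_real s)) \<le> M" if "s \<ge> c + 1" for s
      proof -
        have "norm (k t (of_real s)) \<le> M * exp (- s) * exp s"
          unfolding k_real using M that by (intro mult_right_mono) auto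
        then show ?thesis by (simp add: mult.assoc flip: exp_add)
      qed
      then show ?thesis by blast
    qed
    show "of_real \<tau> \<in> E" using \<tau> by (auto simp: E_def strip_def n_def)
  qed (use s in auto)
  then have "norm (sol (of_real \<tau>) (of_real s) 0 0 - sol (- of_real \<tau>) (of_real s) 0 0) * exp s * exp (- s)
      \<le> 2 * \<rho> * exp (c + 1) * s / (2 * (c + 1)) * exp (- s)"
    unfolding k_real by (rule mult_right_mono) simp
  then show ?thesis by (simp add: mult.assoc flip: exp_add)
qed

end

section \<open>Matching the two sides at 0\<close>

context normal_form
begin

lemma slow_solution_continuous: "slow_solution \<epsilon> I v \<Longrightarrow> continuous_on I v"
  unfolding slow_solution_def continuous_on_eq_continuous_within
  using has_vector_derivative_continuous by blast

text \<open>Gronwall's inequality bounds the distance to \<open>y\<^bsub>N\<^esub>\<close> from below, so the solutions with end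
  values \<open>\<plusminus>\<rho>/2\<close> pass the target at 0 on different sides; now use continuity in \<open>\<beta>\<close>.\<close>

lemma shooting:
  fixes es N \<epsilon> :: real and target :: complex
  assumes es: "0 < es * N" "\<bar>es\<bar> < \<bar>N\<bar>" and D: "of_real es \<in> D" "of_real N \<in> D"
    and \<epsilon>: "0 < \<epsilon>" "c \<le> es ^ p / \<epsilon>"
    and target: "target \<in> \<real>"
      "norm (target - ray_sol N \<epsilon> 0 0) < \<rho> / 4 * exp (- (es ^ p / \<epsilon>) - L * \<bar>es\<bar>)"
  obtains \<beta> where "\<beta> \<in> \<real>" "norm \<beta> \<le> \<rho> / 2" "ray_sol es \<epsilon> \<beta> 0 = target"
proof -
  have nz: "es \<noteq> 0" "N \<noteq> 0" using es by auto
  have seg: "closed_segment 0 es \<subseteq> closed_segment 0 N"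
    using es by (auto simp: closed_segment_eq_real_ivl zero_less_mult_iff split: if_splits)
  have "es ^ p \<le> N ^ p" using es(2) p_even by (metis abs_ge_zero less_imp_le power_even_abs power_mono)
  then have \<epsilon>N: "c \<le> N ^ p / \<epsilon>" using \<epsilon> by (meson divide_right_mono less_imp_le order_trans)
  have e0: "\<epsilon> < e0" by (rule ray_eps[OF D(1) nz(1) \<epsilon>, of 0]) (use pos in simp)
  define y where "y = ray_sol N \<epsilon> 0"
  have y: "slow_solution \<epsilon> (closed_segment 0 es) y"
    unfolding y_def using ray_sol_slow[OF D(2) nz(2) \<epsilon>(1) \<epsilon>N, of 0] pos by (intro slow_solution_subset[OF _ seg]) auto
  have yb: "norm (y z) \<le> \<rho> / 4" if "z \<in> closed_segment 0 es" for z
    unfolding y_def using ray_sol_bound[OF D(2) nz(2) \<epsilon>(1) \<epsilon>N, of 0 z] that seg pos by auto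
  have yr: "y z \<in> \<real>" if "z \<in> closed_segment 0 es" for z
    unfolding y_def using ray_sol_real[OF D(2) nz(2) \<epsilon>(1) \<epsilon>N, of 0 z] that seg pos by auto
  define Y where "Y = (\<lambda>b. ray_sol es \<epsilon> (of_real b))"
  have bnorm: "norm (of_real b :: complex) \<le> \<rho> / 2" if "b \<in> {-\<rho>/2..\<rho>/2}" for b using that by auto
  have Y: "slow_solution \<epsilon> (closed_segment 0 es) (Y b)" "Y b es = of_real b"
    and Yr: "z \<in> closed_segment 0 es \<Longrightarrow> Y b z \<in> \<real>"
    if "b \<in> {-\<rho>/2..\<rho>/2}" for b z
    using ray_sol_slow[OF D(1) nz(1) \<epsilon> bnorm[OF that]] ray_sol_end[OF D(1) nz(1) \<epsilon> bnorm[OF that]]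
      ray_sol_real[OF D(1) nz(1) \<epsilon> bnorm[OF that]] by (auto simp: Y_def)
  have Dz: "of_real z \<in> D" if "z \<in> closed_segment 0 es" for z
    using that D(1) pos by (auto simp: closed_segment_eq_real_ivl split: if_splits)
  have lower: "norm (v1 es - v2 es) \<le> exp (es ^ p / \<epsilon> + L * \<bar>es\<bar>) * norm (v1 z - v2 z)"
    if v: "slow_solution \<epsilon> (closed_segment 0 es) v1" "slow_solution \<epsilon> (closed_segment 0 es) v2"
      and z: "z \<in> closed_segment 0 es" for v1 v2 z
  proof -
    have sub: "closed_segment es z \<subseteq> closed_segment 0 es"
      using z by (simp add: subset_closed_segment)
    have "norm (v1 es - v2 es) \<le> exp ((es ^ p - z ^ p) / \<epsilon> + L * \<bar>z - es\<bar>) * norm (v1 z - v2 z)"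
      by (rule slow_solution_compare[OF slow_solution_subset[OF v(1) sub] slow_solution_subset[OF v(2) sub] D(1) Dz[OF z] \<epsilon>(1) e0])
    also have "\<dots> \<le> exp (es ^ p / \<epsilon> + L * \<bar>es\<bar>) * norm (v1 z - v2 z)"
    proof (rule mult_right_mono)
      have "z ^ p \<ge> 0" using p_even by (rule zero_le_even_power)
      then have "(es ^ p - z ^ p) / \<epsilon> \<le> es ^ p / \<epsilon>" using \<epsilon> by (simp add: divide_right_mono)
      moreover have "\<bar>z - es\<bar> \<le> \<bar>es\<bar>" using z by (auto simp: closed_segment_eq_real_ivl split: if_splits)
      then have "L * \<bar>z - es\<bar> \<le> L * \<bar>es\<bar>" using pos by (intro mult_left_mono)
      ultimately show "exp ((es ^ p - z ^ p) / \<epsilon> + L * \<bar>z - es\<bar>) \<le> exp (es ^ p / \<epsilon> + L * \<bar>es\<bar>)" by simp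
    qed simp
    finally show ?thesis .
  qed
  \<comment> \<open>At \<open>es\<close> the distance to \<open>y\<close> is at least \<rho>/2 -
    \<rho>/4, and on the way to 0 it shrinks at most by this exponential factor; \<open>q\<close> is
    thus the half-width of the window at 0 that the shooting reaches.\<close>
  define q where "q = \<rho> / 4 * exp (- (es ^ p / \<epsilon>) - L * \<bar>es\<bar>)"
  have ends: "\<sigma> * Re (Y (\<sigma> * \<rho> / 2) 0 - y 0) \<ge> q" if \<sigma>: "\<sigma> = 1 \<or> \<sigma> = -1" for \<sigma> :: real
  proof -
    define b where "b = \<sigma> * \<rho> / 2"
    have b: "b \<in> {-\<rho>/2..\<rho>/2}" using \<sigma> pos by (auto simp: b_def)
    define g where "g = (\<lambda>z. \<sigma> * Re (Y b z - y z))"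
    have absg: "\<bar>g z\<bar> = norm (Y b z - y z)" if "z \<in> closed_segment 0 es" for z
    proof -
      have "Y b z - y z \<in> \<real>" using Yr[OF b that] yr[OF that] by (rule Reals_diff)
      then show ?thesis using \<sigma> by (auto simp: g_def abs_mult norm_complex_def complex_is_Real_iff)
    qed
    have ges: "g es \<ge> \<rho> / 4"
    proof -
      have "\<bar>Re (y es)\<bar> \<le> \<rho> / 4" using yb[of es] abs_Re_le_cmod[of "y es"] by simp
      moreover have "g es = \<sigma> * (b - Re (y es))" using Y(2)[OF b] by (simp add: g_def)
      ultimately show ?thesis using \<sigma> by (auto simp: b_def abs_le_iff)
    qed
    have gz: "\<rho> / 4 \<le> exp (es ^ p / \<epsilon> + L * \<bar>es\<bar>) * \<bar>g z\<bar>" if z: "z \<in> closed_segment 0 es" for z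
      using lower[OF Y(1)[OF b] y z] absg[of es] absg[OF z] ges by simp
    have "g 0 > 0"
    proof (rule nonvanishing_same_sign[where g=g and u=es and v=0])
      have cY: "continuous_on (closed_segment 0 es) (Y b)" "continuous_on (closed_segment 0 es) y"
        using slow_solution_continuous Y(1)[OF b] y by blast+
      then have "continuous_on (closed_segment 0 es) g"
        unfolding g_def by (intro continuous_intros)
      then show "continuous_on (closed_segment es 0) g" by (simp add: closed_segment_commute)
      show "g z \<noteq> 0" if "z \<in> closed_segment es 0" for z
        using gz[of z] that pos by (auto simp: closed_segment_commute)
      show "g es > 0" using ges pos by simp
    qed
    then have "\<rho> / 4 \<le> exp (es ^ p / \<epsilon> + L * \<bar>es\<bar>) * g 0" using gz[of 0] by simp
    then have "\<rho> / 4 * exp (- (es ^ p / \<epsilon> + L * \<bar>es\<bar>)) \<le> exp (es ^ p / \<epsilon> + L * \<bar>es\<bar>) * g 0 * exp (- (es ^ p / \<epsilon> + L * \<bar>es\<bar>))"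
      by (rule mult_right_mono) simp
    also have "\<dots> = g 0" by (simp add: mult.commute[of _ "g 0"] mult.assoc flip: exp_add)
    finally show ?thesis by (simp add: q_def g_def b_def)
  qed
  have cont: "continuous_on {-\<rho>/2..\<rho>/2} (\<lambda>b. Re (Y b 0))"
  proof (rule continuous_on_Re, rule lipschitz_on_continuous_on)
    show "(exp (L * \<bar>es\<bar>))-lipschitz_on {-\<rho>/2..\<rho>/2} (\<lambda>b. Y b 0)"
    proof (rule lipschitz_onI)
      fix b b' assume b: "b \<in> {-\<rho>/2..\<rho>/2}" "b' \<in> {-\<rho>/2..\<rho>/2}"
      have "norm (Y b 0 - Y b' 0) \<le> exp ((0 ^ p - es ^ p) / \<epsilon> + L * \<bar>es - 0\<bar>) * norm (Y b es - Y b' es)"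
        by (rule slow_solution_compare[OF Y(1)[OF b(1)] Y(1)[OF b(2)] Dz D(1) \<epsilon>(1) e0]) simp
      also have "\<dots> \<le> exp (L * \<bar>es\<bar>) * norm (Y b es - Y b' es)"
        using p2 \<epsilon> zero_le_even_power[OF p_even, of es] by (intro mult_right_mono) (auto simp: power_0_left)
      also have "norm (Y b es - Y b' es) = \<bar>b - b'\<bar>"
        unfolding Y(2)[OF b(1)] Y(2)[OF b(2)] by (metis norm_of_real of_real_diff)
      finally show "dist (Y b 0) (Y b' 0) \<le> exp (L * \<bar>es\<bar>) * dist b b'" by (simp add: dist_norm)
    qed simp
  qed
  have tq: "\<bar>Re target - Re (y 0)\<bar> < q"
    using target(2) abs_Re_le_cmod[of "target - y 0"] by (simp add: q_def y_def)
  have "Re (Y (-\<rho>/2) 0) \<le> Re target" "Re target \<le> Re (Y (\<rho>/2) 0)"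
    using ends[of "-1"] ends[of 1] tq by (auto simp: abs_less_iff)
  then obtain b where b: "-\<rho>/2 \<le> b" "b \<le> \<rho>/2" "Re (Y b 0) = Re target"
    using IVT'[OF _ _ _ cont] pos by auto
  have "Y b 0 \<in> \<real>" using Yr[of b 0] b by simp
  then have "Y b 0 = target" using b(3) target(1) by (simp add: complex_is_Real_iff complex_eq_iff)
  then show ?thesis using that[of "of_real b"] b bnorm[of b] by (auto simp: Y_def)
qed

text \<open>\<open>es\<close> is the end to be shot from, \<open>N\<close> lies slightly beyond it,
  \<open>el\<close> lies on the other side, at least as far out as \<open>- N\<close>. The target is
  compared with the ray solution for \<open>- N\<close>, and that one with the ray solution for
  \<open>N\<close> by \<open>differences_flat\<close>. The total error is of order (1 +
  1/\<epsilon>) exp(-N^p/\<epsilon>), while the window at 0 has width of order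
  exp(-es^p/\<epsilon>). As N^p > es^p, the window wins for small \<epsilon>.\<close>

lemma match_at_0:
  fixes es N el :: real
  assumes es: "0 < es * N" "\<bar>es\<bar> < \<bar>N\<bar>" and el: "el * N < 0" "\<bar>N\<bar> \<le> \<bar>el\<bar>"
    and D: "of_real es \<in> D" "of_real N \<in> D" "of_real (- N) \<in> D" "of_real el \<in> D"
    and \<tau>2: "0 < \<tau>2" "\<And>\<tau>. 0 < \<tau> \<Longrightarrow> \<tau> < \<tau>2 \<Longrightarrow>
    \<exists>M. \<forall>s\<ge>c. norm (sol (of_real \<tau>) (of_real s) 0 0 - sol (- of_real \<tau>) (of_real s) 0 0) \<le> M * exp (- s)"
  obtains \<epsilon>2 where "0 < \<epsilon>2" "\<And>\<epsilon>. 0 < \<epsilon> \<Longrightarrow> \<epsilon> \<le> \<epsilon>2 \<Longrightarrow> c \<le> es ^ p / \<epsilon> \<and> c \<le> el ^ p / \<epsilon> \<and>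
    (\<exists>\<beta>\<in>\<real>. norm \<beta> \<le> \<rho> / 2 \<and> ray_sol es \<epsilon> \<beta> 0 = ray_sol el \<epsilon> 0 0)"
proof -
  have nz: "es \<noteq> 0" "N \<noteq> 0" "el \<noteq> 0" using es el by auto
  have pw: "0 < es ^ p" "es ^ p < N ^ p" "N ^ p \<le> el ^ p"
  proof -
    have "\<bar>es\<bar> ^ p < \<bar>N\<bar> ^ p" using es(2) p2 by (intro power_strict_mono) auto
    moreover have "\<bar>N\<bar> ^ p \<le> \<bar>el\<bar> ^ p" using el(2) by (intro power_mono) auto
    moreover have "0 < \<bar>es\<bar> ^ p" using nz by simp
    ultimately show "0 < es ^ p" "es ^ p < N ^ p" "N ^ p \<le> el ^ p" using p_even by (simp_all add: power_even_abs)
  qed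
  \<comment> \<open>With x = 1/\<epsilon>: \<open>a1\<close> comes from the comparison on the side
    of the target, \<open>a2 * x\<close> from the polynomial factor s = N^p x, \<open>a3\<close>
    from the window; \<open>g\<close> is the exponential gain.\<close>
  define a1 where "a1 = exp (L * \<bar>N\<bar>) * (2 * \<rho>)"
  define a2 where "a2 = 2 * \<rho> * exp (c + 1) / (2 * (c + 1)) * N ^ p"
  define a3 where "a3 = \<rho> / 4 * exp (- L * \<bar>es\<bar>)"
  define g where "g = N ^ p - es ^ p"
  have g: "g > 0" and a3: "a3 > 0" using pw pos by (auto simp: g_def a3_def)
  have "((\<lambda>x. (a1 + a2 * x) * exp (- g * x)) \<longlongrightarrow> 0) at_top" using g by real_asymp
  then have "\<forall>\<^sub>F x in at_top. (a1 + a2 * x) * exp (- g * x) < a3" using a3 by (rule order_tendstoD)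
  moreover have "\<forall>\<^sub>F x in at_top. x \<ge> (2 * (c + 1)) / es ^ p" by (rule eventually_ge_at_top)
  ultimately have "\<forall>\<^sub>F x in at_top. (a1 + a2 * x) * exp (- g * x) < a3 \<and> x \<ge> (2 * (c + 1)) / es ^ p \<and> x > 0"
    using eventually_gt_at_top[of 0] by eventually_elim simp
  then obtain x0 where x0: "\<And>x. x \<ge> x0 \<Longrightarrow> (a1 + a2 * x) * exp (- g * x) < a3 \<and> x \<ge> (2 * (c + 1)) / es ^ p \<and> x > 0"
    by (auto simp: eventually_at_top_linorder)
  show ?thesis
  proof (rule that[of "1 / max x0 1"])
    fix \<epsilon> :: real assume \<epsilon>: "0 < \<epsilon>" "\<epsilon> \<le> 1 / max x0 1"
    define x where "x = 1 / \<epsilon>"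
    have "x \<ge> max x0 1" using \<epsilon> by (simp add: x_def le_divide_eq mult.commute)
    then have x: "(a1 + a2 * x) * exp (- g * x) < a3" "x \<ge> (2 * (c + 1)) / es ^ p" "x > 0" using x0[of x] by auto
    have cs: "2 * (c + 1) \<le> es ^ p / \<epsilon>" using x(2) pw by (simp add: x_def field_simps)
    have cN: "2 * (c + 1) \<le> N ^ p / \<epsilon>" and cl: "2 * (c + 1) \<le> el ^ p / \<epsilon>"
      using cs pw \<epsilon>(1) by (meson divide_right_mono less_imp_le order_trans)+
    have c: "c \<le> es ^ p / \<epsilon>" "c \<le> N ^ p / \<epsilon>" "c \<le> (- N) ^ p / \<epsilon>" "c \<le> el ^ p / \<epsilon>"
      using cs cN cl pos p_even by auto
    have z: "norm (0::complex) \<le> \<rho> / 2" using pos by simp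
    define target where "target = ray_sol el \<epsilon> 0 0"
    have tr: "target \<in> \<real>" unfolding target_def
      by (rule ray_sol_real[OF D(4) nz(3) \<epsilon>(1) c(4) z]) auto
    have 1: "norm (ray_sol (- N) \<epsilon> 0 0 - target) \<le> exp (- ((- N) ^ p / \<epsilon>)) * (exp (L * \<bar>- N\<bar>) * (2 * \<rho>))"
      unfolding target_def
    proof (rule ray_sol_compare[OF D(3) _ \<epsilon>(1) c(3) z])
      show "slow_solution \<epsilon> (closed_segment 0 (- N)) (ray_sol el \<epsilon> 0)"
        by (rule slow_solution_subset[OF ray_sol_slow[OF D(4) nz(3) \<epsilon>(1) c(4) z]])
          (use el in \<open>auto simp: closed_segment_eq_real_ivl mult_less_0_iff split: if_splits\<close>)
    qed (use nz in simp)
    have r0: "ray_sol N \<epsilon> 0 0 = sol (of_real N) (of_real (N ^ p / \<epsilon>)) 0 0"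
      "ray_sol (- N) \<epsilon> 0 0 = sol (- of_real N) (of_real (N ^ p / \<epsilon>)) 0 0"
      using p_even by (simp_all add: ray_sol_def)
    have 2: "norm (ray_sol N \<epsilon> 0 0 - ray_sol (- N) \<epsilon> 0 0)
        \<le> 2 * \<rho> * exp (c + 1) * (N ^ p / \<epsilon>) / (2 * (c + 1)) * exp (- (N ^ p / \<epsilon>))"
      unfolding r0 by (rule differences_flat[OF \<tau>2 D(2)]) (use D(3) cN in auto)
    have "norm (target - ray_sol N \<epsilon> 0 0)
        \<le> norm (ray_sol (- N) \<epsilon> 0 0 - target) + norm (ray_sol N \<epsilon> 0 0 - ray_sol (- N) \<epsilon> 0 0)"
      using norm_triangle_ineq[of "ray_sol (- N) \<epsilon> 0 0 - target" "ray_sol N \<epsilon> 0 0 - ray_sol (- N) \<epsilon> 0 0"]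
      by (simp add: norm_minus_commute)
    also have "\<dots> \<le> (a1 + a2 * x) * exp (- (N ^ p * x))"
    proof -
      have "norm (ray_sol (- N) \<epsilon> 0 0 - target) \<le> a1 * exp (- (N ^ p * x))"
        using 1 p_even by (simp add: a1_def x_def mult.commute)
      moreover have "2 * \<rho> * exp (c + 1) * (N ^ p / \<epsilon>) / (2 * (c + 1)) * exp (- (N ^ p / \<epsilon>)) = a2 * x * exp (- (N ^ p * x))"
        by (simp add: a2_def x_def)
      ultimately show ?thesis using 2 unfolding distrib_right by linarith
    qed
    also have "\<dots> = (a1 + a2 * x) * exp (- g * x) * exp (- (es ^ p * x))"
      by (simp add: g_def algebra_simps flip: exp_add)
    also have "\<dots> < a3 * exp (- (es ^ p * x))" using x(1) by (intro mult_strict_right_mono) auto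
    also have "\<dots> = \<rho> / 4 * exp (- (es ^ p / \<epsilon>) - L * \<bar>es\<bar>)"
      by (simp add: a3_def x_def flip: exp_add)
    finally obtain \<beta> where "\<beta> \<in> \<real>" "norm \<beta> \<le> \<rho> / 2" "ray_sol es \<epsilon> \<beta> 0 = target"
      using shooting[OF es D(1,2) \<epsilon>(1) c(1) tr] by blast
    then show "c \<le> es ^ p / \<epsilon> \<and> c \<le> el ^ p / \<epsilon> \<and>
      (\<exists>\<beta>\<in>\<real>. norm \<beta> \<le> \<rho> / 2 \<and> ray_sol es \<epsilon> \<beta> 0 = ray_sol el \<epsilon> 0 0)"
      using c by (auto simp: target_def)
  qed simp
qed

text \<open>The case distinction decides which end is nearer to 0 in the coordinate z, where the
  weight is z^p on both sides. That side is shot at the ray solution on the other side.\<close>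

theorem real_slow_solution_exists:
  assumes ab: "0 < a" "a < A" "0 < b" "b < B"
    and \<tau>1: "0 < \<tau>1" "\<tau>1 < A" "\<tau>1 < B" and \<alpha>: "0 < \<alpha>" "0 < \<epsilon>1"
    and H: "\<And>\<epsilon>. 0 < \<epsilon> \<Longrightarrow> \<epsilon> < \<epsilon>1 \<Longrightarrow> \<exists>v1 v2. slow_solution \<epsilon> {0..\<tau>1} v1 \<and> slow_solution \<epsilon> {- \<tau>1..0} v2 \<and>
        norm (v1 0 - v2 0) \<le> C * exp (- \<alpha> / \<epsilon>)"
  obtains \<epsilon>2 where "0 < \<epsilon>2" "\<And>\<epsilon>. 0 < \<epsilon> \<Longrightarrow> \<epsilon> \<le> \<epsilon>2 \<Longrightarrow>
    \<epsilon> < e0 \<and> (\<exists>v. slow_solution \<epsilon> {- a..b} v \<and> (\<forall>z\<in>{- a..b}. v z \<in> \<real>))"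
proof -
  obtain \<tau>2 where \<tau>2: "0 < \<tau>2" "\<And>\<tau>. 0 < \<tau> \<Longrightarrow> \<tau> < \<tau>2 \<Longrightarrow>
    \<exists>M. \<forall>s\<ge>c. norm (sol (of_real \<tau>) (of_real s) 0 0 - sol (- of_real \<tau>) (of_real s) 0 0) \<le> M * exp (- s)"
    using differences_flat_near_0[OF \<tau>1 \<alpha> H] by blast
  have combine: "\<exists>v. slow_solution \<epsilon> {- a..b} v \<and> (\<forall>z\<in>{- a..b}. v z \<in> \<real>)"
    if "slow_solution \<epsilon> {0..b} v1" "slow_solution \<epsilon> {- a..0} v2" "v1 0 = v2 0"
      "\<And>z. z \<in> {0..b} \<Longrightarrow> v1 z \<in> \<real>" "\<And>z. z \<in> {- a..0} \<Longrightarrow> v2 z \<in> \<real>" for \<epsilon> v1 v2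
    by (rule exI[of _ "\<lambda>z. if z \<le> 0 then v2 z else v1 z"])
      (use slow_solution_glue[OF that(1-3)] ab that(4,5) in auto)
  have ray: "slow_solution \<epsilon> J (ray_sol \<tau> \<epsilon> \<beta>) \<and> (\<forall>z\<in>J. ray_sol \<tau> \<epsilon> \<beta> z \<in> \<real>)"
    if "of_real \<tau> \<in> D" "\<tau> \<noteq> 0" "0 < \<epsilon>" "c \<le> \<tau> ^ p / \<epsilon>" "norm \<beta> \<le> \<rho> / 2" "\<beta> \<in> \<real>" "J \<subseteq> closed_segment 0 \<tau>" for \<tau> \<epsilon> \<beta> J
    using slow_solution_subset[OF ray_sol_slow[OF that(1-5)] that(7)] ray_sol_real[OF that(1-6)] that(7) by blast
  have z: "norm (0::complex) \<le> \<rho> / 2" "(0::complex) \<in> \<real>" using pos by auto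
  show ?thesis
  proof (cases "a \<le> b")
    case True
    \<comment> \<open>The midpoint lies strictly beyond the nearer end, yet both n and -n stay in
      the strip. The ray on the other side must cover \<open>b\<close> and also reach n, hence the
      maximum in \<open>l\<close>.\<close>
    define n where "n = (a + min A B) / 2"
    have n: "a < n" "n < A" "n < B" using ab True by (auto simp: n_def min_def)
    define l where "l = max n b"
    obtain \<epsilon>2 where \<epsilon>2: "0 < \<epsilon>2" "\<And>\<epsilon>. 0 < \<epsilon> \<Longrightarrow> \<epsilon> \<le> \<epsilon>2 \<Longrightarrow> c \<le> (- a) ^ p / \<epsilon> \<and> c \<le> l ^ p / \<epsilon> \<and>
        (\<exists>\<beta>\<in>\<real>. norm \<beta> \<le> \<rho> / 2 \<and> ray_sol (- a) \<epsilon> \<beta> 0 = ray_sol l \<epsilon> 0 0)"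
    proof (rule match_at_0[where es="- a" and N="- n" and el=l, OF _ _ _ _ _ _ _ _ \<tau>2])
      show "0 < - a * - n" using ab n by simp
      show "l * - n < 0" using ab n by (auto simp: l_def)
      show "complex_of_real (- a) \<in> D" "complex_of_real (- n) \<in> D" "complex_of_real (- (- n)) \<in> D"
        "complex_of_real l \<in> D" using n ab pos unfolding of_real_in_strip by (auto simp: l_def)
    qed (use ab n in \<open>auto simp: l_def\<close>)
    show ?thesis
    proof (rule that[OF \<epsilon>2(1)])
      fix \<epsilon> :: real assume \<epsilon>: "0 < \<epsilon>" "\<epsilon> \<le> \<epsilon>2"
      obtain \<beta> where \<beta>: "c \<le> (- a) ^ p / \<epsilon>" "c \<le> l ^ p / \<epsilon>" "\<beta> \<in> \<real>" "norm \<beta> \<le> \<rho> / 2"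
        "ray_sol (- a) \<epsilon> \<beta> 0 = ray_sol l \<epsilon> 0 0" using \<epsilon>2(2)[OF \<epsilon>] by blast
      have Da: "complex_of_real (- a) \<in> D" and Dl: "complex_of_real l \<in> D"
        using n ab pos unfolding of_real_in_strip by (auto simp: l_def)
      have na: "- a \<noteq> 0" and nl: "l \<noteq> 0" using ab n by (auto simp: l_def)
      have "{- a..0} \<subseteq> closed_segment 0 (- a)" "{0..b} \<subseteq> closed_segment 0 l"
        using ab by (auto simp: closed_segment_eq_real_ivl l_def)
      then show "\<epsilon> < e0 \<and> (\<exists>v. slow_solution \<epsilon> {- a..b} v \<and> (\<forall>z\<in>{- a..b}. v z \<in> \<real>))"
        using combine[of \<epsilon> "ray_sol l \<epsilon> 0" "ray_sol (- a) \<epsilon> \<beta>"]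
          ray[OF Da na \<epsilon>(1) \<beta>(1,4,3), of "{- a..0}"] ray[OF Dl nl \<epsilon>(1) \<beta>(2) z, of "{0..b}"]
          ray_eps[OF Dl nl \<epsilon>(1) \<beta>(2) z(1)] \<beta>(5) by simp
    qed
  next
    case False
    define n where "n = (b + min A B) / 2"
    have n: "b < n" "n < A" "n < B" using ab False by (auto simp: n_def min_def)
    define l where "l = max n a"
    obtain \<epsilon>2 where \<epsilon>2: "0 < \<epsilon>2" "\<And>\<epsilon>. 0 < \<epsilon> \<Longrightarrow> \<epsilon> \<le> \<epsilon>2 \<Longrightarrow> c \<le> b ^ p / \<epsilon> \<and> c \<le> (- l) ^ p / \<epsilon> \<and>
        (\<exists>\<beta>\<in>\<real>. norm \<beta> \<le> \<rho> / 2 \<and> ray_sol b \<epsilon> \<beta> 0 = ray_sol (- l) \<epsilon> 0 0)"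
    proof (rule match_at_0[where es=b and N=n and el="- l", OF _ _ _ _ _ _ _ _ \<tau>2])
      show "0 < b * n" using ab n by simp
      show "- l * n < 0" using ab n by (auto simp: l_def)
      show "complex_of_real b \<in> D" "complex_of_real n \<in> D" "complex_of_real (- n) \<in> D"
        "complex_of_real (- l) \<in> D" using n ab pos unfolding of_real_in_strip by (auto simp: l_def)
    qed (use ab n in \<open>auto simp: l_def\<close>)
    show ?thesis
    proof (rule that[OF \<epsilon>2(1)])
      fix \<epsilon> :: real assume \<epsilon>: "0 < \<epsilon>" "\<epsilon> \<le> \<epsilon>2"
      obtain \<beta> where \<beta>: "c \<le> b ^ p / \<epsilon>" "c \<le> (- l) ^ p / \<epsilon>" "\<beta> \<in> \<real>" "norm \<beta> \<le> \<rho> / 2"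
        "ray_sol b \<epsilon> \<beta> 0 = ray_sol (- l) \<epsilon> 0 0" using \<epsilon>2(2)[OF \<epsilon>] by blast
      have Db: "complex_of_real b \<in> D" and Dl: "complex_of_real (- l) \<in> D"
        using n ab pos unfolding of_real_in_strip by (auto simp: l_def)
      have nb: "b \<noteq> 0" and nl: "- l \<noteq> 0" using ab n by (auto simp: l_def)
      have "{0..b} \<subseteq> closed_segment 0 b" "{- a..0} \<subseteq> closed_segment 0 (- l)"
        using ab by (auto simp: closed_segment_eq_real_ivl l_def)
      then show "\<epsilon> < e0 \<and> (\<exists>v. slow_solution \<epsilon> {- a..b} v \<and> (\<forall>z\<in>{- a..b}. v z \<in> \<real>))"
        using combine[of \<epsilon> "ray_sol b \<epsilon> \<beta>" "ray_sol (- l) \<epsilon> 0"]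
          ray[OF Db nb \<epsilon>(1) \<beta>(1,4,3), of "{0..b}"] ray[OF Dl nl \<epsilon>(1) \<beta>(2) z, of "{- a..0}"]
          ray_eps[OF Dl nl \<epsilon>(1) \<beta>(2) z(1)] \<beta>(5) by simp
    qed
  qed
qed

end

section \<open>The normalizing coordinate\<close>

text \<open>The Noshiro-Warschawski criterion: along the segment from x to y the real part of f / (y
  - x) has derivative Re f' > 0.\<close>

lemma inj_on_Re_deriv_pos:
  assumes "convex S" "open S" "f holomorphic_on S" "\<And>z. z \<in> S \<Longrightarrow> Re (deriv f z) > 0"
  shows "inj_on f S"
proof (rule inj_onI, rule ccontr)
  fix x y assume xy: "x \<in> S" "y \<in> S" "f x = f y" "x \<noteq> y"
  define g where "g = (\<lambda>t::real. Re (f (x + of_real t * (y - x)) / (y - x)))"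
  have inS: "x + of_real t * (y - x) \<in> S" if "0 \<le> t" "t \<le> 1" for t
  proof -
    have "(1 - t) *\<^sub>R x + t *\<^sub>R y \<in> S" using convexD_alt[OF assms(1) xy(1,2)] that by blast
    moreover have "(1 - t) *\<^sub>R x + t *\<^sub>R y = x + of_real t * (y - x)"
      by (simp add: scaleR_conv_of_real algebra_simps)
    ultimately show ?thesis by simp
  qed
  have "\<exists>d. (g has_real_derivative d) (at t) \<and> 0 < d" if t: "0 \<le> t" "t \<le> 1" for t
  proof -
    let ?z = "x + of_real t * (y - x)"
    have "(f has_field_derivative deriv f ?z) (at ?z)"
      using holomorphic_derivI[OF assms(3,2) inS[OF t]] .
    moreover have "((\<lambda>t. x + of_real t * (y - x)) has_vector_derivative (y - x)) (at t)"
      by (auto intro!: derivative_eq_intros)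
    ultimately have "(f \<circ> (\<lambda>t. x + of_real t * (y - x)) has_vector_derivative (y - x) * deriv f ?z) (at t)"
      by (intro field_vector_diff_chain_at)
    then have "((\<lambda>t. f (x + of_real t * (y - x)) / (y - x)) has_vector_derivative (y - x) * deriv f ?z / (y - x)) (at t)"
      unfolding o_def by (rule has_vector_derivative_divide)
    then have "((\<lambda>t. Re (f (x + of_real t * (y - x)) / (y - x))) has_vector_derivative Re ((y - x) * deriv f ?z / (y - x))) (at t)"
      by (rule bounded_linear.has_vector_derivative[OF bounded_linear_Re])
    then have "(g has_real_derivative Re (deriv f ?z)) (at t)"
      using xy(4) by (simp add: g_def has_real_derivative_iff_has_vector_derivative)
    then show ?thesis using assms(4)[OF inS[OF t]] by blast
  qed
  then have "g 0 < g 1" by (intro DERIV_pos_imp_increasing[of 0 1 g]) auto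
  then show False using xy by (simp add: g_def)
qed

lemma extend_interval:
  fixes a b :: real and G :: "real set"
  assumes "open G" "{a..b} \<subseteq> G" "a \<le> b"
  obtains a' b' where "a' < a" "b < b'" "{a'..b'} \<subseteq> G"
proof -
  have "a \<in> G" "b \<in> G" using assms by auto
  then obtain e1 e2 where e: "e1 > 0" "cball a e1 \<subseteq> G" "e2 > 0" "cball b e2 \<subseteq> G"
    using assms(1) open_contains_cball by metis
  have "{a - e1..b + e2} \<subseteq> G"
  proof
    fix x assume x: "x \<in> {a - e1..b + e2}"
    consider "x < a" | "x \<in> {a..b}" | "x > b" by force
    then show "x \<in> G"
    proof cases
      case 1
      then have "x \<in> cball a e1" using x by (auto simp: dist_real_def)
      then show ?thesis using e by blast
    next
      case 3
      then have "x \<in> cball b e2" using x by (auto simp: dist_real_def)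
      then show ?thesis using e by blast
    qed (use assms in auto)
  qed
  then show ?thesis using e that[of "a - e1" "b + e2"] by simp
qed

lemma open_real_trace: "open S \<Longrightarrow> open {x::real. complex_of_real x \<in> S}"
  using continuous_on_open_vimage[of UNIV complex_of_real] by (auto simp: vimage_def intro!: continuous_intros)

lemma real_on_reals_deriv:
  assumes "open S" "f holomorphic_on S" "\<And>x. of_real x \<in> S \<Longrightarrow> f (of_real x) \<in> \<real>" "of_real x \<in> S"
  shows "deriv f (of_real x) \<in> \<real>"
    and "((\<lambda>t. Re (f (of_real t))) has_real_derivative Re (deriv f (of_real x))) (at x)"
proof -
  have "(f has_field_derivative deriv f (of_real x)) (at (of_real x))"
    using holomorphic_derivI[OF assms(2,1,4)] .
  then have v: "((\<lambda>t. f (of_real t)) has_vector_derivative deriv f (of_real x)) (at x)"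
    by (rule has_vector_derivative_real_field)
  show "((\<lambda>t. Re (f (of_real t))) has_real_derivative Re (deriv f (of_real x))) (at x)"
    using bounded_linear.has_vector_derivative[OF bounded_linear_Re v] by (simp add: has_real_derivative_iff_has_vector_derivative)
  have "((\<lambda>t. Im (f (of_real t))) has_vector_derivative Im (deriv f (of_real x))) (at x)"
    by (rule bounded_linear.has_vector_derivative[OF bounded_linear_Im v])
  moreover have "((\<lambda>t. Im (f (of_real t))) has_vector_derivative 0) (at x)"
    by (rule has_vector_derivative_transform_within_open[OF has_vector_derivative_const open_real_trace[OF assms(1)]])
      (use assms in \<open>auto simp: complex_is_Real_iff\<close>)
  ultimately have "Im (deriv f (of_real x)) = 0" by (rule vector_derivative_unique_at)
  then show "deriv f (of_real x) \<in> \<real>" by (simp add: complex_is_Real_iff)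
qed

text \<open>The new coordinate is \<open>\<psi> = (\<integral>\<^sub>0\<^sup>x f)\<^bsup>1/p\<^esup>\<close>, with the branch \<open>\<psi>(x) \<sim> x\<close> at 0.\<close>

lemma normalizing_coordinate:
  fixes f :: "complex \<Rightarrow> complex" and a b :: real
  assumes ab: "a < 0" "0 < b" and p: "even p" "2 \<le> p"
    and \<Omega>: "open \<Omega>" "complex_of_real ` {a..b} \<subseteq> \<Omega>" and f: "f holomorphic_on \<Omega>"
    and f_real: "\<And>x. complex_of_real x \<in> \<Omega> \<Longrightarrow> f (of_real x) \<in> \<real>"
    and f_sign: "\<And>x. x \<in> {a..b} - {0} \<Longrightarrow> x * Re (f (complex_of_real x)) > 0"
    and f_0: "\<exists>h. h \<in> O[at 0](\<lambda>x::complex. x) \<and>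
      (\<forall>\<^sub>F x in at 0. f x = of_nat p * x ^ (p - 1) * (1 + h x))"
  obtains A B k \<psi> where "- A < a" "b < B" "0 < k" "strip A B k \<subseteq> \<Omega>" "\<psi> holomorphic_on strip A B k"
    "inj_on \<psi> (strip A B k)" "\<psi> 0 = 0"
    "\<And>x. x \<in> strip A B k \<Longrightarrow> of_nat p * \<psi> x ^ (p - 1) * deriv \<psi> x = f x"
    "\<And>x. complex_of_real x \<in> strip A B k \<Longrightarrow> \<psi> (of_real x) \<in> \<real>"
    "\<And>x. complex_of_real x \<in> strip A B k \<Longrightarrow> Re (deriv \<psi> (of_real x)) > 0"
proof -
  define g where "g = (\<lambda>x. Re (f (complex_of_real x)))"
  define Q where "Q = {x::real. complex_of_real x \<in> \<Omega>}"
  have Q: "open Q" "{a..b} \<subseteq> Q" using open_real_trace[OF \<Omega>(1)] \<Omega>(2) by (auto simp: Q_def)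
  have contg: "continuous_on Q g"
    unfolding g_def Q_def by (intro continuous_intros continuous_on_compose2[OF holomorphic_on_imp_continuous_on[OF f]]) auto
  \<comment> \<open>The sign condition persists slightly outside the interval because f is nonzero
    at both ends. The open interval is added to the two sign sets since it supplies the point 0,
    where f vanishes.\<close>
  define G where "G = (Q \<inter> g -` {..<0} \<inter> {..<0}) \<union> (Q \<inter> g -` {0<..} \<inter> {0<..}) \<union> {a<..<b}"
  have opG: "open G" unfolding G_def
    by (intro open_Un open_Int continuous_open_preimage[OF contg Q(1)]) auto
  have ga: "g a < 0" and gb: "g b > 0"
    using f_sign[of a] f_sign[of b] ab by (auto simp: g_def mult_less_0_iff zero_less_mult_iff)
  have abG: "{a..b} \<subseteq> G" using ga gb Q ab by (auto simp: G_def)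
  obtain a1' b1' where a1': "a1' < a" and b1': "b < b1'" and sub: "{a1'..b1'} \<subseteq> G"
    using extend_interval[OF opG abG] ab by auto
  have sign1: "x * g x > 0" if "x \<in> {a1'..b1'} - {0}" for x
  proof -
    have "x \<in> G" using that sub by auto
    then show ?thesis using f_sign[of x] that by (auto simp: G_def g_def mult_neg_neg)
  qed
  have sub1: "complex_of_real ` {- (- a1')..b1'} \<subseteq> \<Omega>"
  proof -
    have "G \<subseteq> Q" using Q(2) by (auto simp: G_def)
    then show ?thesis using sub by (auto simp: Q_def)
  qed
  obtain k1 where k1: "0 < k1" "strip (- a1') b1' k1 \<subseteq> \<Omega>"
    using strip_subset_open[OF \<Omega>(1) sub1] by blast
  define N1 where "N1 = strip (- a1') b1' k1"
  have N1: "open N1" "convex N1" "N1 \<subseteq> \<Omega>" "0 \<in> N1"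
    unfolding N1_def using open_strip convex_strip k1(2) by blast+ (use k1 a1' b1' ab in \<open>simp add: strip_def\<close>)
  have fN1: "f holomorphic_on N1" using f N1(3) holomorphic_on_subset by blast
  obtain F0 where F0: "\<And>x. x \<in> N1 \<Longrightarrow> (F0 has_field_derivative f x) (at x within N1)"
    using holomorphic_convex_primitive'[OF N1(2,1) fN1] by blast
  define F where "F = (\<lambda>x. F0 x - F0 0)"
  have F: "(F has_field_derivative f x) (at x)" if "x \<in> N1" for x
    unfolding F_def using F0[OF that] at_within_open[OF that N1(1)] by (auto intro!: derivative_eq_intros)
  have F_0: "F 0 = 0" by (simp add: F_def)
  have holF: "F holomorphic_on N1" using F N1(1) by (auto simp: holomorphic_on_open)
  have derF: "deriv F x = f x" if "x \<in> N1" for x using F[OF that] by (rule DERIV_imp_deriv)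
  have F_real: "F (of_real x) \<in> \<real>" if x: "complex_of_real x \<in> N1" for x
  proof -
    define J where "J = {x. complex_of_real x \<in> N1}"
    have "((\<lambda>t. Im (F (of_real t))) has_real_derivative 0) (at t within J)" if "t \<in> J" for t
    proof -
      have "(F has_field_derivative f (of_real t)) (at (of_real t))" using F that by (simp add: J_def)
      then have "((\<lambda>t. F (of_real t)) has_vector_derivative f (of_real t)) (at t)"
        by (rule has_vector_derivative_real_field)
      then have "((\<lambda>t. Im (F (of_real t))) has_vector_derivative Im (f (of_real t))) (at t)"
        by (rule bounded_linear.has_vector_derivative[OF bounded_linear_Im])
      moreover have "Im (f (of_real t)) = 0" using f_real[of t] that N1(3) by (auto simp: J_def complex_is_Real_iff)
      ultimately show ?thesis
        by (simp add: has_real_derivative_iff_has_vector_derivative has_vector_derivative_at_within)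
    qed
    moreover have "convex J"
    proof -
      have "J = {a1'<..<b1'}" using k1 by (auto simp: J_def N1_def)
      then show ?thesis by simp
    qed
    ultimately obtain C where C: "\<And>t. t \<in> J \<Longrightarrow> Im (F (of_real t)) = C"
      using has_field_derivative_zero_constant[of J "\<lambda>t. Im (F (of_real t))"] by blast
    have "0 \<in> J" using N1(4) by (simp add: J_def)
    then have "C = 0" using C[of 0] F_0 by simp
    then show ?thesis using C[of x] x by (simp add: J_def complex_is_Real_iff)
  qed
  have ReF: "((\<lambda>t. Re (F (of_real t))) has_real_derivative g t) (at t)" if "complex_of_real t \<in> N1" for t
    using real_on_reals_deriv(2)[OF N1(1) holF F_real that] derF[OF that] by (simp add: g_def)
  have F_pos: "Re (F (of_real x)) > 0" if x: "complex_of_real x \<in> N1" "x \<noteq> 0" for x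
  proof -
    have x': "a1' < x" "x < b1'" using x by (auto simp: N1_def)
    have inN: "complex_of_real t \<in> N1" if "min x 0 \<le> t" "t \<le> max x 0" for t
      using that x' a1' b1' ab k1 by (auto simp: N1_def min_def max_def split: if_splits)
    have gt: "t * g t > 0" if "min x 0 \<le> t" "t \<le> max x 0" "t \<noteq> 0" for t
      by (rule sign1) (use that x' a1' b1' ab in \<open>auto simp: min_def max_def split: if_splits\<close>)
    have cont: "continuous_on {min x 0..max x 0} (\<lambda>t. Re (F (of_real t)))"
      by (rule DERIV_continuous_on[OF has_field_derivative_at_within[OF ReF[OF inN]]]) auto
    show ?thesis
    proof (cases "x > 0")
      case True
      have "Re (F (of_real 0)) < Re (F (of_real x))"
      proof (rule DERIV_pos_imp_increasing_open[OF True])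
        fix t assume t: "0 < t" "t < x"
        then show "\<exists>y. ((\<lambda>t. Re (F (of_real t))) has_real_derivative y) (at t) \<and> 0 < y"
          using ReF[OF inN, of t] gt[of t] True by (auto simp: zero_less_mult_iff)
      qed (use cont True in simp)
      then show ?thesis using F_0 by simp
    next
      case False
      then have xn: "x < 0" using x by simp
      have "Re (F (of_real 0)) < Re (F (of_real x))"
      proof (rule DERIV_neg_imp_decreasing_open[OF xn])
        fix t assume t: "x < t" "t < 0"
        then show "\<exists>y. ((\<lambda>t. Re (F (of_real t))) has_real_derivative y) (at t) \<and> y < 0"
          using ReF[OF inN, of t] gt[of t] xn by (auto simp: zero_less_mult_iff)
      qed (use cont xn in simp)
      then show ?thesis using F_0 by simp
    qed
  qed
  have lim: "((\<lambda>x. F x / x ^ p) \<longlongrightarrow> 1) (at 0)"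
  proof -
    obtain h where h: "h \<in> O[at 0](\<lambda>x::complex. x)" "\<forall>\<^sub>F x in at 0. f x = of_nat p * x ^ (p - 1) * (1 + h x)"
      using f_0 by blast
    obtain M where M: "M > 0" "\<forall>\<^sub>F x in at 0. norm (h x) \<le> M * norm x"
      using landau_o.bigE[OF h(1)] by blast
    have "\<forall>\<^sub>F x in at 0. norm (f x - of_nat p * x ^ (p - 1)) \<le> real p * M * norm x ^ p"
      using h(2) M(2)
    proof eventually_elim
      case (elim x)
      have "norm (f x - of_nat p * x ^ (p - 1)) = real p * norm x ^ (p - 1) * norm (h x)"
        using elim(1) by (simp add: algebra_simps norm_mult norm_power)
      also have "\<dots> \<le> real p * norm x ^ (p - 1) * (M * norm x)"
        using elim(2) by (intro mult_left_mono) auto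
      also have "\<dots> = real p * M * (norm x * norm x ^ (p - 1))" by simp
      also have "norm x * norm x ^ (p - 1) = norm x ^ p" using p by (simp flip: power_Suc)
      finally show ?case .
    qed
    then obtain d where d: "d > 0" "\<And>x. x \<noteq> 0 \<Longrightarrow> norm x < d \<Longrightarrow> norm (f x - of_nat p * x ^ (p - 1)) \<le> real p * M * norm x ^ p"
      by (auto simp: eventually_at dist_norm)
    obtain d' where d': "d' > 0" "ball 0 d' \<subseteq> N1" using N1(1,4) open_contains_ball by blast
    \<comment> \<open>The hypothesis on f speaks of punctured neighbourhoods; the value at 0 follows
      by continuity.\<close>
    have f0: "norm (f 0 - of_nat p * 0 ^ (p - 1)) \<le> 0"
    proof -
      have "isCont f 0" using fN1 N1(1,4) by (simp add: holomorphic_on_imp_continuous_on continuous_on_interior interior_open continuous_on_eq_continuous_at[THEN iffD1])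
      then have "((\<lambda>x. norm (f x - of_nat p * x ^ (p - 1))) \<longlongrightarrow> norm (f 0 - of_nat p * 0 ^ (p - 1))) (at 0)"
        by (intro tendsto_intros) (simp add: isCont_def)
      moreover have "((\<lambda>x::complex. real p * M * norm x ^ p) \<longlongrightarrow> real p * M * norm (0::complex) ^ p) (at 0)"
        by (intro tendsto_intros)
      moreover have "\<forall>\<^sub>F x in at 0. norm (f x - of_nat p * x ^ (p - 1)) \<le> real p * M * norm x ^ p"
        using d by (auto simp: eventually_at dist_norm)
      ultimately have "norm (f 0 - of_nat p * 0 ^ (p - 1)) \<le> real p * M * norm (0::complex) ^ p"
        by (intro tendsto_le[OF trivial_limit_at])
      then show ?thesis using p by (simp add: power_0_left)
    qed
    have est: "norm (F x - x ^ p) \<le> real p * M * norm x ^ p * norm x" if x: "norm x < min d d'" for x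
    proof -
      have "norm ((F x - x ^ p) - (F 0 - 0 ^ p)) \<le> (real p * M * norm x ^ p) * norm (x - 0)"
      proof (rule field_differentiable_bound[of "cball 0 (norm x)"])
        fix t :: complex assume t: "t \<in> cball 0 (norm x)"
        then have "t \<in> N1" using x d' by auto
        then show "((\<lambda>x. F x - x ^ p) has_field_derivative f t - of_nat p * t ^ (p - 1)) (at t within cball 0 (norm x))"
          by (auto intro!: derivative_eq_intros has_field_derivative_at_within[OF F])
        have "norm (f t - of_nat p * t ^ (p - 1)) \<le> real p * M * norm t ^ p"
          using d(2)[of t] f0 t x p M(1) by (cases "t = 0") auto
        also have "\<dots> \<le> real p * M * norm x ^ p"
          using t M by (intro mult_left_mono power_mono) auto
        finally show "norm (f t - of_nat p * t ^ (p - 1)) \<le> real p * M * norm x ^ p" .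
      qed auto
      then show ?thesis using F_0 p by (simp add: power_0_left)
    qed
    have "\<forall>\<^sub>F x in at 0. norm (F x / x ^ p - 1) \<le> real p * M * norm x"
      unfolding eventually_at
    proof (intro exI[of _ "min d d'"] conjI ballI impI)
      fix x :: complex assume x: "x \<noteq> 0 \<and> dist x 0 < min d d'"
      have xp: "norm x ^ p > 0" using x by simp
      have "F x / x ^ p - 1 = (F x - x ^ p) / x ^ p" using x by (simp add: diff_divide_distrib)
      then have "norm (F x / x ^ p - 1) = norm (F x - x ^ p) / norm x ^ p" by (simp add: norm_divide norm_power)
      also have "\<dots> \<le> real p * M * norm x"
        using est[of x] x xp by (simp add: divide_le_eq mult_ac)
      finally show "norm (F x / x ^ p - 1) \<le> real p * M * norm x" .
    qed (use d d' in auto)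
    moreover have "((\<lambda>x::complex. real p * M * norm x) \<longlongrightarrow> 0) (at 0)"
      by (auto intro!: tendsto_eq_intros)
    ultimately have "((\<lambda>x. F x / x ^ p - 1) \<longlongrightarrow> 0) (at 0)" by (rule Lim_null_comparison)
    then show ?thesis by (simp add: LIM_zero_iff)
  qed
  \<comment> \<open>A p-th root of \<open>F\<close> itself has no obvious branch at its zero.
    Dividing out x^p leaves a nonvanishing function near 0 with value 1 there, whose root can be
    taken; the factor x is put back afterwards.\<close>
  define H where "H = (\<lambda>x. if x = 0 then 1 else F x / x ^ p)"
  have holH: "H holomorphic_on N1"
    unfolding H_def
    by (rule removable_singularity[OF _ N1(1) lim])
      (auto intro!: holomorphic_intros holomorphic_on_subset[OF holF])
  have FH: "F x = x ^ p * H x" for x using F_0 p by (simp add: H_def)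
  have H_real: "H (of_real x) \<in> \<real>" "Re (H (of_real x)) > 0" if x: "complex_of_real x \<in> N1" for x
  proof -
    obtain y where y: "F (of_real x) = of_real y" using F_real[OF x] by (auto elim: Reals_cases)
    have "H (of_real x) = (if x = 0 then 1 else of_real (y / x ^ p))" by (simp add: H_def y)
    moreover have "y / x ^ p > 0" if "x \<noteq> 0"
      using F_pos[OF x that] y that p by (simp add: zero_less_power_eq)
    ultimately show "H (of_real x) \<in> \<real>" "Re (H (of_real x)) > 0" by auto
  qed
  define a2 where "a2 = (a1' + a) / 2"
  define b2 where "b2 = (b1' + b) / 2"
  have ab2: "a1' < a2" "a2 < a" "b < b2" "b2 < b1'" using a1' b1' by (auto simp: a2_def b2_def)
  have in2: "complex_of_real x \<in> N1" if "x \<in> {- (- a2)..b2}" for x using that ab2 k1 by (auto simp: N1_def)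
  \<comment> \<open>Where Re H > 0 the principal power is holomorphic.\<close>
  define G2 where "G2 = N1 \<inter> H -` {w. 0 < Re w}"
  have opG2: "open G2" unfolding G2_def
    by (rule continuous_open_preimage[OF holomorphic_on_imp_continuous_on[OF holH] N1(1)]) (rule open_halfspace_Re_gt)
  define \<psi> where "\<psi> = (\<lambda>x. x * H x powr (1 / of_nat p))"
  have hol\<psi>: "\<psi> holomorphic_on G2"
    unfolding \<psi>_def
    by (intro holomorphic_intros holomorphic_on_subset[OF holH])
      (auto simp: G2_def complex_nonpos_Reals_iff)
  have \<psi>p: "\<psi> x ^ p = F x" if "x \<in> G2" for x
  proof -
    have "H x \<noteq> 0" using that by (auto simp: G2_def)
    then have "(H x powr (1 / of_nat p)) ^ p = H x"
      using p by (simp add: powr_def flip: exp_of_nat_mult)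
    then show ?thesis by (simp add: \<psi>_def power_mult_distrib FH)
  qed
  have \<psi>': "of_nat p * \<psi> x ^ (p - 1) * deriv \<psi> x = f x" if x: "x \<in> G2" for x
  proof -
    have "((\<lambda>x. \<psi> x ^ p) has_field_derivative of_nat p * \<psi> x ^ (p - 1) * deriv \<psi> x) (at x)"
      using holomorphic_derivI[OF hol\<psi> opG2 x] by (auto intro!: derivative_eq_intros)
    moreover have "((\<lambda>x. \<psi> x ^ p) has_field_derivative f x) (at x)"
      by (rule has_field_derivative_transform_within_open[OF F opG2 x])
        (use x \<psi>p in \<open>auto simp: G2_def\<close>)
    ultimately show ?thesis by (rule DERIV_unique)
  qed
  have \<psi>_real: "\<psi> (of_real x) = of_real (x * Re (H (of_real x)) powr (1 / real p))" if x: "complex_of_real x \<in> N1" for x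
  proof -
    have "H (of_real x) = of_real (Re (H (of_real x)))" using H_real(1)[OF x] by simp
    moreover have "complex_of_real (Re (H (of_real x))) powr of_real (1 / real p) = of_real (Re (H (of_real x)) powr (1 / real p))"
      using H_real(2)[OF x] by (intro powr_of_real) auto
    ultimately show ?thesis by (simp add: \<psi>_def)
  qed
  \<comment> \<open>For x \<noteq> 0 the value \<psi>(x) has the sign of x, and so has f(x); as p -
    1 is odd, the relation \<psi>' forces a positive derivative. At 0 this relation degenerates, and
    the derivative is the value 1 of the root of \<open>H\<close>.\<close>
  have \<psi>'_pos: "Re (deriv \<psi> (of_real x)) > 0" if x: "complex_of_real x \<in> G2" for x
  proof -
    have xN: "complex_of_real x \<in> N1" using x by (simp add: G2_def)
    have dreal: "deriv \<psi> (of_real x) \<in> \<real>"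
      by (rule real_on_reals_deriv(1)[OF opG2 hol\<psi> _ x]) (use \<psi>_real in \<open>auto simp: G2_def\<close>)
    define d where "d = Re (deriv \<psi> (of_real x))"
    have d: "deriv \<psi> (of_real x) = of_real d" using dreal by (simp add: d_def)
    show ?thesis
    proof (cases "x = 0")
      case True
      have "0 \<in> G2" using x True by simp
      have "(\<psi> has_field_derivative deriv \<psi> 0) (at 0)" using holomorphic_derivI[OF hol\<psi> opG2 \<open>0 \<in> G2\<close>] .
      then have "((\<lambda>x. (\<psi> x - \<psi> 0) / (x - 0)) \<longlongrightarrow> deriv \<psi> 0) (at 0)" by (simp add: has_field_derivative_iff)
      moreover have "((\<lambda>x. (\<psi> x - \<psi> 0) / (x - 0)) \<longlongrightarrow> 1) (at 0)"
      proof -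
        have "isCont (\<lambda>x. H x powr (1 / of_nat p)) 0"
        proof -
          have "(\<lambda>x. H x powr (1 / of_nat p)) holomorphic_on G2"
            by (intro holomorphic_intros holomorphic_on_subset[OF holH])
              (auto simp: G2_def complex_nonpos_Reals_iff)
          then show ?thesis using opG2 \<open>0 \<in> G2\<close>
            by (metis continuous_on_eq_continuous_at holomorphic_on_imp_continuous_on)
        qed
        then have "((\<lambda>x. H x powr (1 / of_nat p)) \<longlongrightarrow> 1) (at 0)" by (simp add: isCont_def H_def)
        moreover have "\<forall>\<^sub>F x in at 0. (\<psi> x - \<psi> 0) / (x - 0) = H x powr (1 / of_nat p)"
          by (auto simp: eventually_at \<psi>_def intro!: exI[of _ 1])
        ultimately show ?thesis by (simp cong: tendsto_cong)
      qed
      ultimately have "deriv \<psi> 0 = 1" by (rule LIM_unique)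
      then show ?thesis using True by simp
    next
      case False
      define y where "y = x * Re (H (of_real x)) powr (1 / real p)"
      have y: "\<psi> (of_real x) = of_real y" using \<psi>_real[OF xN] by (simp add: y_def)
      have xy: "x * y > 0"
      proof -
        have "x * x > 0" using False by (auto simp: zero_less_mult_iff)
        then have "(x * x) * Re (H (of_real x)) powr (1 / real p) > 0"
          by (rule mult_pos_pos) (use H_real(2)[OF xN] in simp)
        then show ?thesis by (simp add: y_def mult.assoc)
      qed
      have "of_real (real p * y ^ (p - 1) * d) = f (of_real x)" using \<psi>'[OF x] by (simp add: y d)
      then have "real p * y ^ (p - 1) * d = g x" unfolding g_def by (metis Re_complex_of_real)
      moreover have "x * g x > 0" by (rule sign1) (use xN False in \<open>auto simp: N1_def\<close>)
      ultimately have "x * (real p * y ^ (p - 1) * d) > 0" by simp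
      moreover have "x * y ^ (p - 1) > 0"
      proof -
        have "y ^ (p - 1) = y * y ^ (p - 2)" using p by (simp flip: power_Suc add: numeral_2_eq_2 Suc_diff_Suc)
        moreover have "y ^ (p - 2) > 0" using xy p by (auto simp: zero_less_power_eq)
        ultimately show ?thesis using xy by (simp flip: mult.assoc)
      qed
      moreover have "x * (real p * y ^ (p - 1) * d) = (real p * d) * (x * y ^ (p - 1))" by simp
      ultimately have "real p * d > 0" by (metis zero_less_mult_pos2)
      then show ?thesis using p by (simp add: d_def zero_less_mult_iff)
    qed
  qed
  \<comment> \<open>Positivity of Re \<psi>' spreads from the real interval to a strip, where it
    gives injectivity.\<close>
  define G3 where "G3 = G2 \<inter> deriv \<psi> -` {w. 0 < Re w}"
  have opG3: "open G3" unfolding G3_def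
    by (rule continuous_open_preimage[OF holomorphic_on_imp_continuous_on[OF holomorphic_deriv[OF hol\<psi> opG2]] opG2])
      (rule open_halfspace_Re_gt)
  have "complex_of_real ` {- (- a2)..b2} \<subseteq> G3"
    using in2 H_real \<psi>'_pos by (force simp: G3_def G2_def)
  then obtain k where k: "0 < k" "strip (- a2) b2 k \<subseteq> G3" using strip_subset_open[OF opG3] by blast
  have sG2: "strip (- a2) b2 k \<subseteq> G2" using k by (auto simp: G3_def)
  have sN1: "strip (- a2) b2 k \<subseteq> N1" using sG2 by (auto simp: G2_def)
  have hol: "\<psi> holomorphic_on strip (- a2) b2 k" by (rule holomorphic_on_subset[OF hol\<psi> sG2])
  show ?thesis
  proof (rule that[of "- a2" b2 k \<psi>])
    show "strip (- a2) b2 k \<subseteq> \<Omega>" using sN1 N1(3) by blast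
    show "inj_on \<psi> (strip (- a2) b2 k)"
      by (rule inj_on_Re_deriv_pos[OF convex_strip open_strip hol]) (use k in \<open>auto simp: G3_def\<close>)
    show "\<psi> 0 = 0" by (simp add: \<psi>_def)
    show "of_nat p * \<psi> x ^ (p - 1) * deriv \<psi> x = f x" if "x \<in> strip (- a2) b2 k" for x
      using \<psi>' sG2 that by blast
    show "\<psi> (of_real x) \<in> \<real>" if "complex_of_real x \<in> strip (- a2) b2 k" for x
      unfolding \<psi>_real[OF subsetD[OF sN1 that]] by (rule Reals_of_real)
    show "Re (deriv \<psi> (of_real x)) > 0" if "complex_of_real x \<in> strip (- a2) b2 k" for x
      using \<psi>'_pos sG2 that by blast
  qed (use ab2 k hol in auto)
qed

section \<open>Canards of a normalized equation\<close>

text \<open>Variation of constants backwards from \<sigma> = 1. Only the size of the forcing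
  \<open>q\<close> enters, so this applies to a canard for which nothing but boundedness is known,
  outside the ball in which the Lipschitz estimate holds.\<close>

lemma damped_bound:
  fixes w q :: "real \<Rightarrow> complex"
  assumes w: "\<And>\<sigma>. \<sigma> \<in> {0..1} \<Longrightarrow>
      (w has_vector_derivative of_real (s * (real p * \<sigma> ^ (p - 1))) * w \<sigma> + q \<sigma>) (at \<sigma> within {0..1})"
    and q: "\<And>\<sigma>. \<sigma> \<in> {0..1} \<Longrightarrow> norm (q \<sigma>) \<le> K" and w1: "norm (w 1) \<le> B"
    and kernel: "integral {\<sigma>..1} (\<lambda>r. exp ((\<sigma> ^ p - r ^ p) * s)) \<le> \<kappa>" and K: "0 \<le> K" and \<sigma>: "\<sigma> \<in> {0..1}"
  shows "norm (w \<sigma>) \<le> exp (- ((1 - \<sigma> ^ p) * s)) * B + \<kappa> * K"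
proof -
  define u where "u = (\<lambda>r. exp ((\<sigma> ^ p - r ^ p) * s) *\<^sub>R w r)"
  have u: "(u has_vector_derivative exp ((\<sigma> ^ p - r ^ p) * s) *\<^sub>R q r) (at r within {\<sigma>..1})" if r: "r \<in> {\<sigma>..1}" for r
  proof -
    have r': "r \<in> {0..1}" using r \<sigma> by auto
    have 1: "((\<lambda>r. exp ((\<sigma> ^ p - r ^ p) * s)) has_vector_derivative
        exp ((\<sigma> ^ p - r ^ p) * s) * (- (real p * r ^ (p - 1)) * s)) (at r within {\<sigma>..1})"
      unfolding has_real_derivative_iff_has_vector_derivative[symmetric]
      by (rule DERIV_chain2[where f=exp, OF DERIV_exp]) (auto intro!: derivative_eq_intros)
    have 2: "(w has_vector_derivative of_real (s * (real p * r ^ (p - 1))) * w r + q r) (at r within {\<sigma>..1})"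
      by (rule has_vector_derivative_within_subset[OF w[OF r']]) (use \<sigma> in auto)
    have eq: "E *\<^sub>R (of_real (s * P) * W + Q) + (E * (- P * s)) *\<^sub>R W = E *\<^sub>R Q" for E P :: real and W Q :: complex
      by (simp add: scaleR_conv_of_real algebra_simps)
    from has_vector_derivative_scaleR[OF 1[unfolded has_real_derivative_iff_has_vector_derivative[symmetric]] 2]
    show ?thesis unfolding eq u_def .
  qed
  have int: "((\<lambda>r. exp ((\<sigma> ^ p - r ^ p) * s) *\<^sub>R q r) has_integral (u 1 - u \<sigma>)) {\<sigma>..1}"
    by (rule fundamental_theorem_of_calculus) (use \<sigma> u in auto)
  have "norm (integral {\<sigma>..1} (\<lambda>r. exp ((\<sigma> ^ p - r ^ p) * s) *\<^sub>R q r)) \<le> integral {\<sigma>..1} (\<lambda>r. exp ((\<sigma> ^ p - r ^ p) * s) * K)"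
    by (rule integral_norm_bound_integral[OF has_integral_integrable[OF int]])
      (use q \<sigma> in \<open>auto intro!: integrable_continuous_real continuous_intros\<close>)
  also have "\<dots> \<le> \<kappa> * K" using kernel K by (simp add: mult_right_mono)
  finally have "norm (u 1 - u \<sigma>) \<le> \<kappa> * K" using int by (simp add: integral_unique)
  moreover have "u \<sigma> = w \<sigma>" by (simp add: u_def)
  moreover have "norm (u 1) \<le> exp (- ((1 - \<sigma> ^ p) * s)) * B"
    using w1 by (simp add: u_def left_diff_distrib mult_left_mono)
  ultimately show ?thesis using norm_triangle_ineq2[of "u \<sigma>" "u 1"] by (simp add: norm_minus_commute)
qed

text \<open>The original equation together with the real change of variables \<open>z = Z(x)\<close>, \<open>x = X(z)\<close>
  that brings it into normal form; only its restriction to real arguments is needed.\<close>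

locale normalized_equation = normal_form +
  fixes \<Omega> :: "complex set" and f :: "complex \<Rightarrow> complex" and U :: "(complex \<times> complex \<times> complex) set"
    and P :: "complex \<times> complex \<times> complex \<Rightarrow> complex" and a b :: real and X X' Z Z' :: "real \<Rightarrow> real"
    and M :: real
  assumes ab: "a < 0" "0 < b"
    and U_open: "open U" and P_cont: "continuous_on U P"
    and Z_range: "\<And>x. x \<in> {a..b} \<Longrightarrow> - A < Z x \<and> Z x < B" and Z_0: "Z 0 = 0"
    and Z_mono: "\<And>x y. x \<in> {a..b} \<Longrightarrow> y \<in> {a..b} \<Longrightarrow> x < y \<Longrightarrow> Z x < Z y"
    and XZ: "\<And>x. x \<in> {a..b} \<Longrightarrow> X (Z x) = x"
    and Z_deriv: "\<And>x. x \<in> {a..b} \<Longrightarrow> (Z has_real_derivative Z' x) (at x)"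
    and X_deriv: "\<And>z. z \<in> {- A<..<B} \<Longrightarrow> (X has_real_derivative X' z) (at z)"
    and X'_bound: "\<And>z. z \<in> {- A<..<B} \<Longrightarrow> \<bar>X' z\<bar> \<le> M"
    and ZX': "\<And>x. x \<in> {a..b} \<Longrightarrow> Z' x * X' (Z x) = 1"
    and X'_f: "\<And>z. z \<in> {- A<..<B} \<Longrightarrow> of_real (X' z) * f (of_real (X z)) = of_nat p * of_real z ^ (p - 1)"
    and R_P: "\<And>z y e. z \<in> {- A<..<B} \<Longrightarrow> norm y \<le> \<rho> \<Longrightarrow> norm e < e0 \<Longrightarrow>
        R (of_real z) y e = of_real (X' z) * P (of_real (X z), y, e)"
    and dom: "\<And>x y e. x \<in> {a..b} \<Longrightarrow> norm y \<le> \<rho> \<Longrightarrow> norm e < e0 \<Longrightarrow>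
        of_real x \<in> \<Omega> \<and> (of_real x, y, e) \<in> U"
begin

section \<open>Transfer between the coordinates x and z\<close>

lemma Z_le: "x \<in> {a..b} \<Longrightarrow> y \<in> {a..b} \<Longrightarrow> x \<le> y \<Longrightarrow> Z x \<le> Z y"
  using Z_mono[of x y] by (cases "x = y") auto

lemma Z_sign: "x \<in> {a..b} \<Longrightarrow> 0 \<le> x \<Longrightarrow> 0 \<le> Z x" "x \<in> {a..b} \<Longrightarrow> x \<le> 0 \<Longrightarrow> Z x \<le> 0"
  using Z_le[of 0 x] Z_le[of x 0] Z_0 ab by auto

lemma Z_cont: "S \<subseteq> {a..b} \<Longrightarrow> continuous_on S Z"
  using Z_deriv by (meson DERIV_continuous_on has_field_derivative_at_within subsetD)

lemma Z_surj:
  assumes "x1 \<in> {a..b}" "x2 \<in> {a..b}" "z \<in> {Z x1..Z x2}"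
  shows "\<exists>x\<in>{x1..x2}. Z x = z"
proof -
  have "x1 \<le> x2" using Z_mono[of x2 x1] assms by force
  then show ?thesis using IVT'[of Z x1 z x2] Z_cont[of "{x1..x2}"] assms by auto
qed

lemma X_in:
  assumes "x1 \<in> {a..b}" "x2 \<in> {a..b}" "z \<in> {Z x1..Z x2}"
  shows "X z \<in> {x1..x2}" "Z (X z) = z"
proof -
  obtain x where x: "x \<in> {x1..x2}" "Z x = z" using Z_surj[OF assms] by blast
  then have "X z = x" using XZ[of x] assms by auto
  then show "X z \<in> {x1..x2}" "Z (X z) = z" using x by auto
qed

definition x_sol :: "real \<Rightarrow> real set \<Rightarrow> (real \<Rightarrow> complex) \<Rightarrow> bool"
  where "x_sol \<epsilon> I Y \<longleftrightarrow> (\<forall>x\<in>I. norm (Y x) \<le> \<rho> \<and>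
    (Y has_vector_derivative f (of_real x) / of_real \<epsilon> * Y x + P (of_real x, Y x, of_real \<epsilon>)) (at x within I))"

text \<open>Chain rule together with \<open>X'_f\<close>. The forcing \<open>Q\<close> is arbitrary
  because a canard that is not yet known to be bounded by \<rho> does not admit the replacement of
  \<open>P\<close> by \<open>R\<close>.\<close>

lemma x_deriv_to_z:
  assumes J: "x1 \<in> {a..b}" "x2 \<in> {a..b}" and z: "z \<in> {Z x1..Z x2}"
    and Y: "(Y has_vector_derivative f (of_real (X z)) / of_real \<epsilon> * Y (X z) + Q) (at (X z) within {x1..x2})"
  shows "((\<lambda>z. Y (X z)) has_vector_derivative
    of_real (real p * z ^ (p - 1) / \<epsilon>) * Y (X z) + of_real (X' z) * Q) (at z within {Z x1..Z x2})"
proof -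
  have zI: "z \<in> {- A<..<B}" using z Z_range[OF J(1)] Z_range[OF J(2)] by auto
  have 1: "(X has_vector_derivative X' z) (at z within {Z x1..Z x2})"
    using X_deriv[OF zI] by (simp add: has_real_derivative_iff_has_vector_derivative has_vector_derivative_at_within)
  have "X ` {Z x1..Z x2} \<subseteq> {x1..x2}" using X_in(1)[OF J] by blast
  from vector_diff_chain_within[OF 1 has_vector_derivative_within_subset[OF Y this]]
  have "((\<lambda>z. Y (X z)) has_vector_derivative X' z *\<^sub>R (f (of_real (X z)) / of_real \<epsilon> * Y (X z) + Q)) (at z within {Z x1..Z x2})"
    by (simp add: o_def)
  moreover have "X' z *\<^sub>R (f (of_real (X z)) / of_real \<epsilon> * Y (X z) + Q)
      = (of_real (X' z) * f (of_real (X z))) / of_real \<epsilon> * Y (X z) + of_real (X' z) * Q"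
    by (simp add: scaleR_conv_of_real algebra_simps)
  ultimately show ?thesis unfolding X'_f[OF zI] by simp
qed

lemma x_sol_to_z:
  assumes Y: "x_sol \<epsilon> {x1..x2} Y" and J: "x1 \<in> {a..b}" "x2 \<in> {a..b}" and \<epsilon>: "0 < \<epsilon>" "\<epsilon> < e0"
  shows "slow_solution \<epsilon> {Z x1..Z x2} (\<lambda>z. Y (X z))"
  unfolding slow_solution_def
proof (intro ballI conjI)
  fix z assume z: "z \<in> {Z x1..Z x2}"
  have Xz: "X z \<in> {x1..x2}" using X_in(1)[OF J z] .
  then show n: "norm (Y (X z)) \<le> \<rho>" using Y by (auto simp: x_sol_def)
  have zI: "z \<in> {- A<..<B}" using z Z_range[OF J(1)] Z_range[OF J(2)] by auto
  have "(Y has_vector_derivative f (of_real (X z)) / of_real \<epsilon> * Y (X z) + P (of_real (X z), Y (X z), of_real \<epsilon>)) (at (X z) within {x1..x2})"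
    using Y Xz unfolding x_sol_def by blast
  from x_deriv_to_z[OF J z this]
  show "((\<lambda>z. Y (X z)) has_vector_derivative
      of_real (real p * z ^ (p - 1) / \<epsilon>) * Y (X z) + R (of_real z) (Y (X z)) (of_real \<epsilon>)) (at z within {Z x1..Z x2})"
    using R_P[OF zI n, of "of_real \<epsilon>"] \<epsilon> by simp
qed

lemma slow_solution_to_x:
  assumes v: "slow_solution \<epsilon> {Z a..Z b} v" and real: "\<And>z. z \<in> {Z a..Z b} \<Longrightarrow> v z \<in> \<real>" and \<epsilon>: "0 < \<epsilon>" "\<epsilon> < e0"
  shows "real_solution_on \<Omega> f U P \<epsilon> {a..b} (\<lambda>x. Re (v (Z x)))" "\<And>x. x \<in> {a..b} \<Longrightarrow> \<bar>Re (v (Z x))\<bar> \<le> \<rho>"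
proof -
  have Zx: "Z x \<in> {Z a..Z b}" if "x \<in> {a..b}" for x using Z_le[of a x] Z_le[of x b] that ab by auto
  have vb: "norm (v (Z x)) \<le> \<rho>" if "x \<in> {a..b}" for x using v Zx[OF that] by (auto simp: slow_solution_def)
  show "\<bar>Re (v (Z x))\<bar> \<le> \<rho>" if "x \<in> {a..b}" for x using vb[OF that] abs_Re_le_cmod order_trans by blast
  show "real_solution_on \<Omega> f U P \<epsilon> {a..b} (\<lambda>x. Re (v (Z x)))"
    unfolding real_solution_on_def
  proof (intro ballI)
    fix x assume x: "x \<in> {a..b}"
    have vr: "of_real (Re (v (Z x))) = v (Z x)" using real[OF Zx[OF x]] by simp
    have zI: "Z x \<in> {- A<..<B}" using Z_range[OF x] by auto
    have 1: "(Z has_vector_derivative Z' x) (at x within {a..b})"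
      using Z_deriv[OF x] by (simp add: has_real_derivative_iff_has_vector_derivative has_vector_derivative_at_within)
    have im: "Z ` {a..b} \<subseteq> {Z a..Z b}" using Zx by blast
    define D where "D = of_real (real p * Z x ^ (p - 1) / \<epsilon>) * v (Z x) + R (of_real (Z x)) (v (Z x)) (of_real \<epsilon>)"
    have "(v has_vector_derivative D) (at (Z x) within {Z a..Z b})"
      using v Zx[OF x] by (simp add: slow_solution_def D_def)
    from vector_diff_chain_within[OF 1 has_vector_derivative_within_subset[OF this im]]
    have vZ: "((\<lambda>x. v (Z x)) has_vector_derivative Z' x *\<^sub>R D) (at x within {a..b})" by (simp add: o_def)
    have "R (of_real (Z x)) (v (Z x)) (of_real \<epsilon>) \<in> \<real>"
      by (rule R_real) (use zI pos vb[OF x] real[OF Zx[OF x]] \<epsilon> in auto)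
    then have "D \<in> \<real>" unfolding D_def
      by (intro Reals_add Reals_mult real[OF Zx[OF x]]) auto
    then have Dr: "of_real (Re (Z' x *\<^sub>R D)) = Z' x *\<^sub>R D"
      by (simp add: complex_eq_iff complex_is_Real_iff)
    have "((\<lambda>x. Re (v (Z x))) has_vector_derivative Re (Z' x *\<^sub>R D)) (at x within {a..b})"
      by (rule bounded_linear.has_vector_derivative[OF bounded_linear_Re vZ])
    then have d: "((\<lambda>x. Re (v (Z x))) has_real_derivative Re (Z' x *\<^sub>R D)) (at x within {a..b})"
      by (simp add: has_real_derivative_iff_has_vector_derivative)
    \<comment> \<open>The original equation is verified after multiplication by X'(Z x), the factor
      that \<open>X'_f\<close> and \<open>R_P\<close> carry; it is nonzero by \<open>ZX'\<close> and
      is cancelled at the end.\<close>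
    have "of_real (X' (Z x)) * (of_real \<epsilon> * (Z' x *\<^sub>R D)) = of_real (X' (Z x) * Z' x) * (of_real \<epsilon> * D)"
      by (simp add: scaleR_conv_of_real)
    also have "of_real (X' (Z x) * Z' x) = (1::complex)" using ZX'[OF x] by (simp add: mult.commute)
    also have "1 * (of_real \<epsilon> * D) = of_nat p * of_real (Z x) ^ (p - 1) * v (Z x) + of_real \<epsilon> * R (of_real (Z x)) (v (Z x)) (of_real \<epsilon>)"
      using \<epsilon> by (simp add: D_def distrib_left)
    also have "\<dots> = of_real (X' (Z x)) * (f (of_real x) * v (Z x) + of_real \<epsilon> * P (of_real x, v (Z x), of_real \<epsilon>))"
    proof -
      have "of_real (X' (Z x)) * f (of_real x) = of_nat p * of_real (Z x) ^ (p - 1)"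
        using X'_f[OF zI] XZ[OF x] by simp
      moreover have "R (of_real (Z x)) (v (Z x)) (of_real \<epsilon>) = of_real (X' (Z x)) * P (of_real x, v (Z x), of_real \<epsilon>)"
        using R_P[OF zI vb[OF x], of "of_real \<epsilon>"] \<epsilon> XZ[OF x] by simp
      ultimately show ?thesis by (simp add: distrib_left mult_ac)
    qed
    finally have "of_real (X' (Z x)) * (of_real \<epsilon> * (Z' x *\<^sub>R D))
      = of_real (X' (Z x)) * (f (of_real x) * v (Z x) + of_real \<epsilon> * P (of_real x, v (Z x), of_real \<epsilon>))" .
    moreover have "complex_of_real (X' (Z x)) \<noteq> 0" using ZX'[OF x] by auto
    ultimately have eq: "of_real \<epsilon> * (Z' x *\<^sub>R D) = f (of_real x) * v (Z x) + of_real \<epsilon> * P (of_real x, v (Z x), of_real \<epsilon>)"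
      by (simp only: mult_cancel_left simp_thms)
    show "complex_of_real x \<in> \<Omega> \<and> (complex_of_real x, complex_of_real (Re (v (Z x))), complex_of_real \<epsilon>) \<in> U \<and>
       (\<exists>d. ((\<lambda>x. Re (v (Z x))) has_real_derivative d) (at x within {a..b}) \<and>
          complex_of_real (\<epsilon> * d) = f (complex_of_real x) * complex_of_real (Re (v (Z x))) +
            complex_of_real \<epsilon> * P (complex_of_real x, complex_of_real (Re (v (Z x))), complex_of_real \<epsilon>))"
      unfolding vr using dom[OF x vb[OF x], of "of_real \<epsilon>"] \<epsilon> d eq Dr by (auto intro!: exI[of _ "Re (Z' x *\<^sub>R D)"])
  qed
qed

theorem global_canard_exists:
  assumes x1: "0 < x1" "a \<le> - x1" "x1 \<le> b" and \<alpha>: "0 < \<alpha>" "0 < \<epsilon>1"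
    and H: "\<And>\<epsilon>. 0 < \<epsilon> \<Longrightarrow> \<epsilon> < \<epsilon>1 \<Longrightarrow> \<exists>Y1 Y2. x_sol \<epsilon> {0..x1} Y1 \<and> x_sol \<epsilon> {- x1..0} Y2 \<and>
        norm (Y1 0 - Y2 0) \<le> C * exp (- \<alpha> / \<epsilon>)"
  shows "\<exists>y. global_canard \<Omega> f U P a b y"
proof -
  have in_ab: "0 \<in> {a..b}" "x1 \<in> {a..b}" "- x1 \<in> {a..b}" "a \<in> {a..b}" "b \<in> {a..b}" using x1 ab by auto
  have Zpos: "0 < Z x1" "Z (- x1) < 0" "Z a < 0" "0 < Z b"
    using Z_mono[OF in_ab(1,2)] Z_mono[OF in_ab(3,1)] Z_mono[OF in_ab(4,1)] Z_mono[OF in_ab(1,5)] Z_0 x1 ab by auto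
  define \<tau>1 where "\<tau>1 = min (Z x1) (- Z (- x1))"
  have \<tau>1: "0 < \<tau>1" "\<tau>1 < A" "\<tau>1 < B" "\<tau>1 \<le> Z x1" "Z (- x1) \<le> - \<tau>1"
    using Zpos Z_range[OF in_ab(2)] Z_range[OF in_ab(3)] by (auto simp: \<tau>1_def)
  obtain \<epsilon>2 where \<epsilon>2: "0 < \<epsilon>2" "\<And>\<epsilon>. 0 < \<epsilon> \<Longrightarrow> \<epsilon> \<le> \<epsilon>2 \<Longrightarrow>
    \<epsilon> < e0 \<and> (\<exists>v. slow_solution \<epsilon> {- (- Z a)..Z b} v \<and> (\<forall>z\<in>{- (- Z a)..Z b}. v z \<in> \<real>))"
  proof (rule real_slow_solution_exists[of "- Z a" "Z b" \<tau>1 \<alpha> "min \<epsilon>1 e0" C])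
    fix \<epsilon> :: real assume \<epsilon>: "0 < \<epsilon>" "\<epsilon> < min \<epsilon>1 e0"
    then obtain Y1 Y2 where Y: "x_sol \<epsilon> {0..x1} Y1" "x_sol \<epsilon> {- x1..0} Y2" "norm (Y1 0 - Y2 0) \<le> C * exp (- \<alpha> / \<epsilon>)"
      using H[of \<epsilon>] by auto
    have X0: "X 0 = 0" using XZ[OF in_ab(1)] Z_0 by simp
    have "slow_solution \<epsilon> {0..\<tau>1} (\<lambda>z. Y1 (X z))"
      by (rule slow_solution_subset[OF x_sol_to_z[OF Y(1) in_ab(1,2)]]) (use \<epsilon> Z_0 \<tau>1 in auto)
    moreover have "slow_solution \<epsilon> {- \<tau>1..0} (\<lambda>z. Y2 (X z))"
      by (rule slow_solution_subset[OF x_sol_to_z[OF Y(2) in_ab(3,1)]]) (use \<epsilon> Z_0 \<tau>1 in auto)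
    ultimately show "\<exists>v1 v2. slow_solution \<epsilon> {0..\<tau>1} v1 \<and> slow_solution \<epsilon> {- \<tau>1..0} v2 \<and>
        norm (v1 0 - v2 0) \<le> C * exp (- \<alpha> / \<epsilon>)"
      using Y(3) X0 by (intro exI[of _ "\<lambda>z. Y1 (X z)"] exI[of _ "\<lambda>z. Y2 (X z)"]) simp
  qed (use Zpos Z_range[OF in_ab(4)] Z_range[OF in_ab(5)] \<tau>1 \<alpha> pos in auto)
  then have "\<forall>\<epsilon>. \<exists>v. 0 < \<epsilon> \<and> \<epsilon> \<le> \<epsilon>2 \<longrightarrow> \<epsilon> < e0 \<and> slow_solution \<epsilon> {Z a..Z b} v \<and> (\<forall>z\<in>{Z a..Z b}. v z \<in> \<real>)"
    by auto
  then obtain v where v: "\<And>\<epsilon>. 0 < \<epsilon> \<Longrightarrow> \<epsilon> \<le> \<epsilon>2 \<Longrightarrow> \<epsilon> < e0 \<and> slow_solution \<epsilon> {Z a..Z b} (v \<epsilon>) \<and> (\<forall>z\<in>{Z a..Z b}. v \<epsilon> z \<in> \<real>)"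
    by metis
  define y where "y = (\<lambda>x \<epsilon>. Re (v \<epsilon> (Z x)))"
  have sol: "real_solution_on \<Omega> f U P \<epsilon> {a..b} (\<lambda>x. y x \<epsilon>)" and bnd: "x \<in> {a..b} \<Longrightarrow> \<bar>y x \<epsilon>\<bar> \<le> \<rho>"
    if "\<epsilon> \<in> {0<..\<epsilon>2}" for \<epsilon> x
    using slow_solution_to_x[of \<epsilon> "v \<epsilon>"] v[of \<epsilon>] that by (auto simp: y_def)
  have "closure {(complex_of_real x, complex_of_real (y x \<epsilon>), complex_of_real \<epsilon>) | x \<epsilon>. x \<in> {a..b} \<and> \<epsilon> \<in> {0<..\<epsilon>2}} \<subseteq> U"
  \<comment> \<open>The graphs lie in a product of compact sets inside \<open>U\<close>; the closed
    disc of radius \<epsilon>2 is admissible because \<epsilon>2 itself satisfies \<epsilon>2 <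
    e0.\<close>
  proof -
    define T where "T = (complex_of_real ` {a..b}) \<times> cball (0::complex) \<rho> \<times> cball (0::complex) \<epsilon>2"
    have "closed T" unfolding T_def
      by (intro closed_Times closed_cball compact_imp_closed compact_continuous_image continuous_intros compact_Icc)
    moreover have "{(complex_of_real x, complex_of_real (y x \<epsilon>), complex_of_real \<epsilon>) | x \<epsilon>. x \<in> {a..b} \<and> \<epsilon> \<in> {0<..\<epsilon>2}} \<subseteq> T"
      using bnd by (auto simp: T_def)
    moreover have "T \<subseteq> U"
      using dom v[of \<epsilon>2] \<epsilon>2(1) by (auto simp: T_def)
    ultimately show ?thesis using closure_minimal by blast
  qed
  then have "canard_on \<Omega> f U P {a..b} y"
    unfolding canard_on_def using \<epsilon>2(1) sol bnd by (intro exI[of _ \<epsilon>2] conjI exI[of _ \<rho>]) blast+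
  then show ?thesis by (auto simp: global_canard_def)
qed

lemma real_solution_vector_derivative:
  assumes "real_solution_on \<Omega> f U P \<epsilon> I y" "x \<in> I" "\<epsilon> > 0"
  shows "((\<lambda>x. complex_of_real (y x)) has_vector_derivative
    f (of_real x) / of_real \<epsilon> * of_real (y x) + P (of_real x, of_real (y x), of_real \<epsilon>)) (at x within I)"
proof -
  obtain d where d: "(y has_real_derivative d) (at x within I)"
    "complex_of_real (\<epsilon> * d) = f (of_real x) * of_real (y x) + of_real \<epsilon> * P (of_real x, of_real (y x), of_real \<epsilon>)"
    using assms by (auto simp: real_solution_on_def)
  have "complex_of_real d = complex_of_real (\<epsilon> * d) / of_real \<epsilon>" using assms(3) by simp
  also have "\<dots> = f (of_real x) / of_real \<epsilon> * of_real (y x) + P (of_real x, of_real (y x), of_real \<epsilon>)"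
    unfolding d(2) using assms(3) by (simp add: add_divide_distrib)
  finally show ?thesis
    using has_vector_derivative_of_real[OF d(1), where 'a=complex] by (simp only:)
qed

text \<open>A canard is a priori only bounded. As the equation is attracting towards 0 in the direction
  from the end points of an interval to its interior, it is in fact small in the interior.\<close>

lemma local_canard_small:
  assumes "local_canard \<Omega> f U P y"
  obtains x1 \<epsilon>1 where "0 < x1" "a \<le> - x1" "x1 \<le> b" "0 < \<epsilon>1" "\<epsilon>1 < e0"
    "\<And>\<epsilon>. 0 < \<epsilon> \<Longrightarrow> \<epsilon> < \<epsilon>1 \<Longrightarrow> x_sol \<epsilon> {- x1..x1} (\<lambda>x. of_real (y x \<epsilon>))"
proof -
  obtain l r \<epsilon>c Bd where lr: "l < 0" "0 < r" and \<epsilon>c: "0 < \<epsilon>c"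
    and sol: "\<And>\<epsilon>. \<epsilon> \<in> {0<..\<epsilon>c} \<Longrightarrow> real_solution_on \<Omega> f U P \<epsilon> {l<..<r} (\<lambda>x. y x \<epsilon>)"
    and Bd: "\<And>\<epsilon> x. \<epsilon> \<in> {0<..\<epsilon>c} \<Longrightarrow> x \<in> {l<..<r} \<Longrightarrow> \<bar>y x \<epsilon>\<bar> \<le> Bd"
    and clos: "closure {(complex_of_real x, complex_of_real (y x \<epsilon>), complex_of_real \<epsilon>) | x \<epsilon>.
                  x \<in> {l<..<r} \<and> \<epsilon> \<in> {0<..\<epsilon>c}} \<subseteq> U"
    using assms unfolding local_canard_def canard_on_def by blast
  define T where "T = {(complex_of_real x, complex_of_real (y x \<epsilon>), complex_of_real \<epsilon>) | x \<epsilon>. x \<in> {l<..<r} \<and> \<epsilon> \<in> {0<..\<epsilon>c}}"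
  have "T \<subseteq> cball 0 (max (- l) r) \<times> cball 0 Bd \<times> cball 0 \<epsilon>c"
    using Bd by (force simp: T_def)
  then have "bounded T" using bounded_subset bounded_Times bounded_cball by metis
  \<comment> \<open>The closure condition on canards enters here: the closed graph is a compact part
    of \<open>U\<close>, so \<open>P\<close> is bounded along the canard.\<close>
  then have "compact (P ` closure T)"
    using clos by (intro compact_continuous_image continuous_on_subset[OF P_cont]) (simp_all add: T_def compact_closure)
  then obtain KP where KP: "\<And>q. q \<in> closure T \<Longrightarrow> norm (P q) \<le> KP"
    using compact_imp_bounded bounded_iff by (metis imageI)
  have KP': "norm (P (of_real x, of_real (y x \<epsilon>), of_real \<epsilon>)) \<le> KP" if "x \<in> {l<..<r}" "\<epsilon> \<in> {0<..\<epsilon>c}" for x \<epsilon>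
    by (rule KP, rule subsetD[OF closure_subset]) (use that in \<open>auto simp: T_def\<close>)
  define x2 where "x2 = min (min (- l) r) (min (- a) b) / 2"
  have x2: "0 < x2" "a < - x2" "x2 < b" "l < - x2" "x2 < r"
    using lr ab by (auto simp: x2_def min_def)
  have in_ab: "0 \<in> {a..b}" "x2 \<in> {a..b}" "- x2 \<in> {a..b}" using x2 ab by auto
  have Zpos: "0 < Z x2" "Z (- x2) < 0"
    using Z_mono[OF in_ab(1,2)] Z_mono[OF in_ab(3,1)] Z_0 x2 by auto
  define K2 where "K2 = (A + B) * (\<bar>M\<bar> * \<bar>KP\<bar>)"
  have K2: "K2 \<ge> 0" using pos by (simp add: K2_def)
  \<comment> \<open>The forcing may use up half of \<rho>; the other half is left for the damped end
    value. Adding 1 guards against \<open>K2 = 0\<close>.\<close>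
  define k where "k = \<rho> / 2 / (K2 + 1)"
  have k: "k > 0" "k * K2 \<le> \<rho> / 2" using K2 pos by (auto simp: k_def field_simps)
  have "0 < p" using p2 by simp
  then obtain c' where c': "c' > 0" "\<And>\<sigma> x. \<sigma> \<in> {0..1} \<Longrightarrow> c' \<le> x \<Longrightarrow> integral {\<sigma>..1} (\<lambda>r. exp ((\<sigma> ^ p - r ^ p) * x)) \<le> k"
    using integral_exp_power_small[OF _ k(1)] by blast
  have "((\<lambda>s. exp (- (1 / 2 * s)) * \<bar>Bd\<bar>) \<longlongrightarrow> 0) at_top" by real_asymp
  then have "\<forall>\<^sub>F s in at_top. exp (- (1 / 2 * s)) * \<bar>Bd\<bar> < \<rho> / 2" by (rule order_tendstoD) (use pos in simp)
  then obtain s1 where s1: "\<And>s. s \<ge> s1 \<Longrightarrow> exp (- (1 / 2 * s)) * \<bar>Bd\<bar> < \<rho> / 2"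
    by (auto simp: eventually_at_top_linorder)
  define s2 where "s2 = max 1 (max c' s1)"
  \<comment> \<open>For z up to half the end of the ray one has 1 - \<sigma>^p \<ge> 1/2, so the a
    priori bound \<open>Bd\<close> at the end is damped by exp(-s/2). The points \<open>x3\<close>
    and \<open>x4\<close> below mark this half in the variable x.\<close>
  have one_side: "\<bar>y x \<epsilon>\<bar> \<le> \<rho>"
    if \<tau>: "\<tau> = Z x2 \<or> \<tau> = Z (- x2)" and \<epsilon>: "\<epsilon> \<in> {0<..\<epsilon>c}" "s2 \<le> \<tau> ^ p / \<epsilon>"
      and x: "x \<in> {- x2..x2}" "Z x / \<tau> \<in> {0..1/2}" for \<tau> \<epsilon> x
  proof -
    have \<tau>nz: "\<tau> \<noteq> 0" using \<tau> Zpos by auto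
    have \<tau>r: "- A < \<tau>" "\<tau> < B" using \<tau> Z_range[OF in_ab(2)] Z_range[OF in_ab(3)] by auto
    have xab: "x \<in> {a..b}" using x x2 by auto
    have \<epsilon>0: "\<epsilon> > 0" using \<epsilon> by simp
    have seg: "\<tau> * \<sigma> \<in> {Z (- x2)..Z x2}" if "\<sigma> \<in> {0..1}" for \<sigma>
    proof -
      have "(1 - \<sigma>) *\<^sub>R 0 + \<sigma> *\<^sub>R \<tau> \<in> {Z (- x2)..Z x2}"
        using that \<tau> Zpos by (intro convexD_alt convex_real_interval) auto
      then show ?thesis by (simp add: mult.commute)
    qed
    define v where "v = (\<lambda>z. complex_of_real (y (X z) \<epsilon>))"
    define Pv where "Pv = (\<lambda>z. P (of_real (X z), v z, of_real \<epsilon>))"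
    define w where "w = (\<lambda>\<sigma>. v (\<tau> * \<sigma>))"
    define q where "q = (\<lambda>\<sigma>. of_real (\<tau> * X' (\<tau> * \<sigma>)) * Pv (\<tau> * \<sigma>))"
    have Xin: "X z \<in> {- x2..x2}" "X z \<in> {l<..<r}" if "z \<in> {Z (- x2)..Z x2}" for z
      using X_in(1)[OF in_ab(3,2) that] x2 by auto
    have w': "(w has_vector_derivative of_real (\<tau> ^ p / \<epsilon> * (real p * \<sigma> ^ (p - 1))) * w \<sigma> + q \<sigma>) (at \<sigma> within {0..1})"
      if \<sigma>: "\<sigma> \<in> {0..1}" for \<sigma>
    proof -
      define z where "z = \<tau> * \<sigma>"
      have z: "z \<in> {Z (- x2)..Z x2}" using seg[OF \<sigma>] by (simp add: z_def)
      have "((\<lambda>x. complex_of_real (y x \<epsilon>)) has_vector_derivative f (of_real (X z)) / of_real \<epsilon> * of_real (y (X z) \<epsilon>) + Pv z) (at (X z) within {- x2..x2})"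
        unfolding Pv_def v_def
        by (rule has_vector_derivative_within_subset[OF real_solution_vector_derivative[OF sol[OF \<epsilon>(1)] Xin(2)[OF z] \<epsilon>0]])
          (use x2 in auto)
      from x_deriv_to_z[OF in_ab(3,2) z this]
      have vd: "(v has_vector_derivative of_real (real p * z ^ (p - 1) / \<epsilon>) * v z + of_real (X' z) * Pv z) (at z within {Z (- x2)..Z x2})"
        unfolding v_def .
      have "((\<lambda>\<sigma>. \<tau> * \<sigma>) has_vector_derivative \<tau>) (at \<sigma> within {0..1})"
        by (auto intro!: derivative_eq_intros simp flip: has_real_derivative_iff_has_vector_derivative)
      moreover have "(v has_vector_derivative of_real (real p * z ^ (p - 1) / \<epsilon>) * v z + of_real (X' z) * Pv z)
          (at (\<tau> * \<sigma>) within (\<lambda>\<sigma>. \<tau> * \<sigma>) ` {0..1})"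
        using has_vector_derivative_within_subset[OF vd] seg unfolding z_def by blast
      ultimately have "(v \<circ> (\<lambda>\<sigma>. \<tau> * \<sigma>) has_vector_derivative \<tau> *\<^sub>R (of_real (real p * z ^ (p - 1) / \<epsilon>) * v z + of_real (X' z) * Pv z)) (at \<sigma> within {0..1})"
        by (rule vector_diff_chain_within)
      then have "(w has_vector_derivative \<tau> *\<^sub>R (of_real (real p * z ^ (p - 1) / \<epsilon>) * v z + of_real (X' z) * Pv z)) (at \<sigma> within {0..1})"
        unfolding o_def w_def .
      moreover have "\<tau> *\<^sub>R (of_real (real p * z ^ (p - 1) / \<epsilon>) * v z + of_real (X' z) * Pv z)
          = of_real (\<tau> ^ p / \<epsilon> * (real p * \<sigma> ^ (p - 1))) * w \<sigma> + q \<sigma>"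
      proof -
        have "\<tau> ^ p = \<tau> * \<tau> ^ (p - 1)" using p2 by (simp flip: power_Suc)
        then have "\<tau> * (real p * z ^ (p - 1) / \<epsilon>) = \<tau> ^ p / \<epsilon> * (real p * \<sigma> ^ (p - 1))"
          by (simp add: z_def power_mult_distrib)
        then have "complex_of_real \<tau> * of_real (real p * z ^ (p - 1) / \<epsilon>) = of_real (\<tau> ^ p / \<epsilon> * (real p * \<sigma> ^ (p - 1)))"
          by (metis of_real_mult)
        moreover have "complex_of_real \<tau> * of_real (X' z) = of_real (\<tau> * X' z)" by simp
        ultimately show ?thesis
          unfolding scaleR_conv_of_real distrib_left mult.assoc[symmetric] w_def q_def z_def by (simp only:)
      qed
      ultimately show ?thesis by simp
    qed
    have q_bd: "norm (q \<sigma>) \<le> K2" if \<sigma>: "\<sigma> \<in> {0..1}" for \<sigma>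
    proof -
      note z = seg[OF \<sigma>]
      have "norm (Pv (\<tau> * \<sigma>)) \<le> \<bar>KP\<bar>"
        unfolding Pv_def v_def using KP'[OF Xin(2)[OF z] \<epsilon>(1)] by linarith
      moreover have "\<tau> * \<sigma> \<in> {- A<..<B}" using z Z_range[OF in_ab(2)] Z_range[OF in_ab(3)] by auto
      then have "\<bar>X' (\<tau> * \<sigma>)\<bar> \<le> \<bar>M\<bar>" using X'_bound[of "\<tau> * \<sigma>"] by linarith
      moreover have "\<bar>\<tau>\<bar> \<le> A + B" using \<tau>r pos by auto
      ultimately have "\<bar>\<tau>\<bar> * (\<bar>X' (\<tau> * \<sigma>)\<bar> * norm (Pv (\<tau> * \<sigma>))) \<le> K2"
        unfolding K2_def using pos by (intro mult_mono) auto
      then show ?thesis by (simp add: q_def norm_mult abs_mult mult.assoc)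
    qed
    define \<sigma> where "\<sigma> = Z x / \<tau>"
    have "\<sigma> \<in> {0..1/2}" using x(2) unfolding \<sigma>_def .
    then have \<sigma>: "\<sigma> \<in> {0..1}" "\<sigma> \<le> 1 / 2" by auto
    have s: "s2 \<le> \<tau> ^ p / \<epsilon>" "c' \<le> \<tau> ^ p / \<epsilon>" "s1 \<le> \<tau> ^ p / \<epsilon>" "0 \<le> \<tau> ^ p / \<epsilon>"
      using \<epsilon>(2) by (auto simp: s2_def)
    have "norm (w 1) \<le> \<bar>Bd\<bar>"
      using Bd[OF \<epsilon>(1) Xin(2)[OF seg[of 1]]] by (simp add: w_def v_def)
    then have "norm (w \<sigma>) \<le> exp (- ((1 - \<sigma> ^ p) * (\<tau> ^ p / \<epsilon>))) * \<bar>Bd\<bar> + k * K2"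
      by (intro damped_bound[OF w' q_bd _ c'(2)[OF \<sigma>(1) s(2)] K2 \<sigma>(1)])
    also have "\<dots> \<le> exp (- (1 / 2 * (\<tau> ^ p / \<epsilon>))) * \<bar>Bd\<bar> + k * K2"
    proof -
      have "\<sigma> ^ p \<le> \<sigma> ^ 1" using \<sigma> p2 by (intro power_decreasing) auto
      then have "1 / 2 \<le> 1 - \<sigma> ^ p" using \<sigma> by simp
      then have "1 / 2 * (\<tau> ^ p / \<epsilon>) \<le> (1 - \<sigma> ^ p) * (\<tau> ^ p / \<epsilon>)" using s(4) by (rule mult_right_mono)
      then show ?thesis by (intro add_right_mono mult_right_mono) auto
    qed
    also have "\<dots> \<le> \<rho>" using s1[OF s(3)] k(2) by linarith
    finally show ?thesis using XZ[OF xab] \<tau>nz by (simp add: w_def v_def \<sigma>_def)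
  qed
  obtain x3 where x3: "x3 \<in> {0..x2}" "Z x3 = Z x2 / 2"
    using Z_surj[OF in_ab(1,2), of "Z x2 / 2"] Zpos Z_0 by auto
  obtain x4 where x4: "x4 \<in> {- x2..0}" "Z x4 = Z (- x2) / 2"
    using Z_surj[OF in_ab(3,1), of "Z (- x2) / 2"] Zpos Z_0 by auto
  have x34: "x3 > 0" "x4 < 0" using x3 x4 Zpos Z_0 by (auto simp: order_le_less)
  define x1 where "x1 = min x3 (- x4)"
  have x1: "0 < x1" "x1 \<le> x2" "x1 \<le> x3" "x4 \<le> - x1" using x3 x4 x34 by (auto simp: x1_def)
  define \<epsilon>1 where "\<epsilon>1 = min (min \<epsilon>c (e0 / 2)) (min (Z x2 ^ p / s2) (Z (- x2) ^ p / s2))"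
  have s2: "s2 > 0" by (simp add: s2_def)
  have Zp: "Z x2 ^ p > 0" "Z (- x2) ^ p > 0" using Zpos p_even by (simp_all add: zero_less_power_eq)
  show ?thesis
  proof (rule that[of x1 \<epsilon>1])
    show "0 < \<epsilon>1" using Zp s2 \<epsilon>c pos by (simp add: \<epsilon>1_def)
    have "\<epsilon>1 \<le> e0 / 2" unfolding \<epsilon>1_def by linarith
    then show "\<epsilon>1 < e0" using pos(5) by linarith
    fix \<epsilon> :: real assume \<epsilon>: "0 < \<epsilon>" "\<epsilon> < \<epsilon>1"
    then have \<epsilon>': "\<epsilon> \<in> {0<..\<epsilon>c}" "s2 \<le> Z x2 ^ p / \<epsilon>" "s2 \<le> Z (- x2) ^ p / \<epsilon>"
      using s2 by (auto simp: \<epsilon>1_def field_simps)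
    show "x_sol \<epsilon> {- x1..x1} (\<lambda>x. of_real (y x \<epsilon>))"
      unfolding x_sol_def
    proof (intro ballI conjI)
      fix x assume x: "x \<in> {- x1..x1}"
      have xab: "x \<in> {a..b}" "x \<in> {- x2..x2}" "x \<in> {l<..<r}" using x x1 x2 by auto
      have "\<bar>y x \<epsilon>\<bar> \<le> \<rho>"
      proof (cases "x \<ge> 0")
        case True
        have "Z x \<le> Z x3" by (rule Z_le[OF xab(1)]) (use x x1 x3 x2 in auto)
        then show ?thesis
          using one_side[of "Z x2" \<epsilon> x] \<epsilon>' xab Z_sign(1)[OF xab(1) True] Zpos x3 by (simp add: field_simps)
      next
        case False
        have "Z x4 \<le> Z x" by (rule Z_le[OF _ xab(1)]) (use x x1 x4 x2 in auto)
        then show ?thesis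
          using one_side[of "Z (- x2)" \<epsilon> x] \<epsilon>' xab Z_sign(2)[OF xab(1)] Zpos x4 False by (simp add: field_simps)
      qed
      then show "norm (complex_of_real (y x \<epsilon>)) \<le> \<rho>" by simp
      show "((\<lambda>x. complex_of_real (y x \<epsilon>)) has_vector_derivative
          f (of_real x) / of_real \<epsilon> * of_real (y x \<epsilon>) + P (of_real x, of_real (y x \<epsilon>), of_real \<epsilon>)) (at x within {- x1..x1})"
        by (rule has_vector_derivative_within_subset[OF real_solution_vector_derivative[OF sol[OF \<epsilon>'(1)] xab(3) \<epsilon>(1)]])
          (use x1 x2 in auto)
    qed
  qed (use x1 x2 in auto)
qed

text \<open>The canard \<open>Y\<close> exists on both sides and links the two solutions:
  \<open>Y1\<close> is compared with it from x1, \<open>Y2\<close> from -x1. The evaluation point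
  \<xi> may lie to the right of 0 and costs the factor exp(Z \<xi>^p / \<epsilon>), which stays
  bounded when \<xi> is of the order of \<eta>.\<close>

lemma canard_compare:
  assumes x1: "0 < x1" "a \<le> - x1" "x1 \<le> b"
  obtains \<alpha> where "0 < \<alpha>"
    "\<And>\<epsilon> \<xi> Y Y1 Y2. 0 < \<epsilon> \<Longrightarrow> \<epsilon> < e0 \<Longrightarrow> 0 \<le> \<xi> \<Longrightarrow> \<xi> \<le> x1 \<Longrightarrow> x_sol \<epsilon> {- x1..x1} Y \<Longrightarrow>
      x_sol \<epsilon> {0..x1} Y1 \<Longrightarrow> x_sol \<epsilon> {- x1..\<xi>} Y2 \<Longrightarrow>
      norm (Y1 \<xi> - Y2 \<xi>) \<le> exp (Z \<xi> ^ p / \<epsilon> - \<alpha> / \<epsilon>) * (4 * \<rho> * exp (L * (A + B)))"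
proof -
  have in_ab: "0 \<in> {a..b}" "x1 \<in> {a..b}" "- x1 \<in> {a..b}" using x1 ab by auto
  have Zpos: "0 < Z x1" "Z (- x1) < 0"
    using Z_mono[OF in_ab(1,2)] Z_mono[OF in_ab(3,1)] Z_0 x1 by auto
  define \<alpha> where "\<alpha> = min (Z x1 ^ p) (Z (- x1) ^ p)"
  have "Z (- x1) ^ p > 0" using Zpos p_even by (simp add: zero_less_power_eq)
  then have \<alpha>: "0 < \<alpha>" using Zpos by (simp add: \<alpha>_def)
  show ?thesis
  proof (rule that[OF \<alpha>])
    fix \<epsilon> \<xi> :: real and Y Y1 Y2
    assume \<epsilon>: "0 < \<epsilon>" "\<epsilon> < e0" and \<xi>: "0 \<le> \<xi>" "\<xi> \<le> x1"
      and Y: "x_sol \<epsilon> {- x1..x1} Y" "x_sol \<epsilon> {0..x1} Y1" "x_sol \<epsilon> {- x1..\<xi>} Y2"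
    have \<xi>ab: "\<xi> \<in> {a..b}" using \<xi> x1 ab by auto
    define \<zeta> where "\<zeta> = Z \<xi>"
    have X\<zeta>: "X \<zeta> = \<xi>" using XZ[OF \<xi>ab] by (simp add: \<zeta>_def)
    have \<zeta>: "0 \<le> \<zeta>" "\<zeta> \<le> Z x1" using Z_sign(1)[OF \<xi>ab \<xi>(1)] Z_le[OF \<xi>ab in_ab(2) \<xi>(2)] by (auto simp: \<zeta>_def)
    note rg = Z_range[OF in_ab(2)] Z_range[OF in_ab(3)] Z_range[OF \<xi>ab]
    have D: "of_real \<zeta> \<in> D" "of_real (Z x1) \<in> D" "of_real (Z (- x1)) \<in> D"
      using rg pos by (simp_all add: \<zeta>_def)
    have s: "slow_solution \<epsilon> {Z (- x1)..Z x1} (\<lambda>z. Y (X z))" "slow_solution \<epsilon> {0..Z x1} (\<lambda>z. Y1 (X z))"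
      "slow_solution \<epsilon> {Z (- x1)..\<zeta>} (\<lambda>z. Y2 (X z))"
      using x_sol_to_z[OF Y(1) in_ab(3,2) \<epsilon>] x_sol_to_z[OF Y(2) in_ab(1,2) \<epsilon>] x_sol_to_z[OF Y(3) in_ab(3) \<xi>ab \<epsilon>]
      by (simp_all add: Z_0 \<zeta>_def)
    have main: "norm (v1 \<zeta> - v2 \<zeta>) \<le> exp (\<zeta> ^ p / \<epsilon> - \<alpha> / \<epsilon>) * (2 * \<rho> * exp (L * (A + B)))"
      if v: "slow_solution \<epsilon> (closed_segment \<zeta> w) v1" "slow_solution \<epsilon> (closed_segment \<zeta> w) v2"
        and w: "of_real w \<in> D" "\<alpha> \<le> w ^ p" for v1 v2 w
    proof -
      have "norm (v1 \<zeta> - v2 \<zeta>) \<le> exp ((\<zeta> ^ p - w ^ p) / \<epsilon> + L * \<bar>w - \<zeta>\<bar>) * norm (v1 w - v2 w)"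
        by (rule slow_solution_compare[OF v D(1) w(1) \<epsilon>])
      also have "\<dots> \<le> exp ((\<zeta> ^ p / \<epsilon> - \<alpha> / \<epsilon>) + L * (A + B)) * (2 * \<rho>)"
      proof (rule mult_mono)
        have "(\<zeta> ^ p - w ^ p) / \<epsilon> \<le> \<zeta> ^ p / \<epsilon> - \<alpha> / \<epsilon>"
          using w(2) \<epsilon>(1) by (simp add: divide_right_mono flip: diff_divide_distrib)
        moreover have "L * \<bar>w - \<zeta>\<bar> \<le> L * (A + B)"
          using w(1) D(1) pos by (intro mult_left_mono) auto
        ultimately show "exp ((\<zeta> ^ p - w ^ p) / \<epsilon> + L * \<bar>w - \<zeta>\<bar>) \<le> exp ((\<zeta> ^ p / \<epsilon> - \<alpha> / \<epsilon>) + L * (A + B))" by simp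
        have "norm (v1 w) \<le> \<rho>" "norm (v2 w) \<le> \<rho>" using v by (auto simp: slow_solution_def)
        then show "norm (v1 w - v2 w) \<le> 2 * \<rho>" using norm_triangle_ineq4[of "v1 w" "v2 w"] by simp
      qed auto
      finally show ?thesis by (simp add: exp_add mult_ac)
    qed
    have "norm (Y1 (X \<zeta>) - Y (X \<zeta>)) \<le> exp (\<zeta> ^ p / \<epsilon> - \<alpha> / \<epsilon>) * (2 * \<rho> * exp (L * (A + B)))"
      by (rule main[of "Z x1" "\<lambda>z. Y1 (X z)" "\<lambda>z. Y (X z)"])
        (use D(2) \<zeta> Zpos in \<open>auto intro!: slow_solution_subset[OF s(1)] slow_solution_subset[OF s(2)] simp: closed_segment_eq_real_ivl \<alpha>_def\<close>)
    moreover have "norm (Y (X \<zeta>) - Y2 (X \<zeta>)) \<le> exp (\<zeta> ^ p / \<epsilon> - \<alpha> / \<epsilon>) * (2 * \<rho> * exp (L * (A + B)))"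
      by (rule main[of "Z (- x1)" "\<lambda>z. Y (X z)" "\<lambda>z. Y2 (X z)"])
        (use D(3) \<zeta> Zpos in \<open>auto intro!: slow_solution_subset[OF s(1)] slow_solution_subset[OF s(3)] simp: closed_segment_eq_real_ivl \<alpha>_def\<close>)
    moreover have "exp (\<zeta> ^ p / \<epsilon> - \<alpha> / \<epsilon>) * (4 * \<rho> * exp (L * (A + B)))
        = exp (\<zeta> ^ p / \<epsilon> - \<alpha> / \<epsilon>) * (2 * \<rho> * exp (L * (A + B))) + exp (\<zeta> ^ p / \<epsilon> - \<alpha> / \<epsilon>) * (2 * \<rho> * exp (L * (A + B)))"
      by simp
    ultimately show "norm (Y1 \<xi> - Y2 \<xi>) \<le> exp (Z \<xi> ^ p / \<epsilon> - \<alpha> / \<epsilon>) * (4 * \<rho> * exp (L * (A + B)))"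
      using norm_triangle_ineq[of "Y1 \<xi> - Y \<xi>" "Y \<xi> - Y2 \<xi>"] unfolding X\<zeta> \<zeta>_def[symmetric] by simp
  qed
qed

end

section \<open>Reduction to normal form\<close>

lemma holomorphic3_on_compose:
  assumes P: "holomorphic3_on P U" and S: "open S"
    and hol: "g holomorphic_on S" "v holomorphic_on S" "e holomorphic_on S"
    and sub: "\<And>t. t \<in> S \<Longrightarrow> (g t, v t, e t) \<in> U"
  shows "(\<lambda>t. P (g t, v t, e t)) holomorphic_on S"
  unfolding holomorphic_on_def
proof
  fix t assume t: "t \<in> S"
  obtain g' v' e' where d: "(g has_field_derivative g') (at t within S)" "(v has_field_derivative v') (at t within S)"
    "(e has_field_derivative e') (at t within S)"
    using hol t unfolding holomorphic_on_def field_differentiable_def by blast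
  obtain A B C where P': "(P has_derivative (\<lambda>(h, k, l). A * h + B * k + C * l)) (at (g t, v t, e t) within U)"
    using P sub[OF t] unfolding holomorphic3_on_def by blast
  have "((\<lambda>t. (g t, v t, e t)) has_derivative (\<lambda>h. (g' * h, v' * h, e' * h))) (at t within S)"
    using d unfolding has_field_derivative_def by (intro has_derivative_Pair)
  then have "((P \<circ> (\<lambda>t. (g t, v t, e t))) has_derivative
      ((\<lambda>(h, k, l). A * h + B * k + C * l) \<circ> (\<lambda>h. (g' * h, v' * h, e' * h)))) (at t within S)"
    by (rule diff_chain_within) (rule has_derivative_subset[OF P'], use sub in auto)
  then have "((\<lambda>t. P (g t, v t, e t)) has_derivative (\<lambda>h. (A * g' + B * v' + C * e') * h)) (at t within S)"
    by (simp add: o_def algebra_simps)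
  then have "((\<lambda>t. P (g t, v t, e t)) has_field_derivative (A * g' + B * v' + C * e')) (at t within S)"
    by (simp add: has_field_derivative_def)
  then show "(\<lambda>t. P (g t, v t, e t)) field_differentiable at t within S"
    by (auto simp: field_differentiable_def)
qed

lemma holomorphic3_on_imp_continuous_on: "holomorphic3_on P U \<Longrightarrow> continuous_on U P"
  unfolding holomorphic3_on_def continuous_on_eq_continuous_within
  using has_derivative_continuous by blast

text \<open>Cauchy's inequality on circles of radius \<rho>/2, which stay in the ball of radius 2
  \<rho>. It turns a bound for \<open>P\<close> on the larger ball into the Lipschitz constant of
  the normal form.\<close>

lemma bounded_holomorphic_lipschitz:
  fixes f :: "complex \<Rightarrow> complex"
  assumes hol: "f holomorphic_on ball 0 (2 * \<rho>)" and bnd: "\<And>y. norm y < 2 * \<rho> \<Longrightarrow> norm (f y) \<le> K"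
    and \<rho>: "0 < \<rho>" and y: "norm y \<le> \<rho>" "norm y' \<le> \<rho>"
  shows "norm (f y - f y') \<le> 2 * K / \<rho> * norm (y - y')"
proof (rule field_differentiable_bound[of "cball 0 \<rho>" f "deriv f"])
  fix w :: complex assume w: "w \<in> cball 0 \<rho>"
  have sub: "norm v < 2 * \<rho>" if "v \<in> cball w (\<rho> / 2)" for v
  proof -
    have "norm v \<le> norm w + dist w v" using norm_triangle_ineq2[of v w] by (simp add: dist_norm norm_minus_commute)
    then show ?thesis using w that \<rho> by simp
  qed
  have "w \<in> ball 0 (2 * \<rho>)" using w \<rho> by auto
  then show "(f has_field_derivative deriv f w) (at w within cball 0 \<rho>)"
    using holomorphic_derivI[OF hol open_ball] by blast
  have "norm ((deriv ^^ 1) f w) \<le> fact 1 * K / (\<rho> / 2) ^ 1"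
  proof (rule Cauchy_inequality)
    show "f holomorphic_on ball w (\<rho> / 2)"
      by (rule holomorphic_on_subset[OF hol]) (use sub in auto)
    show "continuous_on (cball w (\<rho> / 2)) f"
      by (rule holomorphic_on_imp_continuous_on[OF holomorphic_on_subset[OF hol]]) (use sub in auto)
    show "norm (f v) \<le> K" if "norm (w - v) = \<rho> / 2" for v
      by (rule bnd[OF sub]) (use that in \<open>simp add: dist_norm\<close>)
  qed (use \<rho> in simp)
  then show "norm (deriv f w) \<le> 2 * K / \<rho>" by (simp add: mult.commute)
qed (use y in auto)

text \<open>Since f X' = p z^(p-1), the change of variables gives \<open>R\<close> as \<phi>' times
  \<open>P\<close>. The constants depend on each other in this order: a larger interval, a
  neighbourhood of it in \<open>U\<close> (which fixes \<rho>, \<open>e0\<close> and the bound of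
  \<open>P\<close>), the height of the strip, then \<open>K\<close>, \<open>L\<close>, \<kappa>, and
  finally \<open>c\<close>.\<close>

lemma normalized_equation_exists:
  fixes a b :: real and p :: nat
  assumes ab: "a < 0" "0 < b" and p: "even p" "2 \<le> p"
    and \<Omega>: "open \<Omega>" "complex_of_real ` {a..b} \<subseteq> \<Omega>" and f: "f holomorphic_on \<Omega>"
    and f_real: "\<And>x. complex_of_real x \<in> \<Omega> \<Longrightarrow> f (of_real x) \<in> \<real>"
    and f_sign: "\<And>x. x \<in> {a..b} - {0} \<Longrightarrow> x * Re (f (complex_of_real x)) > 0"
    and f_0: "\<exists>h. h \<in> O[at 0](\<lambda>x::complex. x) \<and>
      (\<forall>\<^sub>F x in at 0. f x = of_nat p * x ^ (p - 1) * (1 + h x))"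
    and U: "open U" "(complex_of_real ` {a..b}) \<times> {0} \<times> {0} \<subseteq> U" and P: "holomorphic3_on P U"
    and P_real: "\<And>x y \<epsilon>. \<lbrakk>x \<in> \<real>; y \<in> \<real>; \<epsilon> \<in> \<real>; (x, y, \<epsilon>) \<in> U\<rbrakk> \<Longrightarrow> P (x, y, \<epsilon>) \<in> \<real>"
  obtains R A B h \<rho> e0 K L c \<kappa> X X' Z Z' M where
    "normalized_equation p R A B h \<rho> e0 K L c \<kappa> \<Omega> f U P a b X X' Z Z' M"
proof -
  obtain A1 B1 k1 \<psi> where n: "- A1 < a" "b < B1" "0 < k1" "strip A1 B1 k1 \<subseteq> \<Omega>" "\<psi> holomorphic_on strip A1 B1 k1"
    "inj_on \<psi> (strip A1 B1 k1)" "\<psi> 0 = 0"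
    "\<And>x. x \<in> strip A1 B1 k1 \<Longrightarrow> of_nat p * \<psi> x ^ (p - 1) * deriv \<psi> x = f x"
    "\<And>x. complex_of_real x \<in> strip A1 B1 k1 \<Longrightarrow> \<psi> (of_real x) \<in> \<real>"
    "\<And>x. complex_of_real x \<in> strip A1 B1 k1 \<Longrightarrow> Re (deriv \<psi> (of_real x)) > 0"
    using normalizing_coordinate[OF ab p \<Omega> f f_real f_sign f_0] by blast
  define S1 where "S1 = strip A1 B1 k1"
  have S1: "open S1" unfolding S1_def by (rule open_strip)
  have hol\<psi>: "\<psi> holomorphic_on S1" and inj\<psi>: "inj_on \<psi> S1" using n(5,6) by (auto simp: S1_def)
  obtain \<phi> where \<phi>: "\<phi> holomorphic_on (\<psi> ` S1)" "\<And>x. x \<in> S1 \<Longrightarrow> deriv \<psi> x * deriv \<phi> (\<psi> x) = 1"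
    "\<And>x. x \<in> S1 \<Longrightarrow> \<phi> (\<psi> x) = x"
    using holomorphic_has_inverse[OF hol\<psi> S1 inj\<psi>] by blast
  have W1: "open (\<psi> ` S1)" by (rule open_mapping_thm3[OF hol\<psi> S1 inj\<psi>])
  define Gx where "Gx = {- A1<..<B1} \<inter> {x. complex_of_real x \<in> (\<lambda>w. (w, 0, 0)) -` U}"
  have "open ((\<lambda>w::complex. (w, 0::complex, 0::complex)) -` U)"
    by (rule open_vimage[OF U(1)]) (intro continuous_intros)
  then have "open Gx" unfolding Gx_def by (intro open_Int open_real_trace) auto
  moreover have "{a..b} \<subseteq> Gx" using n(1,2) U(2) by (auto simp: Gx_def)
  \<comment> \<open>The strictly larger interval makes - A < Z x < B strict on [a, b]; the matching
    at 0 uses up this room.\<close>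
  ultimately obtain a2 b2 where ab2: "a2 < a" "b < b2" "{a2..b2} \<subseteq> Gx"
    using extend_interval[of Gx a b] ab by auto
  have inS1: "complex_of_real x \<in> S1" if "x \<in> {a2..b2}" for x
    using that ab2(3) n(3) by (auto simp: S1_def Gx_def)
  define Kx where "Kx = complex_of_real ` {a2..b2}"
  define KU where "KU = Kx \<times> {0::complex} \<times> {0::complex}"
  have cK: "compact Kx" unfolding Kx_def by (intro compact_continuous_image continuous_intros compact_Icc)
  have "compact KU" unfolding KU_def by (intro compact_Times cK) auto
  moreover have "KU \<subseteq> U" using ab2(3) by (auto simp: KU_def Kx_def Gx_def)
  ultimately obtain r where r: "0 < r" "(\<Union>q\<in>KU. cball q r) \<subseteq> U"
    using compact_subset_open_imp_cball_epsilon_subset U(1) by metis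
  have contP: "continuous_on U P" by (rule holomorphic3_on_imp_continuous_on[OF P])
  have "compact (P ` (\<Union>q\<in>KU. cball q r))"
    by (intro compact_continuous_image continuous_on_subset[OF contP r(2)] compact_minkowski_sum_cball \<open>compact KU\<close>)
  then obtain KP where KP: "\<And>q. q \<in> (\<Union>q\<in>KU. cball q r) \<Longrightarrow> norm (P q) \<le> KP"
    using compact_imp_bounded bounded_iff by (metis imageI)
  \<comment> \<open>The radius r is shared equally by the three variables: r/3 for x, 2 \<rho> = r/3
    for y and \<open>e0\<close> = r/3 for \<epsilon>.\<close>
  define \<rho> where "\<rho> = r / 6"
  define e0 where "e0 = r / 3"
  have \<rho>: "0 < \<rho>" "2 * \<rho> = r / 3" "0 < e0" using r by (auto simp: \<rho>_def e0_def)
  define Nr where "Nr = (\<Union>x\<in>Kx. ball x (r / 3))"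
  have near: "(w, y, e) \<in> (\<Union>q\<in>KU. cball q r)" if "w \<in> Nr" "norm y < 2 * \<rho>" "norm e < e0" for w y e :: complex
  proof -
    obtain x where x: "x \<in> Kx" "dist x w < r / 3" using \<open>w \<in> Nr\<close> by (auto simp: Nr_def)
    have "dist (x, 0, 0) (w, y, e) = norm (x - w, - y, - e)" by (simp add: dist_norm)
    also have "\<dots> \<le> norm (x - w) + (norm (- y) + norm (- e))"
      using norm_Pair_le[of "x - w" "(- y, - e)"] norm_Pair_le[of "- y" "- e"] by linarith
    also have "\<dots> \<le> r" using x that \<rho> by (simp add: dist_norm e0_def)
    finally show ?thesis using x(1) by (force simp: KU_def)
  qed
  have nearU: "(w, y, e) \<in> U" and nearP: "norm (P (w, y, e)) \<le> KP"
    if "w \<in> Nr" "norm y < 2 * \<rho>" "norm e < e0" for w y e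
    using near[OF that] r(2) KP by blast+
  have KP0: "0 \<le> KP"
  proof -
    have "complex_of_real a2 \<in> Kx" using ab2 ab by (auto simp: Kx_def)
    then have "complex_of_real a2 \<in> Nr" using r by (force simp: Nr_def)
    then show ?thesis using nearP[of "of_real a2" 0 0] \<rho> norm_ge_zero order_trans by (metis norm_zero mult_pos_pos zero_less_numeral)
  qed
  define Z where "Z = (\<lambda>x. Re (\<psi> (complex_of_real x)))"
  define Z' where "Z' = (\<lambda>x. Re (deriv \<psi> (complex_of_real x)))"
  have \<psi>r: "\<psi> (of_real x) \<in> \<real>" if "complex_of_real x \<in> S1" for x using n(9) that by (simp add: S1_def)
  have \<psi>Z: "\<psi> (of_real x) = of_real (Z x)" if "x \<in> {a2..b2}" for x using \<psi>r[OF inS1[OF that]] by (simp add: Z_def)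
  have Zd: "(Z has_real_derivative Z' x) (at x)" and \<psi>'Z: "deriv \<psi> (of_real x) = of_real (Z' x)" if "x \<in> {a2..b2}" for x
    using real_on_reals_deriv[OF S1 hol\<psi> \<psi>r inS1[OF that]] by (simp_all add: Z_def[abs_def] Z'_def)
  have Z'pos: "Z' x > 0" if "x \<in> {a2..b2}" for x using n(10)[of x] inS1[OF that] by (simp add: Z'_def S1_def)
  have Zmono: "Z x < Z y" if "x \<in> {a2..b2}" "y \<in> {a2..b2}" "x < y" for x y
    by (rule DERIV_pos_imp_increasing[OF that(3)]) (use Zd Z'pos that in \<open>meson atLeastAtMost_iff order_trans\<close>)
  have Z0: "Z 0 = 0" by (simp add: Z_def n(7))
  define A where "A = - Z a2"
  define B where "B = Z b2"
  have AB: "0 < A" "0 < B" using Zmono[of a2 0] Zmono[of 0 b2] ab ab2 Z0 by (auto simp: A_def B_def)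
  have surj: "\<exists>x\<in>{a2..b2}. Z x = z" if "z \<in> {- A..B}" for z
  proof -
    have "continuous_on {a2..b2} Z"
      using Zd by (meson DERIV_continuous_on has_field_derivative_at_within)
    then show ?thesis using IVT'[of Z a2 z b2] that ab ab2 by (auto simp: A_def B_def)
  qed
  define Kz where "Kz = complex_of_real ` {- A..B}"
  have cKz: "compact Kz" unfolding Kz_def by (intro compact_continuous_image continuous_intros compact_Icc)
  have KzW: "Kz \<subseteq> \<psi> ` S1"
  proof
    fix z assume "z \<in> Kz"
    then obtain t where "t \<in> {- A..B}" "z = of_real t" by (auto simp: Kz_def)
    then obtain x where "x \<in> {a2..b2}" "Z x = t" "z = of_real t" using surj by blast
    then show "z \<in> \<psi> ` S1" using \<psi>Z[of x] inS1[of x] by (intro image_eqI[of _ _ "of_real x"]) simp_all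
  qed
  have \<phi>Kz: "\<phi> (of_real z) \<in> Kx" if z: "z \<in> {- A..B}" for z
  proof -
    obtain x where "x \<in> {a2..b2}" "Z x = z" using surj[OF z] by blast
    then show ?thesis using \<phi>(3)[OF inS1, of x] \<psi>Z[of x] by (auto simp: Kx_def)
  qed
  have hol\<phi>': "deriv \<phi> holomorphic_on (\<psi> ` S1)" by (rule holomorphic_deriv[OF \<phi>(1) W1])
  have "compact (deriv \<phi> ` Kz)"
    by (intro compact_continuous_image cKz holomorphic_on_imp_continuous_on holomorphic_on_subset[OF hol\<phi>' KzW])
  then obtain M0 where M0: "\<And>z. z \<in> Kz \<Longrightarrow> norm (deriv \<phi> z) \<le> M0"
    using compact_imp_bounded bounded_iff by (metis imageI)
  define M where "M = M0 + 1"
  \<comment> \<open>With M = M0 + 1 the bound for \<phi>' is strict on the compact real interval, so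
    it is an open condition and holds on a strip; likewise the nearness of \<phi> to
    \<open>Kx\<close>.\<close>
  define G where "G = (\<psi> ` S1 \<inter> \<phi> -` Nr) \<inter> (\<psi> ` S1 \<inter> deriv \<phi> -` ball 0 M)"
  have opG: "open G" unfolding G_def
    by (intro open_Int continuous_open_preimage holomorphic_on_imp_continuous_on \<phi>(1) hol\<phi>' W1)
      (auto simp: Nr_def)
  have "Kx \<subseteq> Nr" using r by (force simp: Nr_def)
  have "Kz \<subseteq> G"
  proof
    fix z assume z: "z \<in> Kz"
    then obtain t where t: "t \<in> {- A..B}" "z = of_real t" by (auto simp: Kz_def)
    have "\<phi> z \<in> Nr" using \<phi>Kz[OF t(1)] t(2) \<open>Kx \<subseteq> Nr\<close> by auto
    moreover have "norm (deriv \<phi> z) < M" using M0[OF z] by (simp add: M_def)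
    ultimately show "z \<in> G" using z KzW by (auto simp: G_def)
  qed
  then obtain h where h: "0 < h" "strip A B h \<subseteq> G" using strip_subset_open[OF opG] unfolding Kz_def by blast
  define S2 where "S2 = strip A B h"
  have S2: "open S2" "S2 \<subseteq> \<psi> ` S1" using open_strip h by (auto simp: S2_def G_def)
  have \<phi>Nr: "\<phi> z \<in> Nr" and \<phi>'M: "norm (deriv \<phi> z) \<le> M" if "z \<in> S2" for z
    using that h(2) by (auto simp: S2_def G_def)
  have hol\<phi>2: "\<phi> holomorphic_on S2" and hol\<phi>'2: "deriv \<phi> holomorphic_on S2"
    using \<phi>(1) hol\<phi>' S2(2) by (auto intro: holomorphic_on_subset)
  have \<phi>r: "\<phi> (of_real z) \<in> \<real>" if "complex_of_real z \<in> S2" for z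
    using \<phi>Kz[of z] that by (auto simp: S2_def Kx_def)
  define X where "X = (\<lambda>z. Re (\<phi> (complex_of_real z)))"
  define X' where "X' = (\<lambda>z. Re (deriv \<phi> (complex_of_real z)))"
  have inS2: "complex_of_real z \<in> S2" if "z \<in> {- A<..<B}" for z using that h by (simp add: S2_def)
  have \<phi>X: "\<phi> (of_real z) = of_real (X z)" if "z \<in> {- A<..<B}" for z using \<phi>r[OF inS2[OF that]] by (simp add: X_def)
  have Xd: "(X has_real_derivative X' z) (at z)" and \<phi>'X: "deriv \<phi> (of_real z) = of_real (X' z)" if "z \<in> {- A<..<B}" for z
    using real_on_reals_deriv[OF S2(1) hol\<phi>2 \<phi>r inS2[OF that]] by (simp_all add: X_def[abs_def] X'_def)
  define R where "R = (\<lambda>z y e. deriv \<phi> z * P (\<phi> z, y, e))"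
  define L where "L = M * (2 * KP / \<rho>)"
  define K where "K = M * KP"
  have M: "0 \<le> M" using \<phi>'M[OF inS2[of 0]] AB norm_ge_zero order_trans by (metis greaterThanLessThan_iff neg_less_0_iff_less)
  have KL: "0 \<le> K" "0 \<le> L" using M KP0 \<rho> by (auto simp: K_def L_def)
  define m where "m = A + B + h"
  have m: "0 < m" using AB h by (simp add: m_def)
  define \<kappa> where "\<kappa> = min (\<rho> / (4 * (m * (K + 1)))) (1 / (2 * (m * (L + 1))))"
  have \<kappa>: "0 < \<kappa>" "m * K * \<kappa> \<le> \<rho> / 4" "m * L * \<kappa> \<le> 1 / 2"
  proof -
    show \<kappa>0: "0 < \<kappa>" using m KL \<rho> by (simp add: \<kappa>_def)
    have cancel: "q * (t / (n * q)) = t / n" if "q \<noteq> 0" for q t n :: real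
      using that by simp
    have "m * K * \<kappa> \<le> m * (K + 1) * (\<rho> / (4 * (m * (K + 1))))"
      using m KL \<kappa>0 by (intro mult_mono) (auto simp: \<kappa>_def)
    also have "\<dots> = \<rho> / 4" by (rule cancel) (use m KL in simp)
    finally show "m * K * \<kappa> \<le> \<rho> / 4" .
    have "m * L * \<kappa> \<le> m * (L + 1) * (1 / (2 * (m * (L + 1))))"
      using m KL \<kappa>0 by (intro mult_mono) (auto simp: \<kappa>_def)
    also have "\<dots> = 1 / 2" by (rule cancel) (use m KL in simp)
    finally show "m * L * \<kappa> \<le> 1 / 2" .
  qed
  have "0 < p" using p by simp
  then obtain c0 where c0: "0 < c0"
    "\<And>\<sigma> x. \<sigma> \<in> {0..1} \<Longrightarrow> c0 \<le> x \<Longrightarrow> integral {\<sigma>..1} (\<lambda>r. exp ((\<sigma> ^ p - r ^ p) * x)) \<le> \<kappa>"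
    using integral_exp_power_small[OF _ \<kappa>(1)] by blast
  define c where "c = max c0 (m ^ p / e0 + 1)"
  have c: "0 < c" "c0 \<le> c" "m ^ p / c < e0"
  proof -
    show "0 < c" "c0 \<le> c" using c0 by (auto simp: c_def)
    have "m ^ p / e0 < c" by (simp add: c_def)
    then show "m ^ p / c < e0" using \<open>0 < c\<close> \<rho> by (simp add: field_simps)
  qed
  have nf: "normal_form p R A B h \<rho> e0 K L c \<kappa>"
  proof
    fix z y e :: complex assume z: "z \<in> strip A B h" and y: "norm y \<le> \<rho>" and e: "norm e < e0"
    have zS: "z \<in> S2" using z by (simp add: S2_def)
    have y2: "norm y < 2 * \<rho>" using y \<rho> by simp
    show "norm (R z y e) \<le> K"
      unfolding R_def K_def norm_mult using nearP[OF \<phi>Nr[OF zS] y2 e] \<phi>'M[OF zS] M by (intro mult_mono) auto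
    show "R z y e \<in> \<real>" if real: "z \<in> \<real>" "y \<in> \<real>" "e \<in> \<real>"
    proof -
      obtain t where t: "z = of_real t" using real(1) by (auto elim: Reals_cases)
      then have tI: "t \<in> {- A<..<B}" using z by auto
      show ?thesis unfolding R_def t \<phi>X[OF tI] \<phi>'X[OF tI]
        using P_real[of "of_real (X t)" y e] real nearU[OF \<phi>Nr[OF zS] y2 e] t \<phi>X[OF tI] by (intro Reals_mult) auto
    qed
  next
    fix z y y' e :: complex assume z: "z \<in> strip A B h" and y: "norm y \<le> \<rho>" "norm y' \<le> \<rho>" and e: "norm e < e0"
    have zS: "z \<in> S2" using z by (simp add: S2_def)
    have "norm (P (\<phi> z, y, e) - P (\<phi> z, y', e)) \<le> 2 * KP / \<rho> * norm (y - y')"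
    proof (rule bounded_holomorphic_lipschitz[of "\<lambda>y. P (\<phi> z, y, e)"])
      show "(\<lambda>y. P (\<phi> z, y, e)) holomorphic_on ball 0 (2 * \<rho>)"
        by (intro holomorphic3_on_compose[OF P] holomorphic_intros nearU \<phi>Nr zS e) auto
    qed (use nearP \<phi>Nr zS e \<rho> y in auto)
    then have "norm (deriv \<phi> z) * norm (P (\<phi> z, y, e) - P (\<phi> z, y', e)) \<le> M * (2 * KP / \<rho> * norm (y - y'))"
      using \<phi>'M[OF zS] M by (intro mult_mono) auto
    then show "norm (R z y e - R z y' e) \<le> L * norm (y - y')"
      by (simp add: R_def L_def norm_mult flip: right_diff_distrib)
  next
    have "continuous_on (strip A B h \<times> cball 0 \<rho> \<times> ball 0 e0) (\<lambda>q. deriv \<phi> (fst q) * P (\<phi> (fst q), fst (snd q), snd (snd q)))"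
    proof (intro continuous_intros continuous_on_compose2[OF contP]
        continuous_on_compose2[OF holomorphic_on_imp_continuous_on[OF hol\<phi>'2]]
        continuous_on_compose2[OF holomorphic_on_imp_continuous_on[OF hol\<phi>2]])
      show "(\<lambda>q. (\<phi> (fst q), fst (snd q), snd (snd q))) ` (strip A B h \<times> cball 0 \<rho> \<times> ball 0 e0) \<subseteq> U"
        using \<rho> by (auto simp: S2_def intro!: nearU \<phi>Nr)
    qed (auto simp: S2_def)
    then show "continuous_on (strip A B h \<times> cball 0 \<rho> \<times> ball 0 e0) (\<lambda>(z, y, e). R z y e)"
      by (simp add: R_def case_prod_unfold)
  next
    fix S :: "complex set" and g v e :: "complex \<Rightarrow> complex" assume S: "open S" and hol: "g holomorphic_on S" "v holomorphic_on S" "e holomorphic_on S"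
      and sub: "\<And>t. t \<in> S \<Longrightarrow> g t \<in> strip A B h \<and> norm (v t) \<le> \<rho> \<and> norm (e t) < e0"
    have gS: "g ` S \<subseteq> S2" using sub by (auto simp: S2_def)
    have 1: "(\<lambda>t. \<phi> (g t)) holomorphic_on S" "(\<lambda>t. deriv \<phi> (g t)) holomorphic_on S"
      using holomorphic_on_compose_gen[OF hol(1) hol\<phi>2 gS] holomorphic_on_compose_gen[OF hol(1) hol\<phi>'2 gS] by (simp_all add: o_def)
    have "(\<lambda>t. P (\<phi> (g t), v t, e t)) holomorphic_on S"
      by (rule holomorphic3_on_compose[OF P S 1(1) hol(2,3)])
        (rule nearU, use sub gS \<phi>Nr \<rho> in \<open>force+\<close>)
    then show "(\<lambda>t. R (g t) (v t) (e t)) holomorphic_on S"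
      unfolding R_def by (intro holomorphic_on_mult 1(2))
  next
    show "integral {\<sigma>..1} (\<lambda>r. exp ((\<sigma> ^ p - r ^ p) * x)) \<le> \<kappa>" if "\<sigma> \<in> {0..1}" "c \<le> x" for \<sigma> x
      using c0(2)[OF that(1)] that(2) c(2) by simp
  qed (use p AB h \<rho> KL c \<kappa> in \<open>auto simp: m_def\<close>)
  interpret normal_form p R A B h \<rho> e0 K L c \<kappa> by (rule nf)
  have sub_ab: "x \<in> {a2..b2}" if "x \<in> {a..b}" for x using that ab2 by auto
  have Zr: "Z x \<in> {- A<..<B}" if "x \<in> {a..b}" for x
    using Zmono[of a2 x] Zmono[of x b2] that ab2 ab by (auto simp: A_def B_def)
  have X_Z: "X (Z x) = x" if "x \<in> {a..b}" for x
    using \<phi>(3)[OF inS1[OF sub_ab[OF that]]] \<psi>Z[OF sub_ab[OF that]] by (simp add: X_def)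
  have "normalized_equation p R A B h \<rho> e0 K L c \<kappa> \<Omega> f U P a b X X' Z Z' M"
  proof
    show "of_real (X' z) * f (of_real (X z)) = of_nat p * of_real z ^ (p - 1)" if z: "z \<in> {- A<..<B}" for z
    proof -
      obtain x where x: "x \<in> {a2..b2}" "Z x = z" using surj[of z] z by auto
      have Xx: "X z = x" using \<phi>(3)[OF inS1[OF x(1)]] \<psi>Z[OF x(1)] x(2) by (simp add: X_def)
      have "deriv \<psi> (of_real x) * of_real (X' z) = 1"
        using \<phi>(2)[OF inS1[OF x(1)]] \<psi>Z[OF x(1)] x(2) \<phi>'X[OF z] by simp
      moreover have "f (of_real x) = of_nat p * of_real z ^ (p - 1) * deriv \<psi> (of_real x)"
        using n(8)[of "of_real x"] inS1[OF x(1)] \<psi>Z[OF x(1)] x(2) by (simp add: S1_def)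
      ultimately show ?thesis unfolding Xx by (simp add: mult_ac)
    qed
    show "Z' x * X' (Z x) = 1" if x: "x \<in> {a..b}" for x
    proof -
      have "complex_of_real (Z' x * X' (Z x)) = 1"
        using \<phi>(2)[OF inS1[OF sub_ab[OF x]]] \<psi>Z[OF sub_ab[OF x]] \<psi>'Z[OF sub_ab[OF x]] \<phi>'X[OF Zr[OF x]] by simp
      then show ?thesis by (metis of_real_eq_1_iff)
    qed
    show "R (of_real z) y e = of_real (X' z) * P (of_real (X z), y, e)" if "z \<in> {- A<..<B}" for z and y e :: complex
      using \<phi>X[OF that] \<phi>'X[OF that] by (simp add: R_def)
    show "complex_of_real x \<in> \<Omega> \<and> (complex_of_real x, y, e) \<in> U" if "x \<in> {a..b}" "norm y \<le> \<rho>" "norm e < e0" for x and y e :: complex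
    proof -
      have "complex_of_real x \<in> Nr" using sub_ab[OF that(1)] \<open>Kx \<subseteq> Nr\<close> by (auto simp: Kx_def)
      then show ?thesis using nearU[of "of_real x" y e] that \<rho> \<Omega>(2) by auto
    qed
    show "\<bar>X' z\<bar> \<le> M" if "z \<in> {- A<..<B}" for z
      using \<phi>'M[OF inS2[OF that]] \<phi>'X[OF that] by simp
  qed (use ab U contP Zr Z0 Zmono sub_ab X_Z Zd Xd in auto)
  then show ?thesis by (rule that)
qed

section \<open>Expansions and canards\<close>

text \<open>Optimal truncation: the bound is used for \<open>N \<approx> p / (e L\<^sup>p \<eta>\<^sup>p)\<close>.\<close>

lemma gevrey_zero_imp_exp_small:
  fixes d C L \<eta> :: real and p :: nat
  assumes "0 < p" "0 < C" "0 < L" "0 < \<eta>"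
    and d: "\<And>N. d \<le> C * L ^ N * Gamma (real N / real p + 1) * \<eta> ^ N"
  shows "d \<le> C * exp 1 * exp (- (1 / (exp 1 * L ^ p)) / \<eta> ^ p)"
proof -
  define q where "q = L ^ p * \<eta> ^ p"
  have q: "q > 0" using assms by (simp add: q_def)
  \<comment> \<open>Only the indices N = p k are used, for which the Gamma factor is k!. Then k! q^k
    \<le> (q k)^k \<le> exp(-k), and rounding k down costs the factor e.\<close>
  define k where "k = nat \<lfloor>1 / (exp 1 * q)\<rfloor>"
  have "0 \<le> 1 / (exp 1 * q)" using q by simp
  then have "real k = of_int \<lfloor>1 / (exp 1 * q)\<rfloor>" unfolding k_def by (subst of_nat_nat) auto
  then have k: "real k \<le> 1 / (exp 1 * q)" "1 / (exp 1 * q) - 1 \<le> real k" by linarith+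
  have "d \<le> C * L ^ (p * k) * Gamma (real (p * k) / real p + 1) * \<eta> ^ (p * k)" by (rule d)
  also have "Gamma (real (p * k) / real p + 1) = fact k"
    using assms(1) Gamma_fact[of k] by (simp add: add.commute)
  also have "C * L ^ (p * k) * fact k * \<eta> ^ (p * k) = C * (q ^ k * fact k)"
    by (simp add: q_def power_mult power_mult_distrib)
  also have "\<dots> \<le> C * (exp 1 * exp (- (1 / (exp 1 * q))))"
  proof (rule mult_left_mono)
    have "q ^ k * fact k \<le> q ^ k * real k ^ k"
    proof (rule mult_left_mono)
      have "(fact k :: real) \<le> of_nat (k ^ k)" by (rule fact_le_power)
      then show "(fact k :: real) \<le> real k ^ k" by simp
    qed (use q in simp)
    also have "\<dots> = (q * real k) ^ k" by (simp add: power_mult_distrib)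
    also have "\<dots> \<le> (exp (- 1)) ^ k"
    proof (rule power_mono)
      have "q * real k \<le> q * (1 / (exp 1 * q))" using k(1) q by (intro mult_left_mono) auto
      also have "\<dots> = exp (- 1)" using q by (simp add: exp_minus field_simps)
      finally show "q * real k \<le> exp (- 1)" .
    qed (use q in simp)
    also have "\<dots> = exp (- real k)" by (simp flip: exp_of_nat_mult)
    also have "\<dots> \<le> exp (1 - 1 / (exp 1 * q))" using k(2) by simp
    also have "\<dots> = exp 1 * exp (- (1 / (exp 1 * q)))" by (simp flip: exp_add)
    finally show "q ^ k * fact k \<le> exp 1 * exp (- (1 / (exp 1 * q)))" .
  qed (use assms in simp)
  also have "\<dots> = C * exp 1 * exp (- (1 / (exp 1 * L ^ p)) / \<eta> ^ p)" by (simp add: q_def)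
  finally show ?thesis .
qed

lemma exp_minus_inverse_le:
  fixes \<alpha> x :: real
  assumes "0 < \<alpha>" "0 < x"
  shows "exp (- \<alpha> / x) \<le> fact N * (x / \<alpha>) ^ N"
proof -
  define t where "t = \<alpha> / x"
  have t: "t > 0" using assms by (simp add: t_def)
  have "t ^ N / fact N \<le> exp t"
  proof -
    have "(\<Sum>n\<in>{N}. t ^ n /\<^sub>R fact n) \<le> exp t"
      unfolding exp_def using t by (intro sum_le_suminf summable_exp_generic) auto
    then show ?thesis by (simp add: field_simps)
  qed
  then have "exp (- t) \<le> fact N / t ^ N"
    using t by (simp add: exp_minus field_simps)
  then show ?thesis by (simp add: t_def power_divide)
qed

text \<open>Uniqueness of asymptotic expansions: once the lower coefficients vanish, the estimate
  with N = n + 1 leaves norm (d n) \<le> M \<eta>.\<close>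

lemma coefficients_eq_0:
  fixes d :: "nat \<Rightarrow> complex"
  assumes "\<And>N. \<exists>M. \<forall>\<^sub>F \<eta> in at_right (0::real). norm (\<Sum>n = 1..<N. d n * of_real \<eta> ^ n) \<le> M * \<eta> ^ N"
    and "1 \<le> n"
  shows "d n = 0"
  using assms(2)
proof (induction n rule: less_induct)
  case (less n)
  obtain M where M: "\<forall>\<^sub>F \<eta> in at_right (0::real). norm (\<Sum>k = 1..<Suc n. d k * of_real \<eta> ^ k) \<le> M * \<eta> ^ Suc n"
    using assms(1) by blast
  have eq: "(\<Sum>k = 1..<Suc n. d k * of_real \<eta> ^ k) = d n * of_real \<eta> ^ n" for \<eta> :: real
  proof -
    have "(\<Sum>k = 1..<Suc n. d k * of_real \<eta> ^ k) = (\<Sum>k = 1..<n. d k * of_real \<eta> ^ k) + d n * of_real \<eta> ^ n"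
      using less.prems by simp
    also have "(\<Sum>k = 1..<n. d k * of_real \<eta> ^ k) = 0" using less.IH by (intro sum.neutral) auto
    finally show ?thesis by simp
  qed
  have "\<forall>\<^sub>F \<eta> in at_right (0::real). norm (d n) \<le> M * \<eta>"
    using M eventually_at_right_less[of "0::real"]
  proof eventually_elim
    case (elim \<eta>)
    then have "norm (d n) * \<eta> ^ n \<le> (M * \<eta>) * \<eta> ^ n" unfolding eq by (simp add: norm_mult norm_power mult_ac)
    then show ?case using elim by simp
  qed
  moreover have "((\<lambda>\<eta>. M * \<eta>) \<longlongrightarrow> M * 0) (at_right (0::real))" by (intro tendsto_intros)
  ultimately have "norm (d n) \<le> M * 0"
    by (intro tendsto_lowerbound[of "\<lambda>\<eta>. M * \<eta>" _ "at_right (0::real)"]) auto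
  then show ?case by simp
qed

text \<open>The total derivative is given only within the domain of y and \<open>deriv\<close> means
  something only at points of differentiability; an open set \<open>T\<close> inside the slice turns
  the former into a derivative of the slice.\<close>

lemma holomorphic_solution_vector_derivative:
  assumes sol: "holomorphic_solution p \<Omega> f U P S V y" and \<eta>: "\<eta> \<in> S" "\<eta> \<noteq> 0"
    and T: "open T" "complex_of_real x \<in> T" "T \<subseteq> V \<eta>"
  shows "((\<lambda>t. y (of_real t) \<eta>) has_vector_derivative
    f (of_real x) / \<eta> ^ p * y (of_real x) \<eta> + P (of_real x, y (of_real x) \<eta>, \<eta> ^ p)) (at x)"
proof -
  let ?S2 = "{(x, \<eta>). \<eta> \<in> S \<and> x \<in> V \<eta>}"
  have xV: "of_real x \<in> V \<eta>" using T by auto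
  have hol: "holomorphic2_on (\<lambda>(x, \<eta>). y x \<eta>) ?S2"
    and ode: "\<eta> ^ p * deriv (\<lambda>t. y t \<eta>) (of_real x) = f (of_real x) * y (of_real x) \<eta> + \<eta> ^ p * P (of_real x, y (of_real x) \<eta>, \<eta> ^ p)"
    using sol \<eta>(1) xV unfolding holomorphic_solution_def by blast+
  obtain A B where "((\<lambda>(x, \<eta>). y x \<eta>) has_derivative (\<lambda>(h, k). A * h + B * k)) (at (of_real x, \<eta>) within ?S2)"
    using hol \<eta>(1) xV unfolding holomorphic2_on_def by blast
  then have d: "((\<lambda>(x, \<eta>). y x \<eta>) has_derivative (\<lambda>(h, k). A * h + B * k)) (at (of_real x, \<eta>) within (\<lambda>t. (t, \<eta>)) ` T)"
    by (rule has_derivative_subset) (use \<eta> T in auto)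
  have "((\<lambda>t. (t, \<eta>)) has_derivative (\<lambda>h. (h, 0))) (at (complex_of_real x) within T)"
    by (intro derivative_intros)
  from diff_chain_within[OF this d]
  have "((\<lambda>t. y t \<eta>) has_derivative (\<lambda>h. A * h)) (at (of_real x) within T)"
    by (simp add: o_def)
  then have "((\<lambda>t. y t \<eta>) has_field_derivative A) (at (of_real x))"
    by (simp add: has_field_derivative_def at_within_open[OF T(2,1)])
  then have "((\<lambda>t. y t \<eta>) has_field_derivative deriv (\<lambda>t. y t \<eta>) (of_real x)) (at (of_real x))"
    by (simp add: DERIV_imp_deriv)
  then have "((\<lambda>t. y (of_real t) \<eta>) has_vector_derivative deriv (\<lambda>t. y t \<eta>) (of_real x)) (at x)"
    by (rule has_vector_derivative_real_field)
  moreover have "deriv (\<lambda>t. y t \<eta>) (of_real x) = f (of_real x) / \<eta> ^ p * y (of_real x) \<eta> + P (of_real x, y (of_real x) \<eta>, \<eta> ^ p)"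
  proof -
    have "deriv (\<lambda>t. y t \<eta>) (of_real x) = (\<eta> ^ p * deriv (\<lambda>t. y t \<eta>) (of_real x)) / \<eta> ^ p" using \<eta>(2) by simp
    then show ?thesis unfolding ode using \<eta>(2) by (simp add: add_divide_distrib)
  qed
  ultimately show ?thesis by (simp only:)
qed

lemma real_point_in_interior_quasi_sector:
  assumes "0 < \<gamma>" "0 < \<mu>" "\<bar>x\<bar> < \<mu> \<or> (0 < x \<and> x < r)"
  obtains T where "open T" "complex_of_real x \<in> T" "T \<subseteq> quasi_sector (- \<gamma>) \<gamma> (ereal r) \<mu>"
  using assms(3)
proof
  assume "\<bar>x\<bar> < \<mu>"
  then show ?thesis
    by (intro that[of "ball 0 \<mu>"]) (auto simp: quasi_sector_def)
next
  assume x: "0 < x \<and> x < r"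
  have "isCont Arg (of_real x)" using x by (intro continuous_at_Arg) simp
  then have "(Arg \<longlongrightarrow> Arg (of_real x)) (nhds (of_real x))" by (simp add: isCont_def tendsto_nhds_iff)
  moreover have "Arg (of_real x) = 0" using x by (simp add: Arg_of_real)
  ultimately have "\<forall>\<^sub>F w in nhds (of_real x). - \<gamma> < Arg w" "\<forall>\<^sub>F w in nhds (of_real x). Arg w < \<gamma>"
    using assms(1) by (auto intro: order_tendstoD)
  moreover have "\<forall>\<^sub>F w in nhds (complex_of_real x). w \<in> ball 0 r - {0}"
    by (rule eventually_nhds_in_open) (use x in auto)
  ultimately have "\<forall>\<^sub>F w in nhds (complex_of_real x). w \<in> quasi_sector (- \<gamma>) \<gamma> (ereal r) \<mu>"
    by eventually_elim (auto simp: quasi_sector_def sector_def)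
  then show ?thesis using that unfolding eventually_nhds by blast
qed

lemma canard_on_subset:
  assumes "canard_on \<Omega> f U P I y" "J \<subseteq> I"
  shows "canard_on \<Omega> f U P J y"
proof -
  obtain \<epsilon>1 B where \<epsilon>1: "0 < \<epsilon>1" "\<And>\<epsilon>. \<epsilon> \<in> {0<..\<epsilon>1} \<Longrightarrow> real_solution_on \<Omega> f U P \<epsilon> I (\<lambda>x. y x \<epsilon>)"
    "\<forall>\<epsilon>\<in>{0<..\<epsilon>1}. \<forall>x\<in>I. \<bar>y x \<epsilon>\<bar> \<le> B"
    "closure {(complex_of_real x, complex_of_real (y x \<epsilon>), complex_of_real \<epsilon>) | x \<epsilon>. x \<in> I \<and> \<epsilon> \<in> {0<..\<epsilon>1}} \<subseteq> U"
    using assms(1) unfolding canard_on_def by blast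
  have "real_solution_on \<Omega> f U P \<epsilon> J (\<lambda>x. y x \<epsilon>)" if "\<epsilon> \<in> {0<..\<epsilon>1}" for \<epsilon>
    using \<epsilon>1(2)[OF that] assms(2) unfolding real_solution_on_def
    by (meson has_field_derivative_subset subsetD)
  moreover have "closure {(complex_of_real x, complex_of_real (y x \<epsilon>), complex_of_real \<epsilon>) | x \<epsilon>. x \<in> J \<and> \<epsilon> \<in> {0<..\<epsilon>1}}
      \<subseteq> closure {(complex_of_real x, complex_of_real (y x \<epsilon>), complex_of_real \<epsilon>) | x \<epsilon>. x \<in> I \<and> \<epsilon> \<in> {0<..\<epsilon>1}}"
    by (rule closure_mono) (use assms(2) in auto)
  ultimately show ?thesis
    unfolding canard_on_def using \<epsilon>1 assms(2)
    by (intro exI[of _ \<epsilon>1] exI[of _ B] conjI) (blast | rule order_trans)+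
qed

lemma (in normalized_equation) x_sol_subset: "x_sol \<epsilon> I Y \<Longrightarrow> J \<subseteq> I \<Longrightarrow> x_sol \<epsilon> J Y"
  unfolding x_sol_def by (meson has_vector_derivative_within_subset subsetD)

text \<open>Along \<xi> = \<eta> t it makes Z(\<xi>)^p / \<eta>^p bounded, as is needed to absorb
  the loss in \<open>canard_compare\<close>.\<close>

lemma (in normalized_equation) Z_le_linear:
  obtains d where "0 < d" "\<And>x. 0 \<le> x \<Longrightarrow> x < d \<Longrightarrow> Z x \<le> (\<bar>Z' 0\<bar> + 1) * x"
proof -
  have "(Z has_real_derivative Z' 0) (at 0)" using Z_deriv ab by simp
  then have "((\<lambda>x. (Z x - Z 0) / (x - 0)) \<longlongrightarrow> Z' 0) (at 0)" by (simp add: has_field_derivative_iff)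
  then have "\<forall>\<^sub>F x in at 0. (Z x - Z 0) / (x - 0) < \<bar>Z' 0\<bar> + 1" by (rule order_tendstoD) simp
  then obtain d where d: "0 < d" "\<And>x. x \<noteq> 0 \<Longrightarrow> \<bar>x\<bar> < d \<Longrightarrow> Z x / x < \<bar>Z' 0\<bar> + 1"
    by (auto simp: eventually_at Z_0)
  have "Z x \<le> (\<bar>Z' 0\<bar> + 1) * x" if "0 \<le> x" "x < d" for x
    using d(2)[of x] that Z_0 by (cases "x = 0") (auto simp: divide_less_eq less_imp_le)
  then show ?thesis using that d(1) by blast
qed

lemma gevrey_combined_expansion_remainder:
  assumes "gevrey_combined_expansion p S V D W y u g"
  obtains C L where "0 < C" "0 < L" "\<And>N \<eta> x. \<eta> \<in> S \<Longrightarrow> x \<in> V \<eta> \<Longrightarrow>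
      norm (y x \<eta> - (\<Sum>n = 1..<N. (u n x + g n (x / \<eta>)) * \<eta> ^ n))
        \<le> C * L ^ N * Gamma (real N / real p + 1) * norm \<eta> ^ N"
proof -
  obtain C L where "C > 0" "L > 0" and "\<forall>N. \<forall>\<eta>\<in>S. \<forall>x\<in>V \<eta>.
         norm (y x \<eta> - (\<Sum>n = 1..<N. (u n x + g n (x / \<eta>)) * \<eta> ^ n))
           \<le> C * L ^ N * Gamma (real N / real p + 1) * norm \<eta> ^ N"
    using assms unfolding gevrey_combined_expansion_def by (elim conjE exE) (rule that)
  then show ?thesis by (intro that[of C L]) simp_all
qed

theorem mainTheorem6:
  fixes a b :: real and p :: nat
    and \<Omega> :: "complex set" and f :: "complex \<Rightarrow> complex"
    and U :: "(complex \<times> complex \<times> complex) set"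
    and P :: "complex \<times> complex \<times> complex \<Rightarrow> complex"
    and \<delta> \<gamma> x\<^sub>0 \<mu> \<eta>\<^sub>0 :: real
    and S W :: "complex set" and V :: "complex \<Rightarrow> complex set"
    and y_plus y_minus :: "complex \<Rightarrow> complex \<Rightarrow> complex"
    and u g_plus g_minus :: "nat \<Rightarrow> complex \<Rightarrow> complex"
  assumes "a < 0" and "0 < b" and "even p" and "p \<ge> 4"
    and "open \<Omega>" and "complex_of_real ` {a..b} \<subseteq> \<Omega>" and "f holomorphic_on \<Omega>"
    and "\<And>x::real. complex_of_real x \<in> \<Omega> \<Longrightarrow> f (complex_of_real x) \<in> \<real>"
    and "\<And>x::real. x \<in> {a..b} - {0} \<Longrightarrow> x * Re (f (complex_of_real x)) > 0"
    and "\<exists>h. h \<in> O[at 0](\<lambda>x::complex. x) \<and>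
           (\<forall>\<^sub>F x in at 0. f x = of_nat p * x ^ (p - 1) * (1 + h x))"
    and "open U" and "(complex_of_real ` {a..b}) \<times> {0} \<times> {0} \<subseteq> U" and "holomorphic3_on P U"
    and "\<And>x y \<epsilon>. \<lbrakk>x \<in> \<real>; y \<in> \<real>; \<epsilon> \<in> \<real>; (x, y, \<epsilon>) \<in> U\<rbrakk> \<Longrightarrow> P (x, y, \<epsilon>) \<in> \<real>"
    and "\<delta> > 0" and "\<gamma> > 0" and "x\<^sub>0 > 0" and "\<mu> > 0" and "\<eta>\<^sub>0 > 0" and "\<mu> * \<eta>\<^sub>0 \<le> x\<^sub>0"
    and S_def: "S = sector (- \<delta>) \<delta> (ereal \<eta>\<^sub>0)"
    and V_def: "V = (\<lambda>\<eta>. quasi_sector (- \<gamma>) \<gamma> (ereal x\<^sub>0) (\<mu> * norm \<eta>))"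
    and W_def: "W = quasi_sector (- \<gamma> - \<delta>) (\<gamma> + \<delta>) \<infinity> \<mu>"
    and "holomorphic_solution p \<Omega> f U P S V y_plus"
    and "holomorphic_solution p \<Omega> f U P S (\<lambda>\<eta>. uminus ` V \<eta>) y_minus"
    and "gevrey_combined_expansion p S V (ball 0 x\<^sub>0) W y_plus u g_plus"
    and "gevrey_combined_expansion p S (\<lambda>\<eta>. uminus ` V \<eta>) (ball 0 x\<^sub>0) (uminus ` W) y_minus u g_minus"
  shows "((\<exists>y. local_canard \<Omega> f U P y) \<longleftrightarrow> (\<exists>y. global_canard \<Omega> f U P a b y)) \<and>
    ((\<exists>y. global_canard \<Omega> f U P a b y) \<longleftrightarrow> (\<forall>n\<ge>1. \<forall>\<^sub>F X in nhds 0. g_minus n X = g_plus n X)) \<and>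
    ((\<forall>n\<ge>1. \<forall>\<^sub>F X in nhds 0. g_minus n X = g_plus n X) \<longleftrightarrow> (\<forall>n\<ge>1. g_minus n 0 = g_plus n 0))"
proof -
  note ab = assms(1,2) and p = assms(3,4)
  note pars = assms(15-19)
  note sol_plus = assms(24) and sol_minus = assms(25) and gev_plus = assms(26) and gev_minus = assms(27)
  have p2: "2 \<le> p" "0 < p" using p by auto
  obtain R A B h \<rho> e0 K L c \<kappa> X X' Z Z' M where
    "normalized_equation p R A B h \<rho> e0 K L c \<kappa> \<Omega> f U P a b X X' Z Z' M"
    using normalized_equation_exists[OF ab p(1) p2(1) assms(5-14)] by blast
  then interpret ne: normalized_equation p R A B h \<rho> e0 K L c \<kappa> \<Omega> f U P a b X X' Z Z' M .

  \<comment> \<open>The difference of the two expansions\<close>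
  obtain C1 L1 where C1: "0 < C1" "0 < L1" "\<And>N \<eta> x. \<eta> \<in> S \<Longrightarrow> x \<in> V \<eta> \<Longrightarrow>
      norm (y_plus x \<eta> - (\<Sum>n = 1..<N. (u n x + g_plus n (x / \<eta>)) * \<eta> ^ n))
        \<le> C1 * L1 ^ N * Gamma (real N / real p + 1) * norm \<eta> ^ N"
    by (rule gevrey_combined_expansion_remainder[OF gev_plus]) (rule that)
  obtain C2 L2 where C2: "0 < C2" "0 < L2" "\<And>N \<eta> x. \<eta> \<in> S \<Longrightarrow> x \<in> uminus ` V \<eta> \<Longrightarrow>
      norm (y_minus x \<eta> - (\<Sum>n = 1..<N. (u n x + g_minus n (x / \<eta>)) * \<eta> ^ n))
        \<le> C2 * L2 ^ N * Gamma (real N / real p + 1) * norm \<eta> ^ N"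
    by (rule gevrey_combined_expansion_remainder[OF gev_minus]) (rule that)
  have fast: "g_plus n \<in> fast_functions W" "g_minus n \<in> fast_functions (uminus ` W)" if "1 \<le> n" for n
    using gev_plus gev_minus that unfolding gevrey_combined_expansion_def by (elim conjE, simp)+
  have Gam: "0 < Gamma (real N / real p + 1)" for N by (intro Gamma_real_pos) (simp add: add_nonneg_pos)
  define C3 where "C3 = C1 + C2"
  define L3 where "L3 = max L1 L2"
  have C3: "0 < C3" "0 < L3" using C1 C2 by (auto simp: C3_def L3_def)
  \<comment> \<open>The slow parts \<open>u n\<close> are common to both sides and cancel, so that
    only the fast parts remain.\<close>
  have diff: "norm (y_plus x \<eta> - y_minus x \<eta> - (\<Sum>n = 1..<N. (g_plus n (x / \<eta>) - g_minus n (x / \<eta>)) * \<eta> ^ n))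
      \<le> C3 * L3 ^ N * Gamma (real N / real p + 1) * norm \<eta> ^ N"
    if "\<eta> \<in> S" "x \<in> V \<eta>" "x \<in> uminus ` V \<eta>" for N \<eta> x
  proof -
    let ?G = "Gamma (real N / real p + 1) * norm \<eta> ^ N"
    let ?A = "y_plus x \<eta> - (\<Sum>n = 1..<N. (u n x + g_plus n (x / \<eta>)) * \<eta> ^ n)"
    let ?B = "y_minus x \<eta> - (\<Sum>n = 1..<N. (u n x + g_minus n (x / \<eta>)) * \<eta> ^ n)"
    have G: "0 \<le> ?G" using Gam[of N] by simp
    have "norm ?A \<le> C1 * L1 ^ N * ?G" using C1(3)[OF that(1,2), of N] by (simp add: mult.assoc)
    also have "\<dots> \<le> C1 * L3 ^ N * ?G" using C1 C2 G
      by (intro mult_right_mono mult_left_mono power_mono) (auto simp: L3_def)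
    finally have 1: "norm ?A \<le> C1 * L3 ^ N * ?G" .
    have "norm ?B \<le> C2 * L2 ^ N * ?G" using C2(3)[OF that(1,3), of N] by (simp add: mult.assoc)
    also have "\<dots> \<le> C2 * L3 ^ N * ?G" using C1 C2 G
      by (intro mult_right_mono mult_left_mono power_mono) (auto simp: L3_def)
    finally have 2: "norm ?B \<le> C2 * L3 ^ N * ?G" .
    have "y_plus x \<eta> - y_minus x \<eta> - (\<Sum>n = 1..<N. (g_plus n (x / \<eta>) - g_minus n (x / \<eta>)) * \<eta> ^ n) = ?A - ?B"
    proof -
      have "(\<Sum>n = 1..<N. (g_plus n (x / \<eta>) - g_minus n (x / \<eta>)) * \<eta> ^ n)
          = (\<Sum>n = 1..<N. (u n x + g_plus n (x / \<eta>)) * \<eta> ^ n) - (\<Sum>n = 1..<N. (u n x + g_minus n (x / \<eta>)) * \<eta> ^ n)"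
        unfolding sum_subtractf[symmetric] by (intro sum.cong refl) (simp add: algebra_simps)
      then show ?thesis by simp
    qed
    then have "norm (y_plus x \<eta> - y_minus x \<eta> - (\<Sum>n = 1..<N. (g_plus n (x / \<eta>) - g_minus n (x / \<eta>)) * \<eta> ^ n))
        \<le> norm ?A + norm ?B" by (simp only: norm_triangle_ineq4)
    also have "\<dots> \<le> C1 * L3 ^ N * ?G + C2 * L3 ^ N * ?G" using 1 2 by (rule add_mono)
    also have "\<dots> = C3 * L3 ^ N * Gamma (real N / real p + 1) * norm \<eta> ^ N" by (simp add: C3_def algebra_simps)
    finally show ?thesis .
  qed
  \<comment> \<open>The remainder estimate with N = 1 has an empty sum and reads norm y \<le>
    \<gamma>1 \<eta>. With \<eta> < \<eta>1 the solutions stay in the ball of radius \<rho>, and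
    \<eta>^p \<le> \<eta> < e0.\<close>
  define \<gamma>1 where "\<gamma>1 = C1 * L1 * Gamma (1 / real p + 1)"
  define \<gamma>2 where "\<gamma>2 = C2 * L2 * Gamma (1 / real p + 1)"
  have \<gamma>12: "0 < \<gamma>1" "0 < \<gamma>2" using C1 C2 Gam[of 1] by (auto simp: \<gamma>1_def \<gamma>2_def)
  define \<eta>1 where "\<eta>1 = Min {1, \<eta>\<^sub>0, \<rho> / \<gamma>1, \<rho> / \<gamma>2, e0}"
  have \<eta>1: "0 < \<eta>1" "\<eta>1 \<le> 1" "\<eta>1 \<le> \<eta>\<^sub>0" "\<eta>1 \<le> \<rho> / \<gamma>1" "\<eta>1 \<le> \<rho> / \<gamma>2" "\<eta>1 \<le> e0"
    using \<gamma>12 ne.pos(4,5) pars(5) unfolding \<eta>1_def by simp_all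
  have \<eta>S: "complex_of_real \<eta> \<in> S" if "0 < \<eta>" "\<eta> < \<eta>1" for \<eta>
    using that \<eta>1 pars by (simp add: S_def sector_def Arg_of_real)
  have \<eta>p: "\<eta> ^ p < e0" if "0 < \<eta>" "\<eta> < \<eta>1" for \<eta>
  proof -
    have "\<eta> ^ p \<le> \<eta> ^ 1" using that \<eta>1 p2 by (intro power_decreasing) auto
    then show ?thesis using that \<eta>1 by simp
  qed

  \<comment> \<open>The two given solutions on the real axis\<close>
  have V_nhd: "\<exists>T. open T \<and> complex_of_real x \<in> T \<and> T \<subseteq> V (of_real \<eta>)" if "0 < \<eta>" "\<bar>x\<bar> < \<mu> * \<eta> \<or> (0 < x \<and> x < x\<^sub>0)" for \<eta> x
    using real_point_in_interior_quasi_sector[of \<gamma> "\<mu> * \<eta>" x x\<^sub>0] that pars unfolding V_def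
    by (metis abs_of_pos mult_pos_pos norm_of_real)
  have V_nhd': "\<exists>T. open T \<and> complex_of_real x \<in> T \<and> T \<subseteq> uminus ` V (of_real \<eta>)"
    if \<eta>x: "0 < \<eta>" "\<bar>x\<bar> < \<mu> * \<eta> \<or> (- x\<^sub>0 < x \<and> x < 0)" for \<eta> x
  proof -
    obtain T where T: "open T" "complex_of_real (- x) \<in> T" "T \<subseteq> V (of_real \<eta>)"
      using V_nhd[of \<eta> "- x"] \<eta>x by auto
    have "complex_of_real x \<in> uminus ` T" using T(2) by (intro image_eqI[of _ _ "of_real (- x)"]) auto
    moreover have "open (uminus ` T)" using T(1) by (rule open_negations)
    moreover have "uminus ` T \<subseteq> uminus ` V (of_real \<eta>)" using T(3) by (rule image_mono)
    ultimately show ?thesis by blast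
  qed
  have plus: "ne.x_sol (\<eta> ^ p) I (\<lambda>x. y_plus (of_real x) (of_real \<eta>))"
    if \<eta>: "0 < \<eta>" "\<eta> < \<eta>1" and I: "\<And>x. x \<in> I \<Longrightarrow> \<bar>x\<bar> < \<mu> * \<eta> \<or> (0 < x \<and> x < x\<^sub>0)" for \<eta> I
    unfolding ne.x_sol_def
  proof (intro ballI conjI)
    fix x assume x: "x \<in> I"
    obtain T where T: "open T" "complex_of_real x \<in> T" "T \<subseteq> V (of_real \<eta>)" using V_nhd[OF \<eta>(1) I[OF x]] by blast
    have "norm (y_plus (of_real x) (of_real \<eta>)) \<le> \<gamma>1 * \<eta>"
      using C1(3)[OF \<eta>S[OF \<eta>], of "of_real x" 1] T \<eta> by (auto simp: \<gamma>1_def)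
    also have "\<dots> \<le> \<gamma>1 * (\<rho> / \<gamma>1)" using \<eta> \<eta>1 \<gamma>12 by (intro mult_left_mono) auto
    finally show "norm (y_plus (of_real x) (of_real \<eta>)) \<le> \<rho>" using \<gamma>12 by simp
    have "((\<lambda>t. y_plus (of_real t) (of_real \<eta>)) has_vector_derivative
        f (of_real x) / of_real \<eta> ^ p * y_plus (of_real x) (of_real \<eta>) + P (of_real x, y_plus (of_real x) (of_real \<eta>), of_real \<eta> ^ p)) (at x)"
      by (rule holomorphic_solution_vector_derivative[OF sol_plus \<eta>S[OF \<eta>] _ T]) (use \<eta> in simp)
    then show "((\<lambda>x. y_plus (of_real x) (of_real \<eta>)) has_vector_derivative
        f (of_real x) / of_real (\<eta> ^ p) * y_plus (of_real x) (of_real \<eta>) + P (of_real x, y_plus (of_real x) (of_real \<eta>), of_real (\<eta> ^ p))) (at x within I)"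
      by (simp add: has_vector_derivative_at_within)
  qed
  have minus: "ne.x_sol (\<eta> ^ p) I (\<lambda>x. y_minus (of_real x) (of_real \<eta>))"
    if \<eta>: "0 < \<eta>" "\<eta> < \<eta>1" and I: "\<And>x. x \<in> I \<Longrightarrow> \<bar>x\<bar> < \<mu> * \<eta> \<or> (- x\<^sub>0 < x \<and> x < 0)" for \<eta> I
    unfolding ne.x_sol_def
  proof (intro ballI conjI)
    fix x assume x: "x \<in> I"
    obtain T where T: "open T" "complex_of_real x \<in> T" "T \<subseteq> uminus ` V (of_real \<eta>)" using V_nhd'[OF \<eta>(1) I[OF x]] by blast
    have "of_real x \<in> uminus ` V (of_real \<eta>)" using T by blast
    then have "norm (y_minus (of_real x) (of_real \<eta>)) \<le> \<gamma>2 * \<eta>"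
      using C2(3)[OF \<eta>S[OF \<eta>], of "of_real x" 1] \<eta> by (simp add: \<gamma>2_def)
    also have "\<dots> \<le> \<gamma>2 * (\<rho> / \<gamma>2)" using \<eta> \<eta>1 \<gamma>12 by (intro mult_left_mono) auto
    finally show "norm (y_minus (of_real x) (of_real \<eta>)) \<le> \<rho>" using \<gamma>12 by simp
    have "((\<lambda>t. y_minus (of_real t) (of_real \<eta>)) has_vector_derivative
        f (of_real x) / of_real \<eta> ^ p * y_minus (of_real x) (of_real \<eta>) + P (of_real x, y_minus (of_real x) (of_real \<eta>), of_real \<eta> ^ p)) (at x)"
      by (rule holomorphic_solution_vector_derivative[OF sol_minus \<eta>S[OF \<eta>] _ T]) (use \<eta> in simp)
    then show "((\<lambda>x. y_minus (of_real x) (of_real \<eta>)) has_vector_derivative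
        f (of_real x) / of_real (\<eta> ^ p) * y_minus (of_real x) (of_real \<eta>) + P (of_real x, y_minus (of_real x) (of_real \<eta>), of_real (\<eta> ^ p))) (at x within I)"
      by (simp add: has_vector_derivative_at_within)
  qed

  \<comment> \<open>The cycle (b), (a), (c), (d), (b) of implications\<close>
  have b_a: "\<exists>y. local_canard \<Omega> f U P y" if g: "\<exists>y. global_canard \<Omega> f U P a b y"
  proof -
    obtain y where "canard_on \<Omega> f U P {a..b} y" using g by (auto simp: global_canard_def)
    then have "canard_on \<Omega> f U P {a<..<b} y" by (rule canard_on_subset) auto
    then show ?thesis using ab by (auto simp: local_canard_def)
  qed
  have d_b: "\<exists>y. global_canard \<Omega> f U P a b y" if d: "\<forall>n\<ge>1. g_minus n 0 = g_plus n 0"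
  proof -
    define x1 where "x1 = min (x\<^sub>0 / 2) (min (- a) b)"
    have x1: "0 < x1" "a \<le> - x1" "x1 \<le> b" "x1 < x\<^sub>0" using ab pars by (auto simp: x1_def)
    define \<alpha> where "\<alpha> = 1 / (exp 1 * L3 ^ p)"
    have \<alpha>: "0 < \<alpha>" using C3 by (simp add: \<alpha>_def)
    show ?thesis
    proof (rule ne.global_canard_exists[OF x1(1-3) \<alpha>, of "\<eta>1 ^ p" "C3 * exp 1"])
      show "0 < \<eta>1 ^ p" using \<eta>1 by simp
      fix \<epsilon> :: real assume \<epsilon>: "0 < \<epsilon>" "\<epsilon> < \<eta>1 ^ p"
      define \<eta> where "\<eta> = root p \<epsilon>"
      have \<eta>\<epsilon>: "\<eta> ^ p = \<epsilon>" and \<eta>0: "0 < \<eta>" using \<epsilon> p2 by (auto simp: \<eta>_def real_root_gt_zero)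
      have \<eta>lt: "\<eta> < \<eta>1" using \<epsilon>(2) \<eta>\<epsilon> \<eta>1 by (metis less_imp_le power_less_imp_less_base)
      have S1: "ne.x_sol \<epsilon> {0..x1} (\<lambda>x. y_plus (of_real x) (of_real \<eta>))"
        unfolding \<eta>\<epsilon>[symmetric] by (rule plus[OF \<eta>0 \<eta>lt]) (use x1 \<eta>0 pars in \<open>auto simp: less_le\<close>)
      have S2: "ne.x_sol \<epsilon> {- x1..0} (\<lambda>x. y_minus (of_real x) (of_real \<eta>))"
        unfolding \<eta>\<epsilon>[symmetric] by (rule minus[OF \<eta>0 \<eta>lt]) (use x1 \<eta>0 pars in \<open>auto simp: less_le\<close>)
      \<comment> \<open>At x = 0 every fast part is evaluated at X = 0, where (d) makes the terms
        cancel: the whole sum disappears for every N, which is the hypothesis of the optimal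
        truncation.\<close>
      have "norm (y_plus 0 (of_real \<eta>) - y_minus 0 (of_real \<eta>)) \<le> C3 * L3 ^ N * Gamma (real N / real p + 1) * \<eta> ^ N" for N
      proof -
        have "(0::complex) \<in> V (of_real \<eta>)" using \<eta>0 pars by (simp add: V_def quasi_sector_def)
        moreover have "(0::complex) \<in> uminus ` V (of_real \<eta>)" using calculation by (intro image_eqI[of _ _ 0]) auto
        moreover have "(\<Sum>n = 1..<N. (g_plus n (0 / of_real \<eta>) - g_minus n (0 / of_real \<eta>)) * of_real \<eta> ^ n) = 0"
          using d by (intro sum.neutral) auto
        ultimately show ?thesis using diff[OF \<eta>S[OF \<eta>0 \<eta>lt], of 0 N] \<eta>0 by simp
      qed
      then have "norm (y_plus 0 (of_real \<eta>) - y_minus 0 (of_real \<eta>)) \<le> C3 * exp 1 * exp (- (1 / (exp 1 * L3 ^ p)) / \<eta> ^ p)"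
        by (rule gevrey_zero_imp_exp_small[OF p2(2) C3 \<eta>0])
      then show "\<exists>Y1 Y2. ne.x_sol \<epsilon> {0..x1} Y1 \<and> ne.x_sol \<epsilon> {- x1..0} Y2 \<and> norm (Y1 0 - Y2 0) \<le> C3 * exp 1 * exp (- \<alpha> / \<epsilon>)"
        using S1 S2 unfolding \<eta>\<epsilon> \<alpha>_def[symmetric]
        by (intro exI[of _ "\<lambda>x. y_plus (of_real x) (of_real \<eta>)"] exI[of _ "\<lambda>x. y_minus (of_real x) (of_real \<eta>)"]) simp
    qed
  qed
  have a_c: "\<forall>n\<ge>1. \<forall>\<^sub>F X in nhds 0. g_minus n X = g_plus n X" if l: "\<exists>y. local_canard \<Omega> f U P y"
  proof -
    obtain y where "local_canard \<Omega> f U P y" using l by blast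
    then obtain x2 \<epsilon>1 where x2: "0 < x2" "a \<le> - x2" "x2 \<le> b" "0 < \<epsilon>1"
      and sol: "\<And>\<epsilon>. 0 < \<epsilon> \<Longrightarrow> \<epsilon> < \<epsilon>1 \<Longrightarrow> ne.x_sol \<epsilon> {- x2..x2} (\<lambda>x. of_real (y x \<epsilon>))"
      using ne.local_canard_small by metis
    define x1 where "x1 = min (x\<^sub>0 / 2) x2"
    have x1: "0 < x1" "a \<le> - x1" "x1 \<le> b" "x1 < x\<^sub>0" "x1 \<le> x2" using x2 pars by (auto simp: x1_def)
    obtain \<alpha> where \<alpha>: "0 < \<alpha>" "\<And>\<epsilon> \<xi> Y Y1 Y2. 0 < \<epsilon> \<Longrightarrow> \<epsilon> < e0 \<Longrightarrow> 0 \<le> \<xi> \<Longrightarrow> \<xi> \<le> x1 \<Longrightarrow> ne.x_sol \<epsilon> {- x1..x1} Y \<Longrightarrow>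
      ne.x_sol \<epsilon> {0..x1} Y1 \<Longrightarrow> ne.x_sol \<epsilon> {- x1..\<xi>} Y2 \<Longrightarrow>
      norm (Y1 \<xi> - Y2 \<xi>) \<le> exp (Z \<xi> ^ p / \<epsilon> - \<alpha> / \<epsilon>) * (4 * \<rho> * exp (L * (A + B)))"
      using ne.canard_compare[OF x1(1-3)] by metis
    obtain dz where dz: "0 < dz" "\<And>x. 0 \<le> x \<Longrightarrow> x < dz \<Longrightarrow> Z x \<le> (\<bar>Z' 0\<bar> + 1) * x" using ne.Z_le_linear by blast
    \<comment> \<open>X = t is fixed while x = \<xi> = \<eta> t shrinks with \<eta>. As \<xi> <
      \<mu> \<eta>, both solutions are defined at \<xi>, the left one reaching slightly to the right
      of 0. Their difference is exponentially small by comparison with the canard, hence below every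
      power of \<eta>.\<close>
    have eq_real: "g_plus n (of_real t) - g_minus n (of_real t) = 0" if t: "0 < t" "t < \<mu>" and n: "1 \<le> n" for t n
    proof (rule coefficients_eq_0[OF _ n])
      fix N
      define q where "q = exp (((\<bar>Z' 0\<bar> + 1) * t) ^ p) * (4 * \<rho> * exp (L * (A + B)))"
      define M1 where "M1 = C3 * L3 ^ N * Gamma (real N / real p + 1) + q * (fact N * (1 / \<alpha>) ^ N)"
      have lim1: "((\<lambda>\<eta>. \<eta> ^ p) \<longlongrightarrow> 0 ^ p) (at_right (0::real))" and lim2: "((\<lambda>\<eta>. \<eta> * t) \<longlongrightarrow> 0 * t) (at_right (0::real))"
        by (intro tendsto_intros)+
      have lim1': "((\<lambda>\<eta>. \<eta> ^ p) \<longlongrightarrow> 0) (at_right (0::real))" using lim1 p2 by (simp add: power_0_left)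
      have lim2': "((\<lambda>\<eta>. \<eta> * t) \<longlongrightarrow> 0) (at_right (0::real))" using lim2 by simp
      have id: "((\<lambda>\<eta>. \<eta>) \<longlongrightarrow> 0) (at_right (0::real))" by (rule tendsto_ident_at)
      have "\<forall>\<^sub>F \<eta> in at_right (0::real). norm (\<Sum>n = 1..<N. (g_plus n (of_real t) - g_minus n (of_real t)) * of_real \<eta> ^ n) \<le> M1 * \<eta> ^ N"
        using eventually_at_right_less[of "0::real"] order_tendstoD(2)[OF id \<eta>1(1)] order_tendstoD(2)[OF lim1' x2(4)]
          order_tendstoD(2)[OF lim2' x1(1)] order_tendstoD(2)[OF lim2' dz(1)]
      proof eventually_elim
        case (elim \<eta>)
        define \<xi> where "\<xi> = \<eta> * t"
        have \<xi>: "0 \<le> \<xi>" "\<xi> \<le> x1" "\<xi> < dz" "\<xi> < \<mu> * \<eta>" "0 < \<xi>" using elim t by (auto simp: \<xi>_def)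
        have \<eta>: "0 < \<eta>" "\<eta> < \<eta>1" using elim by auto
        have \<epsilon>: "0 < \<eta> ^ p" "\<eta> ^ p < e0" using \<eta> \<eta>p by auto
        have "norm (y_plus (of_real \<xi>) (of_real \<eta>) - y_minus (of_real \<xi>) (of_real \<eta>))
            \<le> exp (Z \<xi> ^ p / \<eta> ^ p - \<alpha> / \<eta> ^ p) * (4 * \<rho> * exp (L * (A + B)))"
        proof (rule \<alpha>(2)[OF \<epsilon> \<xi>(1,2)])
          show "ne.x_sol (\<eta> ^ p) {- x1..x1} (\<lambda>x. of_real (y x (\<eta> ^ p)))"
            by (rule ne.x_sol_subset[OF sol]) (use \<epsilon> elim x1 in auto)
          show "ne.x_sol (\<eta> ^ p) {0..x1} (\<lambda>x. y_plus (of_real x) (of_real \<eta>))"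
            by (rule plus[OF \<eta>]) (use x1 \<eta> pars in \<open>auto simp: less_le\<close>)
          show "ne.x_sol (\<eta> ^ p) {- x1..\<xi>} (\<lambda>x. y_minus (of_real x) (of_real \<eta>))"
            by (rule minus[OF \<eta>]) (use x1 \<eta> \<xi> in \<open>auto simp: abs_less_iff\<close>)
        qed
        also have "\<dots> \<le> q * exp (- \<alpha> / \<eta> ^ p)"
        proof -
          have "0 \<le> Z \<xi>" using ne.Z_sign(1)[of \<xi>] \<xi> x1 ab by auto
          then have "Z \<xi> ^ p \<le> ((\<bar>Z' 0\<bar> + 1) * \<xi>) ^ p" using dz(2)[OF \<xi>(1,3)] by (intro power_mono) auto
          also have "\<dots> = ((\<bar>Z' 0\<bar> + 1) * t) ^ p * \<eta> ^ p" by (simp add: \<xi>_def power_mult_distrib)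
          finally have "Z \<xi> ^ p / \<eta> ^ p \<le> ((\<bar>Z' 0\<bar> + 1) * t) ^ p" using \<epsilon>(1) by (simp add: divide_le_eq)
          then have "exp (Z \<xi> ^ p / \<eta> ^ p - \<alpha> / \<eta> ^ p) \<le> exp (((\<bar>Z' 0\<bar> + 1) * t) ^ p) * exp (- \<alpha> / \<eta> ^ p)"
            by (simp flip: exp_add)
          then have "exp (Z \<xi> ^ p / \<eta> ^ p - \<alpha> / \<eta> ^ p) * (4 * \<rho> * exp (L * (A + B)))
              \<le> exp (((\<bar>Z' 0\<bar> + 1) * t) ^ p) * exp (- \<alpha> / \<eta> ^ p) * (4 * \<rho> * exp (L * (A + B)))"
            using ne.pos by (intro mult_right_mono) auto
          then show ?thesis by (simp add: q_def mult_ac)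
        qed
        also have "\<dots> \<le> q * (fact N * (1 / \<alpha>) ^ N * \<eta> ^ N)"
        proof (rule mult_left_mono)
          have "exp (- \<alpha> / \<eta> ^ p) \<le> fact N * (\<eta> ^ p / \<alpha>) ^ N" by (rule exp_minus_inverse_le[OF \<alpha>(1) \<epsilon>(1)])
          also have "\<dots> \<le> fact N * (\<eta> / \<alpha>) ^ N"
          proof -
            have "\<eta> ^ p \<le> \<eta> ^ 1" using \<eta> \<eta>1 p2 by (intro power_decreasing) auto
            then show ?thesis using \<alpha>(1) \<epsilon>(1) by (intro mult_left_mono power_mono divide_right_mono) auto
          qed
          finally show "exp (- \<alpha> / \<eta> ^ p) \<le> fact N * (1 / \<alpha>) ^ N * \<eta> ^ N" by (simp add: power_divide)
          show "0 \<le> q" using ne.pos by (simp add: q_def)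
        qed
        finally have 1: "norm (y_plus (of_real \<xi>) (of_real \<eta>) - y_minus (of_real \<xi>) (of_real \<eta>)) \<le> q * (fact N * (1 / \<alpha>) ^ N * \<eta> ^ N)" .
        obtain T1 where "complex_of_real \<xi> \<in> T1" "T1 \<subseteq> V (of_real \<eta>)" using V_nhd[of \<eta> \<xi>] \<eta> \<xi> by auto
        moreover obtain T2 where "complex_of_real \<xi> \<in> T2" "T2 \<subseteq> uminus ` V (of_real \<eta>)" using V_nhd'[of \<eta> \<xi>] \<eta> \<xi> by auto
        ultimately have inV: "complex_of_real \<xi> \<in> V (of_real \<eta>)" "complex_of_real \<xi> \<in> uminus ` V (of_real \<eta>)" by blast+
        have "complex_of_real \<xi> / of_real \<eta> = of_real t" using \<eta> by (simp add: \<xi>_def)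
        then have 2: "norm (y_plus (of_real \<xi>) (of_real \<eta>) - y_minus (of_real \<xi>) (of_real \<eta>)
            - (\<Sum>n = 1..<N. (g_plus n (of_real t) - g_minus n (of_real t)) * of_real \<eta> ^ n))
            \<le> C3 * L3 ^ N * Gamma (real N / real p + 1) * \<eta> ^ N"
          using diff[OF \<eta>S[OF \<eta>] inV, of N] \<eta> by simp
        show "norm (\<Sum>n = 1..<N. (g_plus n (of_real t) - g_minus n (of_real t)) * of_real \<eta> ^ n) \<le> M1 * \<eta> ^ N"
          using norm_triangle_sub[of "\<Sum>n = 1..<N. (g_plus n (of_real t) - g_minus n (of_real t)) * of_real \<eta> ^ n"
              "y_plus (of_real \<xi>) (of_real \<eta>) - y_minus (of_real \<xi>) (of_real \<eta>)"] 1 2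
          unfolding norm_minus_commute[of "\<Sum>n = 1..<N. (g_plus n (of_real t) - g_minus n (of_real t)) * of_real \<eta> ^ n"]
          by (simp add: M1_def algebra_simps)
      qed
      then show "\<exists>M. \<forall>\<^sub>F \<eta> in at_right 0. norm (\<Sum>n = 1..<N. (g_plus n (of_real t) - g_minus n (of_real t)) * of_real \<eta> ^ n) \<le> M * \<eta> ^ N"
        by blast
    qed
    show ?thesis
    proof (intro allI impI)
      fix n :: nat assume n: "1 \<le> n"
      have sub: "ball 0 \<mu> \<subseteq> W" by (auto simp: W_def quasi_sector_def)
      have sub': "ball 0 \<mu> \<subseteq> uminus ` W"
      proof
        fix w :: complex assume "w \<in> ball 0 \<mu>"
        then have "- w \<in> W" using sub by auto
        then show "w \<in> uminus ` W" by (intro image_eqI[of _ _ "- w"]) auto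
      qed
      have hol: "(\<lambda>w. g_plus n w - g_minus n w) holomorphic_on ball 0 \<mu>"
        using fast[OF n] sub sub' unfolding fast_functions_def
        by (intro holomorphic_intros) (auto intro: holomorphic_on_subset)
      \<comment> \<open>Equality on the real segment spreads to the disc, where both functions are
        holomorphic.\<close>
      have "g_plus n w - g_minus n w = 0" if w: "w \<in> ball 0 \<mu>" for w
      proof (rule analytic_continuation[where f="\<lambda>w. g_plus n w - g_minus n w", OF hol open_ball connected_ball _ _ _ _ w])
        show "complex_of_real ` {0<..<\<mu>} \<subseteq> ball 0 \<mu>" by auto
        show "(0::complex) \<in> ball 0 \<mu>" using pars by simp
        show "0 islimpt complex_of_real ` {0<..<\<mu>}"
        proof (subst islimpt_approachable, intro allI impI)
          fix e :: real assume "e > 0"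
          define x where "x = min \<mu> e / 2"
          have "x > 0" "x < \<mu>" "x < e" using pars \<open>e > 0\<close> by (auto simp: x_def)
          then show "\<exists>x'\<in>complex_of_real ` {0<..<\<mu>}. x' \<noteq> 0 \<and> dist x' 0 < e"
            by (intro bexI[of _ "of_real x"]) auto
        qed
        show "g_plus n z - g_minus n z = 0" if "z \<in> complex_of_real ` {0<..<\<mu>}" for z
          using that eq_real n by auto
      qed
      then have "\<forall>w\<in>ball 0 \<mu>. g_minus n w = g_plus n w" by auto
      moreover have "\<forall>\<^sub>F w in nhds 0. w \<in> ball (0::complex) \<mu>" by (rule eventually_nhds_in_open) (use pars in auto)
      ultimately show "\<forall>\<^sub>F X in nhds 0. g_minus n X = g_plus n X" by (auto elim: eventually_mono)
    qed
  qed
  have c_d: "\<forall>n\<ge>1. g_minus n 0 = g_plus n 0" if "\<forall>n\<ge>1. \<forall>\<^sub>F X in nhds 0. g_minus n X = g_plus n X"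
    using that eventually_nhds_x_imp_x by fast
  show ?thesis using b_a d_b a_c c_d by blast
qed

end
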